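(* Let $\Omega\subset\mathbb{R}^2$ be a bounded simply connected domain and $\psi:\partial\Omega\to\mathbb{R}$ a continuous function such that $(\Omega,\psi)$ satisfies a bounded slope condition. Let $f$ be an admissible Lagrangean, and suppose $f$ is approximated, uniformly on $[0,\infty)$, by a sequence of functions $f_n$, $n\in\mathbb{N}$, each strictly convex, in $C^1([0,+\infty))\cap C^{2,\lambda}_{loc}((0,+\infty))$, with $f_n'(0)=0$. Let $u_n$ be the minimizer of $\int_\Omega f_n(|\nabla w|)\,dx\,dy$ among $w\in\mathrm{Lip}(\overline\Omega)$ with $w=\psi$ on $\partial\Omega$, and let $v_n$ be the unique Lipschitz continuous function with $\int_\Omega v_n=0$ satisfying, in the sense of distributions in $\Omega$, $$\partial_x v_n=-f_n'(|\nabla u_n|)\frac{\partial_y u_n}{|\nabla u_n|},\qquad \partial_y v_n=f_n'(|\nabla u_n|)\frac{\partial_x u_n}{|\nabla u_n|}.$$ Assume that, for each $n$, $\rho f_n''(\rho)/f_n'(\rho)$ converges to a positive constant as $\rho\to0^+$, and let $\alpha_n(\rho)=\rho f_n''(\rho)/f_n'(\rho)$ for $\rho>0$, $\alpha_n(0)=\lim_{\rho\to0^+}\rho f_n''(\rho)/f_n'(\rho)$. Let $g_n'$ be the inverse function of $f_n'$, and assume that $\alpha_n\circ g_n'$ converges to a function $\beta$ uniformly on the compact subsets of $[0,+\infty)$. Then the sequence $(v_n)_{n\in\mathbb{N}}$ contains a subsequence that converges uniformly in $\Omega$ to a viscosity solution $v$ of $$-\big[1-\beta(|\nabla v|)\big]\Delta_\infty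 v-|\nabla v|^2\beta(|\nabla v|)\,\Delta v=0\quad\text{in }\Omega.$$
   Context: An admissible Lagrangean is a function $f:[0,+\infty)\to\mathbb{R}$ that is strictly convex, belongs to $C^1([0,+\infty))\cap C^{2,\lambda}_{loc}((0,+\infty))$ for some $0<\lambda<1$, satisfies $f'(0)>0$, and is such that $\rho f''(\rho)/f'(\rho)$ has finite limits as $\rho\to0^+$ and as $\rho\to+\infty$, the limit at $+\infty$ being strictly positive. $\mathrm{Lip}(\overline\Omega)$ is the space of Lipschitz continuous functions on $\overline\Omega$. The pair $(\Omega,\psi)$ satisfies a bounded slope condition (with constant $Q>0$) if for every $x_0\in\partial\Omega$ there exist two affine functions $L^+,L^-$ such that $L^-\le\psi\le L^+$ on $\partial\Omega$, $L^-(x_0)=\psi(x_0)=L^+(x_0)$, and $\sup_{x,y\in\Omega,\,x\ne y}\frac{|L^\pm(x)-L^\pm(y)|}{|x-y|}\le Q$. The right-hand sides of the system defining $v_n$ are understood to be $0$ where $\nabla u_n=0$. $\Delta_\infty v=\langle\nabla^2v\,\nabla v,\nabla v\rangle$. Viscosity solutions are meant in the usual (Crandall–Ishii–Lions) sense. *)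

theory Defs
  imports "HOL-Analysis.Analysis"
begin

section \<open>Derivatives and function classes\<close>

definition partial :: "2 \<Rightarrow> (real^2 \<Rightarrow> real) \<Rightarrow> real^2 \<Rightarrow> real" where
  "partial i u x = frechet_derivative u (at x) (axis i 1)"

text \<open>At points where \<open>u\<close> is not differentiable the value is unspecified; for a Lipschitz function
  these points form a null set by Rademacher's theorem.\<close>
definition grad :: "(real^2 \<Rightarrow> real) \<Rightarrow> real^2 \<Rightarrow> real^2" where
  "grad u x = (\<chi> i. partial i u x)"

definition hessian :: "(real^2 \<Rightarrow> real) \<Rightarrow> real^2 \<Rightarrow> real^2^2" where
  "hessian u x = jacobian (grad u) (at x)"

text \<open>Meant for open \<open>S\<close>.\<close>
definition C2_on :: "(real^2) set \<Rightarrow> (real^2 \<Rightarrow> real) \<Rightarrow> bool" where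
  "C2_on S u \<longleftrightarrow> (\<forall>x\<in>S. u differentiable (at x)) \<and> (\<forall>x\<in>S. grad u differentiable (at x))
     \<and> continuous_on S (hessian u)"

text \<open>Smoothness is expressed by total differentiability of all iterated partial derivatives.\<close>
definition test_fun :: "(real^2) set \<Rightarrow> (real^2 \<Rightarrow> real) \<Rightarrow> bool" where
  "test_fun S \<phi> \<longleftrightarrow> (\<forall>is x. fold partial is \<phi> differentiable (at x))
     \<and> compact (closure {x. \<phi> x \<noteq> 0}) \<and> closure {x. \<phi> x \<noteq> 0} \<subseteq> S"

definition has_weak_partial ::
    "(real^2) set \<Rightarrow> 2 \<Rightarrow> (real^2 \<Rightarrow> real) \<Rightarrow> (real^2 \<Rightarrow> real) \<Rightarrow> bool" where
  "has_weak_partial S i v h \<longleftrightarrow>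
     (\<forall>K. compact K \<and> K \<subseteq> S \<longrightarrow> set_integrable lebesgue K v \<and> set_integrable lebesgue K h) \<and>
     (\<forall>\<phi>. test_fun S \<phi> \<longrightarrow>
        (LINT x:S|lebesgue. v x * partial i \<phi> x) = - (LINT x:S|lebesgue. h x * \<phi> x))"

definition Lip :: "(real^2) set \<Rightarrow> (real^2 \<Rightarrow> real) set" where
  "Lip S = {w. \<exists>C. C-lipschitz_on S w}"


section \<open>Functions on the half-line\<close>

text \<open>A function on \<open>[0,\<infinity>)\<close> is a total function whose values on the negative half-line are
  irrelevant: the derivative at \<open>0\<close> is one-sided.\<close>
definition hderiv :: "(real \<Rightarrow> real) \<Rightarrow> real \<Rightarrow> real" where
  "hderiv f \<rho> = vector_derivative f (at \<rho> within {0..})"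

definition hderiv2 :: "(real \<Rightarrow> real) \<Rightarrow> real \<Rightarrow> real" where
  "hderiv2 f \<rho> = hderiv (hderiv f) \<rho>"

definition strictly_convex_on :: "real set \<Rightarrow> (real \<Rightarrow> real) \<Rightarrow> bool" where
  "strictly_convex_on S f \<longleftrightarrow> (\<forall>x\<in>S. \<forall>y\<in>S. \<forall>t. x \<noteq> y \<and> 0 < t \<and> t < 1 \<longrightarrow>
     f ((1 - t) * x + t * y) < (1 - t) * f x + t * f y)"

definition C1_halfline :: "(real \<Rightarrow> real) \<Rightarrow> bool" where
  "C1_halfline f \<longleftrightarrow> (\<forall>\<rho>\<ge>0. f differentiable (at \<rho> within {0..})) \<and> continuous_on {0..} (hderiv f)"

definition C2_loc_holder :: "real \<Rightarrow> (real \<Rightarrow> real) \<Rightarrow> bool" where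
  "C2_loc_holder \<kappa> f \<longleftrightarrow>
     (\<forall>\<rho>>0. f differentiable (at \<rho>)) \<and> (\<forall>\<rho>>0. hderiv f differentiable (at \<rho>)) \<and>
     (\<forall>K. compact K \<and> K \<subseteq> {0<..} \<longrightarrow>
        (\<exists>C. \<forall>x\<in>K. \<forall>y\<in>K. \<bar>hderiv2 f x - hderiv2 f y\<bar> \<le> C * \<bar>x - y\<bar> powr \<kappa>))"

definition regular_lagrangean :: "(real \<Rightarrow> real) \<Rightarrow> bool" where
  "regular_lagrangean f \<longleftrightarrow> strictly_convex_on {0..} f \<and> C1_halfline f \<and>
     (\<exists>\<kappa>. 0 < \<kappa> \<and> \<kappa> < 1 \<and> C2_loc_holder \<kappa> f)"

definition log_slope :: "(real \<Rightarrow> real) \<Rightarrow> real \<Rightarrow> real" where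
  "log_slope f \<rho> = \<rho> * hderiv2 f \<rho> / hderiv f \<rho>"

definition admissible_lagrangean :: "(real \<Rightarrow> real) \<Rightarrow> bool" where
  "admissible_lagrangean f \<longleftrightarrow> regular_lagrangean f \<and> hderiv f 0 > 0 \<and>
     (\<exists>l. (log_slope f \<longlongrightarrow> l) (at_right 0)) \<and> (\<exists>l>0. (log_slope f \<longlongrightarrow> l) at_top)"

definition alpha :: "(real \<Rightarrow> real) \<Rightarrow> real \<Rightarrow> real" where
  "alpha f \<rho> = (if \<rho> > 0 then log_slope f \<rho> else Lim (at_right 0) (log_slope f))"

text \<open>The inverse of \<open>f'\<close> on \<open>[0,\<infinity>)\<close>; unspecified outside the range of \<open>f'\<close>.\<close>
definition dual_deriv :: "(real \<Rightarrow> real) \<Rightarrow> real \<Rightarrow> real" where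
  "dual_deriv f = the_inv_into {0..} (hderiv f)"


section \<open>Variational problem and conjugate function\<close>

definition affine_fun :: "(real^2 \<Rightarrow> real) \<Rightarrow> bool" where
  "affine_fun L \<longleftrightarrow> (\<exists>a b. \<forall>x. L x = a \<bullet> x + b)"

definition bounded_slope_condition :: "(real^2) set \<Rightarrow> (real^2 \<Rightarrow> real) \<Rightarrow> real \<Rightarrow> bool" where
  "bounded_slope_condition \<Omega> \<psi> Q \<longleftrightarrow> (\<forall>x0\<in>frontier \<Omega>. \<exists>Lp Lm. affine_fun Lp \<and> affine_fun Lm \<and>
     (\<forall>x\<in>frontier \<Omega>. Lm x \<le> \<psi> x \<and> \<psi> x \<le> Lp x) \<and> Lm x0 = \<psi> x0 \<and> \<psi> x0 = Lp x0 \<and>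
     (\<forall>x\<in>\<Omega>. \<forall>y\<in>\<Omega>. x \<noteq> y \<longrightarrow>
        \<bar>Lp x - Lp y\<bar> / norm (x - y) \<le> Q \<and> \<bar>Lm x - Lm y\<bar> / norm (x - y) \<le> Q))"

definition energy :: "(real^2) set \<Rightarrow> (real \<Rightarrow> real) \<Rightarrow> (real^2 \<Rightarrow> real) \<Rightarrow> real" where
  "energy \<Omega> f w = (LINT x:\<Omega>|lebesgue. f (norm (grad w x)))"

definition is_minimizer ::
    "(real^2) set \<Rightarrow> (real^2 \<Rightarrow> real) \<Rightarrow> (real \<Rightarrow> real) \<Rightarrow> (real^2 \<Rightarrow> real) \<Rightarrow> bool" where
  "is_minimizer \<Omega> \<psi> f u \<longleftrightarrow>
     u \<in> Lip (closure \<Omega>) \<and> (\<forall>x\<in>frontier \<Omega>. u x = \<psi> x) \<and>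
     (\<forall>w. w \<in> Lip (closure \<Omega>) \<and> (\<forall>x\<in>frontier \<Omega>. w x = \<psi> x) \<longrightarrow> energy \<Omega> f u \<le> energy \<Omega> f w)"

definition flux :: "(real \<Rightarrow> real) \<Rightarrow> (real^2 \<Rightarrow> real) \<Rightarrow> real^2 \<Rightarrow> real^2" where
  "flux f u x = (if grad u x = 0 then 0
     else (hderiv f (norm (grad u x)) / norm (grad u x)) *\<^sub>R grad u x)"

definition is_conjugate ::
    "(real^2) set \<Rightarrow> (real \<Rightarrow> real) \<Rightarrow> (real^2 \<Rightarrow> real) \<Rightarrow> (real^2 \<Rightarrow> real) \<Rightarrow> bool" where
  "is_conjugate \<Omega> f u v \<longleftrightarrow> v \<in> Lip \<Omega> \<and> (LINT x:\<Omega>|lebesgue. v x) = 0 \<and>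
     has_weak_partial \<Omega> 1 v (\<lambda>x. - (flux f u x $ 2)) \<and>
     has_weak_partial \<Omega> 2 v (\<lambda>x. flux f u x $ 1)"


section \<open>Viscosity solutions\<close>

text \<open>Viscosity solutions of \<open>F (\<nabla>v) (\<nabla>\<^sup>2v) = 0\<close> in an open set, for \<open>F\<close> continuous and degenerate
  elliptic (nonincreasing in the matrix argument).\<close>

definition viscosity_subsolution ::
    "(real^2) set \<Rightarrow> (real^2 \<Rightarrow> real^2^2 \<Rightarrow> real) \<Rightarrow> (real^2 \<Rightarrow> real) \<Rightarrow> bool" where
  "viscosity_subsolution \<Omega> F v \<longleftrightarrow> continuous_on \<Omega> v \<and>
     (\<forall>\<phi>. \<forall>x\<in>\<Omega>. C2_on \<Omega> \<phi> \<and> (\<forall>\<^sub>F y in nhds x. v y - \<phi> y \<le> v x - \<phi> x)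
        \<longrightarrow> F (grad \<phi> x) (hessian \<phi> x) \<le> 0)"

definition viscosity_supersolution ::
    "(real^2) set \<Rightarrow> (real^2 \<Rightarrow> real^2^2 \<Rightarrow> real) \<Rightarrow> (real^2 \<Rightarrow> real) \<Rightarrow> bool" where
  "viscosity_supersolution \<Omega> F v \<longleftrightarrow> continuous_on \<Omega> v \<and>
     (\<forall>\<phi>. \<forall>x\<in>\<Omega>. C2_on \<Omega> \<phi> \<and> (\<forall>\<^sub>F y in nhds x. v y - \<phi> y \<ge> v x - \<phi> x)
        \<longrightarrow> F (grad \<phi> x) (hessian \<phi> x) \<ge> 0)"

definition viscosity_solution ::
    "(real^2) set \<Rightarrow> (real^2 \<Rightarrow> real^2^2 \<Rightarrow> real) \<Rightarrow> (real^2 \<Rightarrow> real) \<Rightarrow> bool" where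
  "viscosity_solution \<Omega> F v \<longleftrightarrow> viscosity_subsolution \<Omega> F v \<and> viscosity_supersolution \<Omega> F v"

text \<open>\<open>F\<close> such that \<open>F (\<nabla>v) (\<nabla>\<^sup>2v) = - (1 - \<beta> \<bar>\<nabla>v\<bar>) \<Delta>\<^sub>\<infinity>v - \<bar>\<nabla>v\<bar>\<^sup>2 \<beta> \<bar>\<nabla>v\<bar> \<Delta>v\<close>.\<close>
definition limit_operator :: "(real \<Rightarrow> real) \<Rightarrow> real^2 \<Rightarrow> real^2^2 \<Rightarrow> real" where
  "limit_operator \<beta> p X =
     - (1 - \<beta> (norm p)) * ((X *v p) \<bullet> p) - (norm p)\<^sup>2 * \<beta> (norm p) * trace X"

end

theory Submission
  imports Defs "HOL-Complex_Analysis.Great_Picard"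
begin

text \<open>The idea of the proof. Let \<open>A\<^sub>n p = f\<^sub>n'(\<bar>p\<bar>) p / \<bar>p\<bar>\<close>, a monotone map, and let \<open>rot\<close> be the rotation by a
right angle, which commutes with \<open>A\<^sub>n\<close>. The system for the conjugate function says that
\<open>\<nabla>v\<^sub>n = rot (A\<^sub>n (\<nabla>u\<^sub>n)) = A\<^sub>n (rot \<nabla>u\<^sub>n)\<close>, and \<open>rot \<nabla>u\<^sub>n\<close> is divergence free because \<open>\<nabla>u\<^sub>n\<close> is a
gradient. So \<open>v\<^sub>n\<close> solves \<open>div (A\<^sub>n\<^sup>-\<^sup>1 (\<nabla>v\<^sub>n)) = 0\<close> weakly. Where \<open>\<nabla>v\<^sub>n \<noteq> 0\<close>, formally carrying out the divergence
gives, up to a negative factor, the operator of the theorem with \<open>\<alpha>\<^sub>n \<circ> g\<^sub>n'\<close> in place of \<open>\<beta>\<close>.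

Compactness. The affine functions of the bounded slope condition are barriers for \<open>u\<^sub>n\<close>
(\<open>lip_minimizer_le_affine\<close>), and comparing \<open>u\<^sub>n\<close> with its translates carries the resulting bound from
the boundary to the interior: \<open>u\<^sub>n\<close> is \<open>Q\<close>-Lipschitz (\<open>lip_minimizer_lipschitz\<close>). Hence
\<open>\<bar>\<nabla>v\<^sub>n\<bar> \<le> f\<^sub>n'(Q)\<close>, which is bounded because the \<open>f\<^sub>n\<close> are convex and converge. The bounded slope
condition makes \<open>\<Omega>\<close> convex unless \<open>\<psi>\<close> is the restriction of an affine function, and then \<open>u\<^sub>n\<close> is affine and
\<open>\<nabla>v\<^sub>n\<close> is constant; in both cases the \<open>v\<^sub>n\<close> are Lipschitz with a common constant
(\<open>conjugate_lipschitz\<close>). They have mean zero, so the theorem of Arzela and Ascoli applies.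

The equation. Let a test function \<open>\<phi>\<close> touch the limit from above at \<open>x\<^sub>0\<close>, and suppose that the operator is
positive there. It vanishes when \<open>\<nabla>\<phi> = 0\<close>, so \<open>\<nabla>\<phi>(x\<^sub>0) \<noteq> 0\<close>. After adding a small quadratic function to
\<open>\<phi>\<close>, the touching is strict and, for large \<open>n\<close>, \<open>A\<^sub>n\<^sup>-\<^sup>1 (\<nabla>\<phi>)\<close> has negative divergence on a ball around
\<open>x\<^sub>0\<close>. Testing this and the equation of \<open>v\<^sub>n\<close> with the positive part of \<open>v\<^sub>n - \<phi> - m\<close> contradicts
the monotonicity of \<open>A\<^sub>n\<close> (\<open>comparison_with_strict_supersolution\<close>). Since \<open>f\<^sub>n''\<close> may have zeros,
\<open>A\<^sub>n\<^sup>-\<^sup>1\<close> may fail to be differentiable; it is replaced by the inverse of \<open>p \<mapsto> A\<^sub>n p + \<epsilon> p\<close>, for which the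
bound of the divergence does not depend on \<open>\<epsilon>\<close>, and \<open>\<epsilon>\<close> is sent to \<open>0\<close> at the end. The case of touching from
below follows by changing the signs of \<open>u\<^sub>n\<close>, \<open>v\<^sub>n\<close> and \<open>\<phi>\<close>.

Energies and fluxes are built from pointwise gradients of Lipschitz functions, so these arguments rest on
Rademacher's theorem, with which the development begins.\<close>

section \<open>Differentiability almost everywhere of Lipschitz functions\<close>

text \<open>The covering theorem for balls, in the form in which it applies to difference quotients: these only provide
intervals that have the covered point as an endpoint.\<close>
lemma Vitali_covering_intervals:
  fixes E U :: "real set"
  assumes "open U" "E \<subseteq> U"
    and fine: "\<And>x d. x \<in> E \<Longrightarrow> 0 < d \<Longrightarrow> \<exists>a b. a < b \<and> b - a < d \<and> a \<le> x \<and> x \<le> b \<and> P a b"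
  obtains C where "countable C" "\<And>a b. (a, b) \<in> C \<Longrightarrow> a < b \<and> P a b \<and> {a..b} \<subseteq> U"
    "disjoint_family_on (\<lambda>(a, b). {a..b}) C" "negligible (E - (\<Union>(a, b)\<in>C. {a..b}))"
proof -
  define K where "K = {(a, b). a < b \<and> P a b \<and> {a..b} \<subseteq> U}"
  define cen rad where "cen = (\<lambda>(a, b). (a + b) / 2 :: real)" and "rad = (\<lambda>(a, b). (b - a) / 2 :: real)"
  have cb: "cball (cen i) (rad i) = (\<lambda>(a, b). {a..b}) i" for i
    by (cases i) (simp add: cen_def rad_def cball_eq_atLeastAtMost field_simps)
  have fin: "\<exists>i. i \<in> K \<and> x \<in> cball (cen i) (rad i) \<and> rad i < d" if x: "x \<in> E" and d: "0 < d" for x d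
  proof -
    obtain e where e: "e > 0" "cball x e \<subseteq> U"
      using assms(1,2) x open_contains_cball by blast
    obtain a b where ab: "a < b" "b - a < min d e" "a \<le> x" "x \<le> b" "P a b"
      using fine[OF x, of "min d e"] d e by auto
    have "{a..b} \<subseteq> cball x e"
      using ab by (auto simp: dist_real_def)
    then have "(a, b) \<in> K"
      using ab e unfolding K_def by blast
    moreover have "rad (a, b) < d"
      using ab by (simp add: rad_def)
    ultimately show ?thesis
      using ab(3,4) cb[of "(a, b)"] by (intro exI[of _ "(a, b)"]) auto
  qed
  have pos: "\<And>i. i \<in> K \<Longrightarrow> 0 < rad i"
    by (auto simp: K_def rad_def)
  obtain C where C: "countable C" "C \<subseteq> K"
     "pairwise (\<lambda>i j. disjnt (cball (cen i) (rad i)) (cball (cen j) (rad j))) C"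
     "negligible (E - (\<Union>i \<in> C. cball (cen i) (rad i)))"
    by (rule Vitali_covering_theorem_cballs[of K rad E cen, OF pos fin]) blast+
  show ?thesis
  proof
    show "countable C" by fact
    show "a < b \<and> P a b \<and> {a..b} \<subseteq> U" if "(a, b) \<in> C" for a b
      using that C(2) by (auto simp: K_def)
    show "disjoint_family_on (\<lambda>(a, b). {a..b}) C"
      using C(3) unfolding cb by (simp add: disjoint_family_on_def pairwise_def disjnt_def)
    show "negligible (E - (\<Union>(a, b)\<in>C. {a..b}))"
      using C(4) unfolding cb .
  qed
qed

text \<open>Disjoint intervals on which \<open>f\<close> grows at a rate of at most \<open>p\<close> cover \<open>E\<close> up to a null set; inside of these, disjoint
intervals on which \<open>f\<close> grows at a rate of at least \<open>q\<close> do so again. The Stieltjes measure of \<open>f\<close> compares the total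
growth on both families, and yields \<open>q \<bar>E\<bar> \<le> p \<bar>U\<bar>\<close> for all open \<open>U \<supseteq> E\<close>.\<close>
lemma negligible_differing_difference_quotients:
  fixes f :: "real \<Rightarrow> real"
  assumes f: "mono f" "continuous_on UNIV f" and E: "E \<in> lmeasurable" and "p < q"
    and low: "\<And>x d. x \<in> E \<Longrightarrow> 0 < d \<Longrightarrow>
      \<exists>a b. a < b \<and> b - a < d \<and> a \<le> x \<and> x \<le> b \<and> f b - f a \<le> p * (b - a)"
    and upp: "\<And>x d. x \<in> E \<Longrightarrow> 0 < d \<Longrightarrow>
      \<exists>a b. a < b \<and> b - a < d \<and> a \<le> x \<and> x \<le> b \<and> q * (b - a) \<le> f b - f a"
  shows "negligible E"
proof (cases "E = {}")
  case False
  then obtain x where "x \<in> E" by auto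
  then obtain a b where "a < b" "f b - f a \<le> p * (b - a)"
    using low[of x 1] by auto
  moreover have "f a \<le> f b"
    using f(1) \<open>a < b\<close> by (simp add: monoD)
  ultimately have p: "0 \<le> p"
    by (smt (verit) mult_less_0_iff)
  let ?\<mu> = "interval_measure f"
  have mu: "emeasure ?\<mu> {a..b} = ennreal (f b - f a)" if "a \<le> b" for a b
    using that f by (intro emeasure_interval_measure_Icc) (auto simp: monoD continuous_on_eq_continuous_at)
  have main: "q * measure lebesgue E \<le> p * (measure lebesgue E + e)" if "e > 0" for e
  proof -
    obtain U where U: "open U" "E \<subseteq> U" "(U - E) \<in> lmeasurable" "measure lebesgue (U - E) < e"
      by (metis E \<open>e > 0\<close> fmeasurableD sets_lebesgue_outer_open emeasure_eq_measure2 ennreal_less_iff measure_nonneg)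
    have Um: "U \<in> lmeasurable"
      using U E by (metis Diff_partition fmeasurable.Un)
    have "measure lebesgue U \<le> measure lebesgue E + measure lebesgue (U - E)"
      by (metis Diff_partition E U(2,3) fmeasurableD measure_Un_le)
    then have Ue: "measure lebesgue U \<le> measure lebesgue E + e"
      using U(4) by linarith
    obtain C where C: "countable C"
      "\<And>a b. (a, b) \<in> C \<Longrightarrow> a < b \<and> f b - f a \<le> p * (b - a) \<and> {a..b} \<subseteq> U"
      "disjoint_family_on (\<lambda>(a, b). {a..b}) C" "negligible (E - (\<Union>(a, b)\<in>C. {a..b}))"
      by (rule Vitali_covering_intervals[of U E "\<lambda>a b. f b - f a \<le> p * (b - a)", OF U(1,2) low]) blast+
    \<comment> \<open>only interiors, so that the second family is nested in the first; the endpoints are countably many\<close>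
    define V where "V = (\<Union>(a, b)\<in>C. {a<..<b})"
    define E' where "E' = E \<inter> V"
    have "open V"
      by (auto simp: V_def)
    moreover have "E' \<subseteq> V"
      by (auto simp: E'_def)
    moreover have "\<And>x d. x \<in> E' \<Longrightarrow> 0 < d \<Longrightarrow>
        \<exists>a b. a < b \<and> b - a < d \<and> a \<le> x \<and> x \<le> b \<and> q * (b - a) \<le> f b - f a"
      using upp by (auto simp: E'_def)
    note prems = calculation this
    obtain D where D: "countable D"
      "\<And>a b. (a, b) \<in> D \<Longrightarrow> a < b \<and> q * (b - a) \<le> f b - f a \<and> {a..b} \<subseteq> V"
      "disjoint_family_on (\<lambda>(a, b). {a..b}) D" "negligible (E' - (\<Union>(a, b)\<in>D. {a..b}))"
      by (rule Vitali_covering_intervals[of V E' "\<lambda>a b. q * (b - a) \<le> f b - f a", OF prems]) blast+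
    have "E - (\<Union>(a, b)\<in>D. {a..b}) \<subseteq> (E' - (\<Union>(a, b)\<in>D. {a..b})) \<union> (E - (\<Union>(a, b)\<in>C. {a..b}))
        \<union> (\<Union>(a, b)\<in>C. {a, b})"
      unfolding E'_def V_def by fastforce
    moreover have "negligible (\<Union>(a, b)\<in>C. {a, b})"
      using C(1) by (auto simp: case_prod_unfold intro!: negligible_countable_Union)
    ultimately have neg: "negligible (E - (\<Union>(a, b)\<in>D. {a..b}))"
      using C(4) D(4) by (meson negligible_Un negligible_subset)
    have D_sub: "(\<Union>(a, b)\<in>D. {a..b}) \<subseteq> (\<Union>(a, b)\<in>C. {a..b})"
    proof safe
      fix x a b assume "(a, b) \<in> D" "x \<in> {a..b}"
      then have "x \<in> V"
        using D(2) by blast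
      then obtain a' b' where "(a', b') \<in> C" "x \<in> {a'<..<b'}"
        by (auto simp: V_def)
      then show "x \<in> (\<Union>(a, b)\<in>C. {a..b})"
        by (intro UN_I[of "(a', b')"]) auto
    qed
    have sets: "(\<Union>(a, b)\<in>D. {a..b}) \<in> sets borel" "(\<Union>(a, b)\<in>C. {a..b}) \<in> sets borel"
      using C(1) D(1) by (auto intro!: sets.countable_UN')
    have q: "0 \<le> q"
      using p \<open>p < q\<close> by simp
    have leb_scale: "ennreal c * emeasure lebesgue (\<Union>(a, b)\<in>X. {a..b})
        = (\<integral>\<^sup>+(a, b). ennreal (c * (b - a)) \<partial>count_space X)"
      if "countable X" "disjoint_family_on (\<lambda>(a, b). {a..b}) X" "\<And>a b. (a, b) \<in> X \<Longrightarrow> a < b" "0 \<le> c"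
      for X :: "(real \<times> real) set" and c
    proof -
      have "emeasure lebesgue (\<Union>i\<in>X. (\<lambda>(a, b). {a..b}) i) = (\<integral>\<^sup>+i. emeasure lebesgue ((\<lambda>(a, b). {a..b}) i) \<partial>count_space X)"
        using that by (intro emeasure_UN_countable) auto
      then have "ennreal c * emeasure lebesgue (\<Union>i\<in>X. (\<lambda>(a, b). {a..b}) i) = (\<integral>\<^sup>+i. ennreal c * emeasure lebesgue ((\<lambda>(a, b). {a..b}) i) \<partial>count_space X)"
        by (simp only: nn_integral_cmult borel_measurable_count_space)
      also have "\<dots> = (\<integral>\<^sup>+(a, b). ennreal (c * (b - a)) \<partial>count_space X)"
        using that(3,4) by (intro nn_integral_cong) (auto simp: less_imp_le ennreal_mult)
      finally show ?thesis .
    qed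
    have mus: "emeasure ?\<mu> (\<Union>(a, b)\<in>X. {a..b}) = (\<integral>\<^sup>+(a, b). ennreal (f b - f a) \<partial>count_space X)"
      if "countable X" "disjoint_family_on (\<lambda>(a, b). {a..b}) X" "\<And>a b. (a, b) \<in> X \<Longrightarrow> a < b"
      for X :: "(real \<times> real) set"
    proof -
      have "emeasure ?\<mu> (\<Union>i\<in>X. (\<lambda>(a, b). {a..b}) i) = (\<integral>\<^sup>+i. emeasure ?\<mu> ((\<lambda>(a, b). {a..b}) i) \<partial>count_space X)"
        using that by (intro emeasure_UN_countable) auto
      also have "\<dots> = (\<integral>\<^sup>+(a, b). ennreal (f b - f a) \<partial>count_space X)"
        using that(3) by (intro nn_integral_cong) (auto simp: less_imp_le mu)
      finally show ?thesis .
    qed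
    have "emeasure lebesgue E \<le> emeasure lebesgue (\<Union>(a, b)\<in>D. {a..b})"
    proof (rule emeasure_mono_AE)
      show "AE x in lebesgue. x \<in> E \<longrightarrow> x \<in> (\<Union>(a, b)\<in>D. {a..b})"
        using neg unfolding negligible_iff_null_sets by (rule AE_I') auto
    qed (use sets in auto)
    then have "ennreal q * emeasure lebesgue E \<le> ennreal q * emeasure lebesgue (\<Union>(a, b)\<in>D. {a..b})"
      by (rule mult_left_mono) simp
    also have "\<dots> = (\<integral>\<^sup>+(a, b). ennreal (q * (b - a)) \<partial>count_space D)"
      by (rule leb_scale[OF D(1,3)]) (use D(2) q in auto)
    also have "\<dots> \<le> (\<integral>\<^sup>+(a, b). ennreal (f b - f a) \<partial>count_space D)"
      using D(2) by (intro nn_integral_mono) (auto intro!: ennreal_leI)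
    also have "\<dots> = emeasure ?\<mu> (\<Union>(a, b)\<in>D. {a..b})"
      using D mus[of D] by auto
    also have "\<dots> \<le> emeasure ?\<mu> (\<Union>(a, b)\<in>C. {a..b})"
      using D_sub sets by (intro emeasure_mono) auto
    also have "\<dots> = (\<integral>\<^sup>+(a, b). ennreal (f b - f a) \<partial>count_space C)"
      using C mus[of C] by auto
    also have "\<dots> \<le> (\<integral>\<^sup>+(a, b). ennreal (p * (b - a)) \<partial>count_space C)"
      using C(2) by (intro nn_integral_mono) (auto intro!: ennreal_leI)
    also have "\<dots> = ennreal p * emeasure lebesgue (\<Union>(a, b)\<in>C. {a..b})"
      by (rule leb_scale[symmetric, OF C(1,3)]) (use C(2) p in auto)
    also have "\<dots> \<le> ennreal p * emeasure lebesgue U"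
      using C(2) Um by (intro mult_left_mono emeasure_mono) auto
    finally have "ennreal (q * measure lebesgue E) \<le> ennreal (p * measure lebesgue U)"
      using E Um p q by (simp add: emeasure_eq_measure2 ennreal_mult')
    then have "q * measure lebesgue E \<le> p * measure lebesgue U"
      using p by (subst (asm) ennreal_le_iff) auto
    also have "\<dots> \<le> p * (measure lebesgue E + e)"
      using Ue p by (rule mult_left_mono)
    finally show ?thesis .
  qed
  have "q * measure lebesgue E \<le> p * measure lebesgue E"
  proof (rule field_le_epsilon)
    fix e :: real assume "e > 0"
    have "q * measure lebesgue E \<le> p * (measure lebesgue E + e / (p + 1))"
      using main[of "e / (p + 1)"] p \<open>e > 0\<close> by simp
    also have "\<dots> \<le> p * measure lebesgue E + e"
      using p \<open>e > 0\<close> by (simp add: field_simps)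
    finally show "q * measure lebesgue E \<le> p * measure lebesgue E + e" .
  qed
  then have "measure lebesgue E = 0"
    using \<open>p < q\<close> by (smt (verit, ccfv_SIG) measure_nonneg mult_right_mono mult_strict_right_mono)
  then show ?thesis
    using E negligible_iff_measure by blast
qed simp

text \<open>If the limit did not exist, two rationals would fit between the lower and the upper limit.\<close>
lemma tendsto_of_no_rational_gap:
  fixes g :: "'a \<Rightarrow> real"
  assumes "F \<noteq> bot" and bd: "\<forall>\<^sub>F h in F. \<bar>g h\<bar> \<le> C"
    and nogap: "\<And>p q. p \<in> \<rat> \<Longrightarrow> q \<in> \<rat> \<Longrightarrow> p < q \<Longrightarrow> (\<exists>\<^sub>F h in F. g h < p) \<Longrightarrow> (\<exists>\<^sub>F h in F. q < g h) \<Longrightarrow> False"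
  shows "\<exists>l. (g \<longlongrightarrow> l) F"
proof -
  let ?g = "\<lambda>h. ereal (g h)"
  have "\<not> Liminf F ?g < Limsup F ?g"
  proof
    assume less: "Liminf F ?g < Limsup F ?g"
    obtain p :: rat where p: "Liminf F ?g < real_of_rat p" "real_of_rat p < Limsup F ?g"
      using ereal_dense3[OF less] by blast
    obtain q :: rat where q: "ereal (real_of_rat p) < real_of_rat q" "real_of_rat q < Limsup F ?g"
      using ereal_dense3[OF p(2)] by blast
    obtain p' :: rat where p': "Liminf F ?g < real_of_rat p'" "ereal (real_of_rat p') < real_of_rat p"
      using ereal_dense3[OF p(1)] by blast
    have "\<exists>\<^sub>F h in F. g h < real_of_rat p"
    proof (rule ccontr)
      assume "\<not> (\<exists>\<^sub>F h in F. g h < real_of_rat p)"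
      then have "\<forall>\<^sub>F h in F. ereal (real_of_rat p) \<le> ?g h"
        by (simp add: not_frequently not_less)
      then show False
        using Liminf_bounded p(1) by (metis leD)
    qed
    moreover have "\<exists>\<^sub>F h in F. real_of_rat q < g h"
    proof (rule ccontr)
      assume "\<not> (\<exists>\<^sub>F h in F. real_of_rat q < g h)"
      then have "\<forall>\<^sub>F h in F. ?g h \<le> ereal (real_of_rat q)"
        by (simp add: not_frequently not_less)
      then show False
        using Limsup_bounded q(2) by (metis leD)
    qed
    ultimately show False
      using nogap[of "real_of_rat p" "real_of_rat q"] q(1) by auto
  qed
  then have eq: "Liminf F ?g = Limsup F ?g"
    using Liminf_le_Limsup[OF \<open>F \<noteq> bot\<close>, of ?g] by auto
  define L where "L = Limsup F ?g"
  have "- ereal C \<le> Liminf F ?g"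
    by (rule Liminf_bounded, rule eventually_mono[OF bd]) auto
  moreover have "Limsup F ?g \<le> ereal C"
    by (rule Limsup_bounded, rule eventually_mono[OF bd]) auto
  ultimately have "\<bar>L\<bar> \<noteq> \<infinity>"
    using eq unfolding L_def by auto
  then obtain l where l: "L = ereal l"
    by auto
  have "(?g \<longlongrightarrow> L) F"
    using eq unfolding L_def by (intro Liminf_eq_Limsup[OF \<open>F \<noteq> bot\<close>]) auto
  then show ?thesis
    unfolding l by (auto intro!: exI[of _ l])
qed

lemma lipschitz_directional_bound:
  fixes W :: "'a::real_normed_vector \<Rightarrow> real"
  assumes "C-lipschitz_on UNIV W"
  shows "\<bar>(W (x + h *\<^sub>R e) - W x) / h\<bar> \<le> C * norm e"
proof (cases "h = 0")
  case False
  have "\<bar>W (x + h *\<^sub>R e) - W x\<bar> \<le> C * (\<bar>h\<bar> * norm e)"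
    using lipschitz_onD[OF assms, of "x + h *\<^sub>R e" x] by (simp add: dist_norm)
  then show ?thesis
    using False by (simp add: abs_divide field_simps)
next
  case True
  then show ?thesis
    using lipschitz_on_nonneg[OF assms] by simp
qed

text \<open>Tonelli's theorem in the line parameter and the point: by translation invariance the measure of \<open>B\<close> is an average
over \<open>t\<close> of the measures of its translates by \<open>t *\<^sub>R e\<close>.\<close>
lemma null_set_of_null_lines:
  fixes B :: "'a::euclidean_space set"
  assumes B: "B \<in> sets borel"
    and line: "\<And>x. {t \<in> {0..1}. x + t *\<^sub>R e \<in> B} \<in> null_sets lborel"
  shows "B \<in> null_sets lborel"
proof -
  have [measurable]: "(\<lambda>(t, x). indicator {0..1::real} t * indicator B (x + t *\<^sub>R e) :: ennreal)
      \<in> borel_measurable (lborel \<Otimes>\<^sub>M lborel)"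
    using B by measurable
  have "emeasure lborel B = (\<integral>\<^sup>+x. indicator B x \<partial>lborel)"
    using B by simp
  also have "\<dots> = (\<integral>\<^sup>+t. indicator {0..1::real} t * (\<integral>\<^sup>+x. indicator B x \<partial>lborel) \<partial>lborel)"
    by (subst nn_integral_multc) auto
  also have "\<dots> = (\<integral>\<^sup>+t. (\<integral>\<^sup>+x. indicator {0..1::real} t * indicator B (x + t *\<^sub>R e) \<partial>lborel) \<partial>lborel)"
  proof (rule nn_integral_cong)
    fix t :: real
    have "(\<integral>\<^sup>+x. indicator B x \<partial>lborel) = (\<integral>\<^sup>+x. indicator B x \<partial>distr lborel borel ((+) (t *\<^sub>R e)))"
      by (simp add: lborel_distr_plus)
    also have "\<dots> = (\<integral>\<^sup>+x. indicator B (x + t *\<^sub>R e) \<partial>lborel)"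
      using B by (subst nn_integral_distr) (auto simp: add.commute)
    finally show "indicator {0..1} t * (\<integral>\<^sup>+x. indicator B x \<partial>lborel)
        = (\<integral>\<^sup>+x. indicator {0..1::real} t * indicator B (x + t *\<^sub>R e) \<partial>lborel)"
      using B by (subst nn_integral_cmult) auto
  qed
  also have "\<dots> = (\<integral>\<^sup>+x. (\<integral>\<^sup>+t. indicator {0..1::real} t * indicator B (x + t *\<^sub>R e) \<partial>lborel) \<partial>lborel)"
    by (rule lborel_pair.Fubini'[symmetric]) simp
  also have "\<dots> = (\<integral>\<^sup>+(x::'a). 0 \<partial>lborel)"
  proof (rule nn_integral_cong)
    fix x :: 'a
    have "(\<integral>\<^sup>+t. indicator {0..1::real} t * indicator B (x + t *\<^sub>R e) \<partial>lborel)
        = (\<integral>\<^sup>+t. indicator {t \<in> {0..1}. x + t *\<^sub>R e \<in> B} t \<partial>lborel)"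
      by (intro nn_integral_cong) (auto simp: indicator_def)
    also have "\<dots> = emeasure lborel {t \<in> {0..1}. x + t *\<^sub>R e \<in> B}"
      using line[of x] by (intro nn_integral_indicator) auto
    finally show "(\<integral>\<^sup>+t. indicator {0..1::real} t * indicator B (x + t *\<^sub>R e) \<partial>lborel) = 0"
      using line[of x] by auto
  qed
  finally show ?thesis
    using B by auto
qed

text \<open>Where the derivative along \<open>e\<close> fails to exist, two rationals separate the lower from the upper limit of the difference
quotients. For each pair of rationals this set is a countable intersection of open sets, and it meets every line in
direction \<open>e\<close> in a null set: on the line, \<open>W\<close> becomes increasing when a linear function is added.\<close>
lemma AE_lipschitz_directional_derivative:
  fixes W :: "'a::euclidean_space \<Rightarrow> real"
  assumes W: "C-lipschitz_on UNIV W"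
  shows "AE x in lborel. \<exists>l. ((\<lambda>h. (W (x + h *\<^sub>R e) - W x) / h) \<longlongrightarrow> l) (at 0)"
proof -
  define dq where "dq = (\<lambda>h x. (W (x + h *\<^sub>R e) - W x) / h)"
  define Low where "Low p n = (\<Union>h\<in>{h. h \<noteq> 0 \<and> \<bar>h\<bar> < 1 / real (Suc n)}. {x. dq h x < p})" for p n
  define Upp where "Upp q n = (\<Union>h\<in>{h. h \<noteq> 0 \<and> \<bar>h\<bar> < 1 / real (Suc n)}. {x. q < dq h x})" for q n
  define B where "B p q = (\<Inter>n. Low p n) \<inter> (\<Inter>n. Upp q n)" for p q
  have contW: "continuous_on UNIV W"
    using W by (rule lipschitz_on_continuous_on)
  have contdq: "continuous_on UNIV (dq h)" for h
    unfolding dq_def divide_inverse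
    by (intro continuous_intros continuous_on_compose2[OF contW]) auto
  have "open (Low p n)" for p n
    unfolding Low_def by (intro open_UN ballI open_Collect_less contdq continuous_intros)
  moreover have "open (Upp p n)" for p n
    unfolding Upp_def by (intro open_UN ballI open_Collect_less contdq continuous_intros)
  ultimately have Bm: "B p q \<in> sets borel" for p q
    unfolding B_def by (intro sets.Int sets.countable_INT'') auto
  have C0: "0 \<le> C"
    using W by (rule lipschitz_on_nonneg)
  have null: "B p q \<in> null_sets lborel" if "p < q" for p q
  proof (rule null_set_of_null_lines[OF Bm])
    fix x
    define E where "E = {t \<in> {0..1}. x + t *\<^sub>R e \<in> B p q}"
    define K where "K = C * norm e"
    define f where "f t = W (x + t *\<^sub>R e) + K * t" for t
    have quot: "(f (t + h) - f t) / h = dq h (x + t *\<^sub>R e) + K" if "h \<noteq> 0" for t h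
      using that by (simp add: f_def dq_def algebra_simps add_divide_distrib diff_divide_distrib)
    have Wd: "\<bar>W (x + t *\<^sub>R e) - W (x + s *\<^sub>R e)\<bar> \<le> K * \<bar>t - s\<bar>" for s t
      using lipschitz_onD[OF W, of "x + t *\<^sub>R e" "x + s *\<^sub>R e"]
      by (simp add: dist_norm K_def mult_ac flip: scaleR_diff_left)
    have "mono f"
    proof (rule monoI)
      fix s t :: real assume "s \<le> t"
      then show "f s \<le> f t"
        using Wd[of t s] by (simp add: f_def algebra_simps)
    qed
    moreover have "continuous_on UNIV f"
      unfolding f_def by (intro continuous_intros continuous_on_compose2[OF contW]) auto
    moreover have "E \<in> lmeasurable"
    proof (rule bounded_set_imp_lmeasurable)
      show "bounded E"
        by (rule bounded_subset[of "{0..1}"]) (auto simp: E_def)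
      have "E = {0..1} \<inter> (\<lambda>t. x + t *\<^sub>R e) -` B p q"
        by (auto simp: E_def)
      moreover have "(\<lambda>t. x + t *\<^sub>R e) -` B p q \<inter> space borel \<in> sets borel"
        by (intro measurable_sets[OF _ Bm]) simp
      ultimately have "E \<in> sets borel" by simp
      then show "E \<in> sets lebesgue" by simp
    qed
    moreover have "p + K < q + K" using that by simp
    moreover have "\<exists>a b. a < b \<and> b - a < d \<and> a \<le> t \<and> t \<le> b \<and> f b - f a \<le> (p + K) * (b - a)"
      if t: "t \<in> E" and d: "0 < d" for t d
    proof -
      obtain n where n: "1 / real (Suc n) < d"
        using d by (metis nat_approx_posE)
      have "x + t *\<^sub>R e \<in> Low p n"
        using t by (auto simp: E_def B_def)
      then obtain h where h: "h \<noteq> 0" "\<bar>h\<bar> < 1 / real (Suc n)" "dq h (x + t *\<^sub>R e) < p"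
        by (auto simp: Low_def)
      have lt: "(f (t + h) - f t) / h \<le> p + K"
        using quot[OF h(1)] h(3) by simp
      have hd: "\<bar>h\<bar> < d" using h(2) n by linarith
      show ?thesis
      proof (cases "h > 0")
        case True
        then show ?thesis
          using lt hd by (intro exI[of _ t] exI[of _ "t + h"]) (auto simp: field_simps)
      next
        case False
        then show ?thesis
          using lt hd h(1) by (intro exI[of _ "t + h"] exI[of _ t]) (auto simp: field_simps)
      qed
    qed
    moreover have "\<exists>a b. a < b \<and> b - a < d \<and> a \<le> t \<and> t \<le> b \<and> (q + K) * (b - a) \<le> f b - f a"
      if t: "t \<in> E" and d: "0 < d" for t d
    proof -
      obtain n where n: "1 / real (Suc n) < d"
        using d by (metis nat_approx_posE)
      have "x + t *\<^sub>R e \<in> Upp q n"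
        using t by (auto simp: E_def B_def)
      then obtain h where h: "h \<noteq> 0" "\<bar>h\<bar> < 1 / real (Suc n)" "q < dq h (x + t *\<^sub>R e)"
        by (auto simp: Upp_def)
      have lt: "q + K \<le> (f (t + h) - f t) / h"
        using quot[OF h(1)] h(3) by simp
      have hd: "\<bar>h\<bar> < d" using h(2) n by linarith
      show ?thesis
      proof (cases "h > 0")
        case True
        then show ?thesis
          using lt hd by (intro exI[of _ t] exI[of _ "t + h"]) (auto simp: field_simps)
      next
        case False
        then show ?thesis
          using lt hd h(1) by (intro exI[of _ "t + h"] exI[of _ t]) (auto simp: field_simps)
      qed
    qed
    ultimately have "negligible E"
      by (rule negligible_differing_difference_quotients)
    moreover have "E \<in> sets lborel"
    proof -
      have "E = {0..1} \<inter> (\<lambda>t. x + t *\<^sub>R e) -` B p q"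
        by (auto simp: E_def)
      moreover have "(\<lambda>t. x + t *\<^sub>R e) -` B p q \<inter> space borel \<in> sets borel"
        by (intro measurable_sets[OF _ Bm]) simp
      ultimately show ?thesis by simp
    qed
    ultimately show "{t \<in> {0..1}. x + t *\<^sub>R e \<in> B p q} \<in> null_sets lborel"
      unfolding E_def[symmetric] negligible_iff_null_sets
      by (simp add: null_sets_completion_iff)
  qed
  have "(\<Union>(p, q)\<in>{(p, q). p \<in> \<rat> \<and> q \<in> \<rat> \<and> p < q}. B p q) \<in> null_sets lborel"
  proof (rule null_sets_UN')
    have "countable (\<rat> \<times> \<rat> :: (real \<times> real) set)"
      by (intro countable_SIGMA countable_rat)
    then show "countable {(p, q). p \<in> \<rat> \<and> q \<in> \<rat> \<and> p < (q::real)}"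
      by (rule countable_subset[rotated]) auto
  qed (auto intro: null)
  then show ?thesis
  proof (rule AE_I', safe)
    fix x assume x: "\<nexists>l. ((\<lambda>h. (W (x + h *\<^sub>R e) - W x) / h) \<longlongrightarrow> l) (at 0)"
    have "\<not> (\<forall>p q. p \<in> \<rat> \<longrightarrow> q \<in> \<rat> \<longrightarrow> p < q \<longrightarrow> (\<exists>\<^sub>F h in at 0. dq h x < p) \<longrightarrow> (\<exists>\<^sub>F h in at 0. q < dq h x) \<longrightarrow> False)"
      using tendsto_of_no_rational_gap[of "at (0::real)" "\<lambda>h. dq h x" "C * norm e"] x
        lipschitz_directional_bound[OF W, of x _ e]
      unfolding dq_def by fastforce
    then obtain p q where pq: "p \<in> \<rat>" "q \<in> \<rat>" "p < q"
      and fr: "\<exists>\<^sub>F h in at 0. dq h x < p" "\<exists>\<^sub>F h in at 0. q < dq h x" by blast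
    have ev: "\<forall>\<^sub>F h in at (0::real). h \<noteq> 0 \<and> \<bar>h\<bar> < 1 / real (Suc n)" for n
      unfolding eventually_at by (intro exI[of _ "1 / real (Suc n)"]) auto
    have "x \<in> Low p n" for n
      using frequently_ex[OF frequently_eventually_conj[OF fr(1) ev[of n]]] by (auto simp: Low_def)
    moreover have "x \<in> Upp q n" for n
      using frequently_ex[OF frequently_eventually_conj[OF fr(2) ev[of n]]] by (auto simp: Upp_def)
    ultimately have "x \<in> B p q" by (simp add: B_def)
    then show "x \<in> (\<Union>(p, q)\<in>{(p, q). p \<in> \<rat> \<and> q \<in> \<rat> \<and> p < q}. B p q)"
      using pq by blast
  qed
qed

text \<open>The measure with density \<open>1 + k / B\<close>, for a large constant \<open>B\<close>, agrees with Lebesgue measure on all boxes, hence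
everywhere.\<close>
lemma AE_eq_0_of_box_integrals_eq_0:
  fixes k :: "'a::euclidean_space \<Rightarrow> real"
  assumes k[measurable]: "k \<in> borel_measurable lborel" and bd: "AE x in lborel. \<bar>k x\<bar> \<le> C"
    and box: "\<And>l u. (LINT x:box l u|lborel. k x) = 0"
  shows "AE x in lborel. k x = 0"
proof -
  define B where "B = \<bar>C\<bar> + 1"
  have B: "B > 0" "AE x in lborel. \<bar>k x\<bar> \<le> B"
    using bd by (auto simp: B_def)
  define M where "M = density lborel (\<lambda>x. ennreal (1 + k x / B))"
  have "lborel = M"
  proof (rule lborel_eqI)
    show "sets M = sets borel" by (simp add: M_def)
    fix l u :: 'a assume lu: "\<And>b. b \<in> Basis \<Longrightarrow> l \<bullet> b \<le> u \<bullet> b"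
    have fin: "emeasure lborel (box l u) < \<infinity>"
      by (rule emeasure_lborel_box_finite)
    have int1: "integrable lborel (\<lambda>x. indicator (box l u) x :: real)"
      using fin by (intro integrable_real_indicator) auto
    have intk: "integrable lborel (\<lambda>x. indicator (box l u) x * k x)"
    proof (rule Bochner_Integration.integrable_bound[of _ "\<lambda>x. B * indicator (box l u) x"])
      show "AE x in lborel. norm (indicator (box l u) x * k x) \<le> norm (B * indicator (box l u) x)"
        using B(2) by eventually_elim (use B(1) in \<open>auto simp: indicator_def\<close>)
    qed (use int1 in auto)
    have "emeasure M (box l u) = (\<integral>\<^sup>+x. ennreal (1 + k x / B) * indicator (box l u) x \<partial>lborel)"
      unfolding M_def by (subst emeasure_density) auto
    also have "\<dots> = (\<integral>\<^sup>+x. ennreal (indicator (box l u) x + indicator (box l u) x * k x / B) \<partial>lborel)"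
      by (intro nn_integral_cong) (auto simp: indicator_def)
    also have "\<dots> = ennreal (LINT x|lborel. indicator (box l u) x + indicator (box l u) x * k x / B)"
    proof (rule nn_integral_eq_integral)
      show "AE x in lborel. 0 \<le> indicator (box l u) x + indicator (box l u) x * k x / B"
        using B(2) by eventually_elim (use B(1) in \<open>auto simp: indicator_def field_simps\<close>)
      show "integrable lborel (\<lambda>x. indicator (box l u) x + indicator (box l u) x * k x / B)"
        using int1 intk by (intro Bochner_Integration.integrable_add integrable_divide)
    qed
    also have "(LINT x|lborel. indicator (box l u) x + indicator (box l u) x * k x / B)
        = measure lborel (box l u) + (LINT x|lborel. indicator (box l u) x * k x) / B"
      using int1 intk by (subst Bochner_Integration.integral_add) auto
    also have "(LINT x|lborel. indicator (box l u) x * k x) = 0"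
      using box[of l u] by (simp add: set_lebesgue_integral_def)
    finally show "emeasure M (box l u) = (\<Prod>b\<in>Basis. (u - l) \<bullet> b)"
      using lu by (simp add: measure_lborel_box_eq)
  qed
  then have "density lborel (\<lambda>_. 1) = density lborel (\<lambda>x. ennreal (1 + k x / B))"
    by (simp add: M_def density_1)
  then have "AE x in lborel. 1 = ennreal (1 + k x / B)"
    by (subst (asm) sigma_finite_density_unique) (auto simp: density_1 sigma_finite_lborel)
  with B(2) show ?thesis
    by eventually_elim (metis B(1) add_cancel_right_right divide_eq_0_iff ennreal_eq_1 less_irrefl)
qed

lemma tendsto_directional_scale:
  fixes W :: "'a::real_normed_vector \<Rightarrow> real"
  assumes "((\<lambda>h. (W (x + h *\<^sub>R e) - W x) / h) \<longlongrightarrow> l) (at 0)"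
  shows "((\<lambda>h. (W (x + h *\<^sub>R (c *\<^sub>R e)) - W x) / h) \<longlongrightarrow> c * l) (at 0)"
proof (cases "c = 0")
  case False
  have "filterlim (\<lambda>h. h * c) (at 0) (at 0)"
    using False by (auto intro!: filterlim_atI tendsto_eq_intros simp: eventually_at_filter)
  then have "((\<lambda>h. c * ((W (x + (h * c) *\<^sub>R e) - W x) / (h * c))) \<longlongrightarrow> c * l) (at 0)"
    using filterlim_compose[OF assms] by (intro tendsto_mult_left) auto
  then show ?thesis
    by (rule Lim_transform_eventually) (auto intro!: always_eventually simp: False)
qed simp

lemma box_indicator_translate_tendsto:
  fixes y :: "'a::euclidean_space"
  assumes "y \<notin> frontier (box l u)" "s \<longlonglongrightarrow> (0::real)"
  shows "(\<lambda>n. indicator (box l u) (y - s n *\<^sub>R a) :: real) \<longlonglongrightarrow> indicator (box l u) y"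
proof -
  have lim: "(\<lambda>n. y - s n *\<^sub>R a) \<longlonglongrightarrow> y"
    by (rule tendsto_eq_intros assms(2) | simp)+
  consider "y \<in> box l u" | "y \<in> - closure (box l u)"
    using assms(1) interior_open[OF open_box, of l u] by (auto simp: frontier_def)
  then have "\<forall>\<^sub>F n in sequentially. indicator (box l u) (y - s n *\<^sub>R a) = (indicator (box l u) y :: real)"
  proof cases
    case 1
    then have "\<forall>\<^sub>F n in sequentially. y - s n *\<^sub>R a \<in> box l u"
      using lim open_box topological_tendstoD by blast
    then show ?thesis by eventually_elim (use 1 in auto)
  next
    case 2
    then have "\<forall>\<^sub>F n in sequentially. y - s n *\<^sub>R a \<in> - closure (box l u)"
      using lim closed_closure topological_tendstoD by (metis open_Compl)
    then show ?thesis
      by eventually_elim (use 2 closure_subset in \<open>auto simp: indicator_def\<close>)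
  qed
  then show ?thesis by (rule tendsto_eventually)
qed

text \<open>The limit along one fixed sequence is a Borel function of \<open>x\<close>; almost everywhere it is the two-sided derivative.\<close>
definition dirderiv :: "('a::real_normed_vector \<Rightarrow> real) \<Rightarrow> 'a \<Rightarrow> 'a \<Rightarrow> real" where
  "dirderiv W e x = lim (\<lambda>n. (W (x + (1 / real (Suc n)) *\<^sub>R e) - W x) / (1 / real (Suc n)))"

lemma filterlim_inverse_Suc_at_0: "filterlim (\<lambda>n. 1 / real (Suc n)) (at 0) sequentially"
proof (rule filterlim_atI)
  show "(\<lambda>n. 1 / real (Suc n)) \<longlonglongrightarrow> 0"
    by (rule LIMSEQ_Suc[OF lim_1_over_n])
qed auto

lemma dirderiv_eqI:
  assumes "((\<lambda>h. (W (x + h *\<^sub>R e) - W x) / h) \<longlongrightarrow> l) (at 0)"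
  shows "dirderiv W e x = l"
  unfolding dirderiv_def
  by (rule limI, rule filterlim_compose[OF assms filterlim_inverse_Suc_at_0])

lemma AE_dirderiv:
  fixes W :: "'a::euclidean_space \<Rightarrow> real"
  assumes W: "C-lipschitz_on UNIV W"
  shows "AE x in lborel. ((\<lambda>h. (W (x + h *\<^sub>R e) - W x) / h) \<longlongrightarrow> dirderiv W e x) (at 0)"
  using AE_lipschitz_directional_derivative[OF W, of e]
  by eventually_elim (use dirderiv_eqI in blast)

lemma dirderiv_measurable:
  fixes W :: "'a::euclidean_space \<Rightarrow> real"
  assumes W: "C-lipschitz_on UNIV W"
  shows "dirderiv W e \<in> borel_measurable lborel"
proof -
  have [measurable]: "W \<in> borel_measurable borel"
    using W by (intro borel_measurable_continuous_onI lipschitz_on_continuous_on)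
  show ?thesis unfolding dirderiv_def by measurable
qed

text \<open>The increment of \<open>W\<close> along \<open>a + b\<close> is the sum of the increments along \<open>a\<close> from \<open>x\<close> and along \<open>b\<close> from the shifted
point. In an integral over a box the shift can be moved from the function to the box, where it disappears in the
limit. Thus additivity holds for the integrals over all boxes.\<close>
lemma AE_dirderiv_add:
  fixes W :: "'a::euclidean_space \<Rightarrow> real"
  assumes W: "C-lipschitz_on UNIV W"
  shows "AE x in lborel. dirderiv W (a + b) x = dirderiv W a x + dirderiv W b x"
proof -
  have [measurable]: "W \<in> borel_measurable borel"
    using W by (intro borel_measurable_continuous_onI lipschitz_on_continuous_on)
  note [measurable] = dirderiv_measurable[OF W]
  define s where "s n = 1 / real (Suc n)" for n
  have s: "s n > 0" "s n \<noteq> 0" for n by (auto simp: s_def)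
  have s_at: "filterlim s (at 0) sequentially"
    unfolding s_def using filterlim_inverse_Suc_at_0 .
  then have s0: "s \<longlonglongrightarrow> 0" by (simp add: filterlim_at)
  define Q where "Q e n x = (W (x + s n *\<^sub>R e) - W x) / s n" for e n x
  have Q[measurable]: "Q e n \<in> borel_measurable lborel" for e n
    unfolding Q_def by measurable
  have Qb: "\<bar>Q e n x\<bar> \<le> C * norm e" for e n x
    unfolding Q_def by (rule lipschitz_directional_bound[OF W])
  have Qlim: "AE x in lborel. (\<lambda>n. Q e n x) \<longlonglongrightarrow> dirderiv W e x" for e
    using AE_dirderiv[OF W, of e] unfolding Q_def
    by eventually_elim (use filterlim_compose s_at in blast)
  have Db: "AE x in lborel. \<bar>dirderiv W e x\<bar> \<le> C * norm e" for e
    using Qlim[of e]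
    by eventually_elim (rule LIMSEQ_le_const2, rule tendsto_rabs, assumption, use Qb in blast)
  define k where "k x = dirderiv W (a + b) x - (dirderiv W a x + dirderiv W b x)" for x
  have "AE x in lborel. k x = 0"
  proof (rule AE_eq_0_of_box_integrals_eq_0)
    show "k \<in> borel_measurable lborel"
      unfolding k_def by measurable
    show "AE x in lborel. \<bar>k x\<bar> \<le> C * norm (a + b) + (C * norm a + C * norm b)"
      using Db[of "a + b"] Db[of a] Db[of b] by eventually_elim (auto simp: k_def)
    fix l u :: 'a
    let ?I = "\<lambda>x. indicator (box l u) x :: real"
    have int1: "integrable lborel ?I"
      by (intro integrable_real_indicator) (auto intro: emeasure_lborel_box_finite[unfolded infinity_ennreal_def])
    have intB: "integrable lborel (\<lambda>x. ?I x * g x)"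
      if [measurable]: "g \<in> borel_measurable lborel" and "AE x in lborel. \<bar>g x\<bar> \<le> K" for g K
    proof (rule Bochner_Integration.integrable_bound[of _ "\<lambda>x. K * ?I x"])
      show "AE x in lborel. norm (?I x * g x) \<le> norm (K * ?I x)"
        using that(2) by eventually_elim (auto simp: indicator_def)
    qed (use int1 in auto)
    note intD = intB[OF dirderiv_measurable[OF W] Db]
    have lim1: "(\<lambda>n. LINT x|lborel. ?I x * Q e n x) \<longlonglongrightarrow> (LINT x|lborel. ?I x * dirderiv W e x)" for e
    proof (rule integral_dominated_convergence[where w = "\<lambda>x. C * norm e * ?I x"])
      show "AE x in lborel. (\<lambda>n. ?I x * Q e n x) \<longlonglongrightarrow> ?I x * dirderiv W e x"
        using Qlim[of e] by eventually_elim (intro tendsto_mult_left)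
      show "AE x in lborel. norm (?I x * Q e n x) \<le> C * norm e * ?I x" for n
        using Qb by (auto simp: indicator_def)
    qed (use int1 in auto)
    obtain R where R: "R > 0" "\<And>x n. x \<in> box l u \<Longrightarrow> x + s n *\<^sub>R a \<in> ball 0 R"
    proof -
      obtain r where r: "\<And>x. x \<in> box l u \<Longrightarrow> norm x \<le> r" "r > 0"
        using bounded_box[of l u] by (meson bounded_pos)
      show ?thesis
      proof (rule that[of "r + norm a + 1"])
        show "x + s n *\<^sub>R a \<in> ball 0 (r + norm a + 1)" if "x \<in> box l u" for x n
        proof -
          have "s n \<le> 1" by (simp add: s_def)
          then have "norm (s n *\<^sub>R a) \<le> norm a"
            using mult_right_mono[of "s n" 1 "norm a"] s(1)[of n] by simp
          then show ?thesis
            using r(1)[OF that] norm_triangle_ineq[of x "s n *\<^sub>R a"] by simp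
        qed
      qed (use r(2) norm_ge_zero[of a] in linarith)
    qed
    have lim2: "(\<lambda>n. LINT x|lborel. ?I x * Q b n (x + s n *\<^sub>R a)) \<longlonglongrightarrow> (LINT x|lborel. ?I x * dirderiv W b x)"
    proof -
      have "(LINT x|lborel. ?I x * Q b n (x + s n *\<^sub>R a)) = (LINT y|lborel. ?I (y - s n *\<^sub>R a) * Q b n y)" for n
      proof -
        have "(LINT y|lborel. ?I (y - s n *\<^sub>R a) * Q b n y)
           = (LINT y|distr lborel borel ((+) (s n *\<^sub>R a)). ?I (y - s n *\<^sub>R a) * Q b n y)"
          by (simp add: lborel_distr_plus)
        also have "\<dots> = (LINT x|lborel. ?I x * Q b n (x + s n *\<^sub>R a))"
          by (subst integral_distr) (auto simp: add.commute)
        finally show ?thesis ..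
      qed
      moreover have "(\<lambda>n. LINT y|lborel. ?I (y - s n *\<^sub>R a) * Q b n y) \<longlonglongrightarrow> (LINT y|lborel. ?I y * dirderiv W b y)"
      proof (rule integral_dominated_convergence[where w = "\<lambda>x. C * norm b * indicator (ball 0 R) x"])
        have "AE y in lebesgue. y \<notin> frontier (box l u)"
          using negligible_convex_frontier[of "box l u"] unfolding negligible_iff_null_sets
          by (intro AE_not_in) auto
        then have "AE y in lborel. y \<notin> frontier (box l u)"
          by (simp add: AE_completion_iff)
        with Qlim[of b] show "AE y in lborel. (\<lambda>n. ?I (y - s n *\<^sub>R a) * Q b n y) \<longlonglongrightarrow> ?I y * dirderiv W b y"
          by eventually_elim (intro tendsto_mult box_indicator_translate_tendsto s0)
        have "norm (?I (y - s n *\<^sub>R a) * Q b n y) \<le> C * norm b * indicator (ball 0 R) y" for n y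
          using R(2)[of "y - s n *\<^sub>R a" n] Qb[of b n y] lipschitz_on_nonneg[OF W] by (auto simp: indicator_def)
        then show "AE y in lborel. norm (?I (y - s n *\<^sub>R a) * Q b n y) \<le> C * norm b * indicator (ball 0 R) y" for n
          by simp
        show "integrable lborel (\<lambda>x::'a. C * norm b * indicator (ball 0 R) x)"
          by (intro integrable_mult_right integrable_real_indicator) (auto intro: emeasure_bounded_finite[unfolded infinity_ennreal_def])
      qed auto
      ultimately show ?thesis by simp
    qed
    have Qsum: "Q (a + b) n x = Q a n x + Q b n (x + s n *\<^sub>R a)" for n x
      by (simp add: Q_def diff_divide_distrib scaleR_add_right add.assoc)
    have shift: "integrable lborel (\<lambda>x. ?I x * Q b n (x + s n *\<^sub>R a))" for n
      by (rule intB[of _ "C * norm b"]) (use Qb in auto)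
    have sum: "(\<lambda>n. LINT x|lborel. ?I x * Q (a + b) n x) = (\<lambda>n. (LINT x|lborel. ?I x * Q a n x) + (LINT x|lborel. ?I x * Q b n (x + s n *\<^sub>R a)))"
      unfolding Qsum distrib_left
      by (intro ext Bochner_Integration.integral_add intB[of _ "C * norm a"] shift) (use Qb in auto)
    have "(\<lambda>n. LINT x|lborel. ?I x * Q (a + b) n x)
        \<longlonglongrightarrow> (LINT x|lborel. ?I x * dirderiv W a x) + (LINT x|lborel. ?I x * dirderiv W b x)"
      unfolding sum by (intro tendsto_add lim1 lim2)
    then have "(LINT x|lborel. ?I x * dirderiv W (a + b) x)
        = (LINT x|lborel. ?I x * dirderiv W a x) + (LINT x|lborel. ?I x * dirderiv W b x)"
      by (rule LIMSEQ_unique[OF lim1])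
    then show "(LINT x:box l u|lborel. k x) = 0"
      unfolding k_def set_lebesgue_integral_def
      using intD by (simp add: right_diff_distrib distrib_left)
  qed
  then show ?thesis by (simp add: k_def)
qed

lemma AE_dirderiv_linear:
  fixes W :: "'a::euclidean_space \<Rightarrow> real"
  assumes W: "C-lipschitz_on UNIV W"
  shows "AE x in lborel. dirderiv W a x = a \<bullet> (\<Sum>b\<in>Basis. dirderiv W b x *\<^sub>R b)"
proof -
  have scale: "AE x in lborel. dirderiv W (c *\<^sub>R e) x = c * dirderiv W e x" for c e
    using AE_dirderiv[OF W, of e]
    by eventually_elim (intro dirderiv_eqI tendsto_directional_scale)
  have "AE x in lborel. dirderiv W (\<Sum>b\<in>S. (a \<bullet> b) *\<^sub>R b) x = (\<Sum>b\<in>S. (a \<bullet> b) * dirderiv W b x)"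
    if "finite S" for S :: "'a set"
    using that
  proof (induction S)
    case empty
    have "dirderiv W 0 x = 0" for x
      by (rule dirderiv_eqI) simp
    then show ?case by simp
  next
    case (insert e S)
    show ?case
      using insert.IH scale[of "a \<bullet> e" e] AE_dirderiv_add[OF W, of "(a \<bullet> e) *\<^sub>R e" "\<Sum>b\<in>S. (a \<bullet> b) *\<^sub>R b"]
      by eventually_elim (use insert.hyps in simp)
  qed
  from this[of Basis] show ?thesis
    by (simp add: euclidean_representation inner_sum_right mult.commute)
qed

text \<open>Almost everywhere the derivatives in a countable dense set of directions exist and are linear in the direction. Finitely
many of these directions approximate the unit sphere, and the Lipschitz bound controls the error of the approximation,
so the difference quotients converge uniformly in the direction.\<close>
theorem Rademacher:
  fixes W :: "'a::euclidean_space \<Rightarrow> real"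
  assumes W: "C-lipschitz_on UNIV W"
  shows "AE x in lebesgue. W differentiable (at x)"
proof -
  obtain D :: "'a set" where D: "countable D" "\<And>X. open X \<Longrightarrow> X \<noteq> {} \<Longrightarrow> \<exists>d\<in>D. d \<in> X"
    using countable_dense_exists by blast
  define g where "g x = (\<Sum>b\<in>Basis. dirderiv W b x *\<^sub>R b)" for x
  have C0: "C \<ge> 0" using W by (rule lipschitz_on_nonneg)
  have "AE x in lborel. \<forall>a\<in>D. ((\<lambda>h. (W (x + h *\<^sub>R a) - W x) / h) \<longlongrightarrow> a \<bullet> g x) (at 0)"
  proof (subst AE_ball_countable[OF D(1)], intro ballI)
    show "AE x in lborel. ((\<lambda>h. (W (x + h *\<^sub>R a) - W x) / h) \<longlongrightarrow> a \<bullet> g x) (at 0)" for a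
      using AE_dirderiv[OF W, of a] AE_dirderiv_linear[OF W, of a]
      by eventually_elim (simp add: g_def)
  qed
  then have "AE x in lborel. W differentiable (at x)"
  proof eventually_elim
    case (elim x)
    have "(W has_derivative (\<lambda>h. h \<bullet> g x)) (at x)"
      unfolding has_derivative_at_alt
    proof (intro conjI allI impI)
      show "bounded_linear (\<lambda>h. h \<bullet> g x)"
        by (rule bounded_linear_inner_left)
      fix e :: real assume "e > 0"
      define K where "K = C + norm (g x) + 1"
      define r where "r = e / (2 * K)"
      have den: "K > 0"
        using C0 by (simp add: add_nonneg_pos K_def)
      then have r: "r > 0" using \<open>e > 0\<close> by (simp add: r_def)
      have "sphere 0 1 \<subseteq> (\<Union>d\<in>D. ball d r)"
      proof
        fix y :: 'a
        obtain d where "d \<in> D" "d \<in> ball y r"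
          using D(2)[of "ball y r"] r by auto
        then show "y \<in> (\<Union>d\<in>D. ball d r)"
          by (auto simp: dist_commute)
      qed
      then obtain F where F: "F \<subseteq> D" "finite F" "sphere 0 1 \<subseteq> (\<Union>d\<in>F. ball d r)"
        using compactE_image[OF compact_sphere, of D "\<lambda>d. ball d r"] by (metis open_ball)
      have "\<forall>\<^sub>F h in at 0. \<forall>a\<in>F. \<bar>(W (x + h *\<^sub>R a) - W x) / h - a \<bullet> g x\<bar> < e / 2"
      proof (subst eventually_ball_finite_distrib[OF F(2)], intro ballI)
        fix a assume "a \<in> F"
        then show "\<forall>\<^sub>F h in at 0. \<bar>(W (x + h *\<^sub>R a) - W x) / h - a \<bullet> g x\<bar> < e / 2"
          using elim F(1) tendstoD[of _ "a \<bullet> g x" "at 0" "e / 2"] \<open>e > 0\<close> by (auto simp: dist_real_def)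
      qed
      then obtain d where d: "d > 0"
        "\<And>h a. h \<noteq> 0 \<Longrightarrow> \<bar>h\<bar> < d \<Longrightarrow> a \<in> F \<Longrightarrow> \<bar>(W (x + h *\<^sub>R a) - W x) / h - a \<bullet> g x\<bar> < e / 2"
        unfolding eventually_at by auto
      have "norm (W y - W x - (y - x) \<bullet> g x) \<le> e * norm (y - x)" if y: "norm (y - x) < d" for y
      proof (cases "y = x")
        case False
        define t where "t = norm (y - x)"
        define v where "v = (y - x) /\<^sub>R t"
        have t: "t > 0" "t < d" using False y by (auto simp: t_def)
        have yv: "y = x + t *\<^sub>R v" using t by (simp add: v_def)
        have "norm v = 1" using False by (simp add: v_def t_def)
        then obtain a where a: "a \<in> F" "norm (v - a) < r"
          using F(3) by (auto simp: subset_iff dist_norm norm_minus_commute)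
        have 1: "\<bar>W (x + t *\<^sub>R v) - W (x + t *\<^sub>R a)\<bar> \<le> C * (t * r)"
        proof -
          have "\<bar>W (x + t *\<^sub>R v) - W (x + t *\<^sub>R a)\<bar> \<le> C * (t * norm (v - a))"
            using lipschitz_onD[OF W, of "x + t *\<^sub>R v" "x + t *\<^sub>R a"] t
            by (simp add: dist_norm flip: scaleR_diff_right)
          also have "\<dots> \<le> C * (t * r)"
            using a t C0 by (intro mult_left_mono) auto
          finally show ?thesis .
        qed
        have 2: "\<bar>W (x + t *\<^sub>R a) - W x - t * (a \<bullet> g x)\<bar> \<le> t * (e / 2)"
        proof -
          have "W (x + t *\<^sub>R a) - W x - t * (a \<bullet> g x) = t * ((W (x + t *\<^sub>R a) - W x) / t - a \<bullet> g x)"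
            using t by (simp add: field_simps)
          then have "\<bar>W (x + t *\<^sub>R a) - W x - t * (a \<bullet> g x)\<bar> = t * \<bar>(W (x + t *\<^sub>R a) - W x) / t - a \<bullet> g x\<bar>"
            using t by (simp add: abs_mult)
          then show ?thesis
            using d(2)[of t a] a t by (simp add: mult_left_mono)
        qed
        have 3: "\<bar>t * (a \<bullet> g x) - t * (v \<bullet> g x)\<bar> \<le> t * r * norm (g x)"
        proof -
          have "\<bar>t * (a \<bullet> g x) - t * (v \<bullet> g x)\<bar> = t * \<bar>(a - v) \<bullet> g x\<bar>"
            using t by (simp add: inner_diff_left abs_mult flip: right_diff_distrib)
          also have "\<dots> \<le> t * (norm (a - v) * norm (g x))"
            using t Cauchy_Schwarz_ineq2 by (intro mult_left_mono) auto
          also have "\<dots> \<le> t * (r * norm (g x))"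
            using t a by (intro mult_left_mono mult_right_mono) (auto simp: norm_minus_commute)
          finally show ?thesis by simp
        qed
        have "C * (t * r) + t * r * norm (g x) \<le> t * (r * K)"
          using t r by (simp add: K_def algebra_simps)
        also have "r * K = e / 2"
          using den by (simp add: r_def)
        finally have half: "C * (t * r) + t * r * norm (g x) \<le> t * (e / 2)" .
        have "t * e = t * (e / 2) + t * (e / 2)"
          by (simp flip: distrib_left)
        then have "\<bar>W (x + t *\<^sub>R v) - W x - t * (v \<bullet> g x)\<bar> \<le> t * e"
          using 1 2 3 half by linarith
        moreover have "W y - W x - (y - x) \<bullet> g x = W (x + t *\<^sub>R v) - W x - t * (v \<bullet> g x)"
          using yv by (metis add_diff_cancel_left' inner_scaleR_left)
        ultimately show ?thesis
          unfolding t_def[symmetric] by (simp add: mult.commute)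
      qed simp
      then show "\<exists>d>0. \<forall>y. norm (y - x) < d \<longrightarrow> norm (W y - W x - (y - x) \<bullet> g x) \<le> e * norm (y - x)"
        using d(1) by blast
    qed
    then show ?case
      by (auto simp: differentiable_def)
  qed
  then show ?thesis
    by (simp add: AE_completion_iff)
qed

section \<open>Gradients of Lipschitz functions in the plane\<close>

lemma has_derivative_grad:
  assumes "W differentiable (at x)"
  shows "(W has_derivative (\<lambda>h. grad W x \<bullet> h)) (at x)"
proof -
  let ?D = "frechet_derivative W (at x)"
  have D: "(W has_derivative ?D) (at x)"
    using assms frechet_derivative_works by blast
  then have lin: "linear ?D"
    using has_derivative_linear by blast
  have "?D h = grad W x \<bullet> h" for h
  proof -
    have "?D h = ?D (\<Sum>i\<in>UNIV. (h $ i) *\<^sub>R axis i 1)"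
      using basis_expansion[of h] by (simp add: scalar_mult_eq_scaleR)
    also have "\<dots> = (\<Sum>i\<in>UNIV. h $ i * ?D (axis i 1))"
      using lin by (simp add: linear_sum linear_scale)
    also have "\<dots> = grad W x \<bullet> h"
      by (simp add: grad_def partial_def inner_vec_def mult.commute)
    finally show ?thesis .
  qed
  then show ?thesis using D by (metis (no_types, lifting) ext)
qed

lemma grad_eqI:
  assumes "(W has_derivative (\<lambda>h. g \<bullet> h)) (at x)"
  shows "grad W x = g"
proof -
  have "frechet_derivative W (at x) = (\<lambda>h. g \<bullet> h)"
    using assms frechet_derivative_at by metis
  then show ?thesis
    by (simp add: grad_def partial_def inner_axis vec_eq_iff)
qed

text \<open>This holds at points without derivative as well: the value chosen there depends only on which linear maps are
derivatives.\<close>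
lemma grad_cong:
  assumes "open S" "x \<in> S" "\<And>y. y \<in> S \<Longrightarrow> U y = W y"
  shows "grad U x = grad W x"
proof -
  have "(U has_derivative D) (at x) \<longleftrightarrow> (W has_derivative D) (at x)" for D
    using has_derivative_transform_within_open[OF _ assms(1,2)] assms(3) by metis
  then show ?thesis
    unfolding grad_def partial_def frechet_derivative_def by simp
qed

lemma grad_add:
  assumes "U differentiable (at x)" "W differentiable (at x)"
  shows "grad (\<lambda>x. U x + W x) x = grad U x + grad W x"
  using has_derivative_add[OF assms[THEN has_derivative_grad]]
  by (intro grad_eqI) (simp add: inner_add_left)

lemma grad_diff:
  assumes "U differentiable (at x)" "W differentiable (at x)"
  shows "grad (\<lambda>x. U x - W x) x = grad U x - grad W x"
  using has_derivative_diff[OF assms[THEN has_derivative_grad]]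
  by (intro grad_eqI) (simp add: inner_diff_left)

lemma grad_cmult:
  assumes "W differentiable (at x)"
  shows "grad (\<lambda>x. c * W x) x = c *\<^sub>R grad W x"
  using has_derivative_mult_right[OF assms[THEN has_derivative_grad], of c]
  by (intro grad_eqI) simp

lemma grad_minus:
  assumes "W differentiable (at x)"
  shows "grad (\<lambda>x. - W x) x = - grad W x"
  using grad_cmult[OF assms, of "-1"] by simp

lemma grad_mult:
  assumes "U differentiable (at x)" "W differentiable (at x)"
  shows "grad (\<lambda>x. U x * W x) x = U x *\<^sub>R grad W x + W x *\<^sub>R grad U x"
  using has_derivative_mult[OF assms[THEN has_derivative_grad]]
  by (intro grad_eqI) (simp add: inner_add_left mult.commute)

lemma grad_affine: "grad (\<lambda>x. a \<bullet> x + b) x = a"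
  by (rule grad_eqI) (auto intro!: derivative_eq_intros)

lemma grad_translate:
  assumes "W differentiable (at (x + a))"
  shows "grad (\<lambda>x. W (x + a)) x = grad W (x + a)" "(\<lambda>x. W (x + a)) differentiable (at x)"
proof -
  have "((\<lambda>x. x + a) has_derivative (\<lambda>h. h)) (at x)"
    by (auto intro!: derivative_eq_intros)
  from has_derivative_compose[OF this has_derivative_grad[OF assms]]
  show "grad (\<lambda>x. W (x + a)) x = grad W (x + a)" "(\<lambda>x. W (x + a)) differentiable (at x)"
    by (auto intro: grad_eqI simp: differentiable_def)
qed

lemma grad_eq_0_at_local_min:
  assumes "W differentiable (at x)" "open S" "x \<in> S" "\<And>y. y \<in> S \<Longrightarrow> W x \<le> W y"
  shows "grad W x = 0"
proof -
  have "(\<lambda>h. grad W x \<bullet> h) = (\<lambda>h. 0)"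
    using differential_zero_maxmin[OF assms(3,2) has_derivative_grad[OF assms(1)]] assms(4) by blast
  then show ?thesis by (metis inner_eq_zero_iff)
qed

lemma tendsto_difference_quotient_grad:
  assumes "W differentiable (at x)" "filterlim t (at 0) F"
  shows "((\<lambda>n. (W (x + t n *\<^sub>R e) - W x) / t n) \<longlongrightarrow> grad W x \<bullet> e) F"
proof -
  have "((\<lambda>h. x + h *\<^sub>R e) has_derivative (\<lambda>h. h *\<^sub>R e)) (at 0)"
    by (auto intro!: derivative_eq_intros)
  from has_derivative_compose[OF this, of W "\<lambda>h. grad W x \<bullet> h"] has_derivative_grad[OF assms(1)]
  have "((\<lambda>h. W (x + h *\<^sub>R e)) has_derivative (\<lambda>h. h * (grad W x \<bullet> e))) (at 0)"
    by simp
  then have "((\<lambda>h. W (x + h *\<^sub>R e)) has_field_derivative (grad W x \<bullet> e)) (at 0)"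
    by (simp add: has_field_derivative_def mult_commute_abs)
  then have "((\<lambda>h. (W (x + h *\<^sub>R e) - W x) / h) \<longlongrightarrow> grad W x \<bullet> e) (at 0)"
    by (simp add: has_field_derivative_iff)
  then show ?thesis
    using assms(2) filterlim_compose by blast
qed

lemma norm_grad_le:
  assumes "C-lipschitz_on S W" "open S" "x \<in> S" "W differentiable (at x)"
  shows "norm (grad W x) \<le> C"
proof -
  let ?g = "grad W x"
  have C: "0 \<le> C" using assms(1) by (rule lipschitz_on_nonneg)
  have lim: "((\<lambda>h. (W (x + h *\<^sub>R ?g) - W x) / h) \<longlongrightarrow> ?g \<bullet> ?g) (at 0)"
    by (rule tendsto_difference_quotient_grad[OF assms(4) filterlim_ident])
  have "((\<lambda>h. x + h *\<^sub>R ?g) \<longlongrightarrow> x) (at 0)"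
    by (auto intro!: tendsto_eq_intros)
  then have "\<forall>\<^sub>F h in at 0. x + h *\<^sub>R ?g \<in> S"
    using assms(2,3) topological_tendstoD by blast
  then have "\<forall>\<^sub>F h in at 0. (W (x + h *\<^sub>R ?g) - W x) / h \<le> C * norm ?g"
    using eventually_neq_at_within[of "0::real"]
  proof eventually_elim
    fix h :: real assume h: "x + h *\<^sub>R ?g \<in> S" "h \<noteq> 0"
    have "\<bar>W (x + h *\<^sub>R ?g) - W x\<bar> \<le> C * (\<bar>h\<bar> * norm ?g)"
      using lipschitz_onD[OF assms(1) h(1) assms(3)] by (simp add: dist_norm)
    then have "\<bar>(W (x + h *\<^sub>R ?g) - W x) / h\<bar> \<le> C * norm ?g"
      using h(2) by (simp add: abs_divide field_simps)
    then show "(W (x + h *\<^sub>R ?g) - W x) / h \<le> C * norm ?g" by linarith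
  qed
  then have "?g \<bullet> ?g \<le> C * norm ?g"
    by (rule tendsto_upperbound[OF lim]) simp
  then have "norm ?g * norm ?g \<le> C * norm ?g"
    by (simp add: power2_norm_eq_inner[symmetric] power2_eq_square)
  then show ?thesis using C by (cases "?g = 0") auto
qed

lemma AE_differentiable: "W \<in> Lip UNIV \<Longrightarrow> AE x in lebesgue. W differentiable (at x)"
  using Rademacher by (auto simp: Lip_def)

lemma continuous_Lip: "W \<in> Lip S \<Longrightarrow> continuous_on S W"
  by (auto simp: Lip_def intro: lipschitz_on_continuous_on)

lemma borel_Lip: "W \<in> Lip UNIV \<Longrightarrow> W \<in> borel_measurable borel"
  by (intro borel_measurable_continuous_onI continuous_Lip)

lemma lebesgue_measurable_Lip: "W \<in> Lip UNIV \<Longrightarrow> W \<in> borel_measurable lebesgue"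
  by (intro measurable_completion) (simp add: borel_Lip)

lemma lebesgue_measurable_AE_cong:
  fixes f g :: "'a::euclidean_space \<Rightarrow> 'b::topological_space"
  assumes "f \<in> borel_measurable lebesgue" "AE x in lebesgue. f x = g x"
  shows "g \<in> borel_measurable lebesgue"
proof (rule measurableI)
  fix A :: "'b set" assume A: "A \<in> sets borel"
  show "g -` A \<inter> space lebesgue \<in> sets lebesgue"
  proof (rule completion.in_sets_AE)
    show "f -` A \<inter> space lebesgue \<in> sets lebesgue"
      using assms(1) A by (rule measurable_sets)
    show "AE x in lebesgue. (x \<in> f -` A \<inter> space lebesgue) = (x \<in> g -` A \<inter> space lebesgue)"
      using assms(2) by eventually_elim simp
  qed simp
qed simp

text \<open>The arbitrary values of the gradient on the null set of points without derivative are harmless because Lebesgue measure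
is complete.\<close>
lemma grad_measurable:
  assumes "W \<in> Lip UNIV"
  shows "(\<lambda>x. grad W x) \<in> borel_measurable lebesgue"
proof -
  have "(\<lambda>x. grad W x \<bullet> e) \<in> borel_measurable lebesgue" for e
  proof (rule lebesgue_measurable_AE_cong)
    obtain C where C: "C-lipschitz_on UNIV W" using assms by (auto simp: Lip_def)
    show "dirderiv W e \<in> borel_measurable lebesgue"
      using dirderiv_measurable[OF C] by (rule measurable_completion)
    show "AE x in lebesgue. dirderiv W e x = grad W x \<bullet> e"
      using AE_differentiable[OF assms]
      by eventually_elim (rule dirderiv_eqI, rule tendsto_difference_quotient_grad, auto simp: filterlim_ident)
  qed
  then show ?thesis
    by (subst borel_measurable_euclidean_space) auto
qed

lemma lebesgue_translation_distr:
  fixes a :: "'a::euclidean_space"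
  shows "distr lebesgue lebesgue (\<lambda>x. x + a) = lebesgue" "(\<lambda>x. x + a) \<in> lebesgue \<rightarrow>\<^sub>M lebesgue"
proof -
  have eq: "(\<lambda>x::'a. a + (\<Sum>j\<in>Basis. (1 * (x \<bullet> j)) *\<^sub>R j)) = (\<lambda>x. x + a)"
    by (simp add: euclidean_representation add.commute)
  show "distr lebesgue lebesgue (\<lambda>x. x + a) = lebesgue"
    using lebesgue_affine_euclidean[of "\<lambda>_. 1" a] unfolding eq by (simp add: density_1)
  show "(\<lambda>x. x + a) \<in> lebesgue \<rightarrow>\<^sub>M lebesgue"
    using lebesgue_affine_measurable[of "\<lambda>_. 1" a] unfolding eq by simp
qed

lemma lebesgue_integral_translate:
  fixes f :: "'a::euclidean_space \<Rightarrow> real"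
  assumes "f \<in> borel_measurable lebesgue"
  shows "(LINT x|lebesgue. f (x + a)) = (LINT x|lebesgue. f x)"
  using integral_distr[OF lebesgue_translation_distr(2) assms, of a]
  by (simp add: lebesgue_translation_distr(1))

lemma AE_lebesgue_translate:
  fixes a :: "'a::euclidean_space"
  assumes "AE x in lebesgue. P x"
  shows "AE x in lebesgue. P (x + a)"
proof (rule AE_distrD[OF lebesgue_translation_distr(2)])
  show "AE x in distr lebesgue lebesgue (\<lambda>x. x + a). P x"
    using assms unfolding lebesgue_translation_distr(1) .
qed

lemma integrable_bounded_support:
  fixes f :: "'a::euclidean_space \<Rightarrow> real"
  assumes "f \<in> borel_measurable lebesgue" "AE x in lebesgue. \<bar>f x\<bar> \<le> K"
    and "\<And>x. x \<notin> ball 0 R \<Longrightarrow> f x = 0"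
  shows "integrable lebesgue f"
proof (rule Bochner_Integration.integrable_bound[of _ "\<lambda>x. K * indicator (ball 0 R) x"])
  show "integrable lebesgue (\<lambda>x::'a. K * indicator (ball 0 R) x)"
    by (intro integrable_mult_right integrable_real_indicator)
      (auto intro: emeasure_bounded_finite[unfolded infinity_ennreal_def])
  show "AE x in lebesgue. norm (f x) \<le> norm (K * indicator (ball 0 R) x)"
    using assms(2) by eventually_elim (use assms(3) in \<open>auto simp: indicator_def\<close>)
qed fact

lemma integrable_indicator_ball:
  "integrable lebesgue (\<lambda>x::'a::euclidean_space. K * indicator (ball 0 R) x :: real)"
  by (intro integrable_mult_right integrable_real_indicator)
    (auto intro: emeasure_bounded_finite[unfolded infinity_ennreal_def])

lemma grad_eq_0_off_support:
  assumes "\<And>y. R \<le> norm y \<Longrightarrow> W y = 0" "R < norm x"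
  shows "grad W x = 0"
proof -
  have "grad W x = grad (\<lambda>_. 0) x"
    using assms by (intro grad_cong[of "- cball 0 R"]) (auto simp: open_Compl)
  also have "\<dots> = 0"
    by (rule grad_eqI) simp
  finally show ?thesis .
qed

definition step :: "nat \<Rightarrow> real" where "step n = 1 / real (Suc n)"

lemma step: "step n > 0" "step n \<noteq> 0" "step n \<le> 1" "filterlim step (at 0) sequentially"
    "filterlim (\<lambda>n. - step n) (at 0) sequentially"
proof -
  show *: "filterlim step (at 0) sequentially"
    unfolding step_def[abs_def] by (rule filterlim_inverse_Suc_at_0)
  show "filterlim (\<lambda>n. - step n) (at 0) sequentially"
    using tendsto_minus[of step 0 sequentially] * by (auto simp: filterlim_at elim: eventually_mono)
qed (auto simp: step_def)

text \<open>The integrals of the difference quotients vanish by translation invariance.\<close>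
lemma integral_grad_eq_0:
  assumes w: "w \<in> Lip UNIV" and supp: "\<And>x. R \<le> norm x \<Longrightarrow> w x = 0"
  shows "(LINT x|lebesgue. grad w x \<bullet> e) = 0"
proof -
  obtain C where C: "C-lipschitz_on UNIV w" using w by (auto simp: Lip_def)
  have [measurable]: "w \<in> borel_measurable borel" using w by (rule borel_Lip)
  have [measurable]: "w \<in> borel_measurable lebesgue" by (simp add: measurable_completion)
  define q where "q n x = (w (x + step n *\<^sub>R e) - w x) / step n" for n x
  have q[measurable]: "q n \<in> borel_measurable lebesgue" for n
    unfolding q_def by (intro measurable_completion) measurable
  have bd: "\<bar>q n x\<bar> \<le> C * norm e" for n x
    unfolding q_def by (rule lipschitz_directional_bound[OF C])
  define R' where "R' = \<bar>R\<bar> + norm e + 1"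
  have off: "q n x = 0" if "x \<notin> ball 0 R'" for n x
  proof -
    have "step n * norm e \<le> 1 * norm e" by (intro mult_right_mono) (auto simp: step)
    moreover have "norm x \<le> norm (x + step n *\<^sub>R e) + norm (step n *\<^sub>R e)"
      by (metis add_diff_cancel norm_triangle_ineq4)
    ultimately have "R \<le> norm (x + step n *\<^sub>R e)"
      using that step(1)[of n] by (simp add: R'_def)
    moreover have "R \<le> norm x"
      using that by (simp add: R'_def) (smt (verit) norm_ge_zero)
    ultimately show ?thesis using supp by (simp add: q_def)
  qed
  have wint: "integrable lebesgue w"
  proof (rule integrable_bounded_support[of _ "C * 2 * \<bar>R\<bar> + \<bar>w 0\<bar>" R])
    show "AE x in lebesgue. \<bar>w x\<bar> \<le> C * 2 * \<bar>R\<bar> + \<bar>w 0\<bar>"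
    proof (rule AE_I2)
      fix x
      have "\<bar>w x - w 0\<bar> \<le> C * norm x"
        using lipschitz_onD[OF C, of x 0] by (simp add: dist_norm)
      moreover have "C * norm x \<le> C * (2 * \<bar>R\<bar>)" if "norm x < R"
        using that lipschitz_on_nonneg[OF C] by (intro mult_left_mono) auto
      moreover have "0 \<le> C * (2 * \<bar>R\<bar>)" using lipschitz_on_nonneg[OF C] by simp
      ultimately show "\<bar>w x\<bar> \<le> C * 2 * \<bar>R\<bar> + \<bar>w 0\<bar>"
        using supp[of x] by (cases "norm x < R") auto
    qed
  qed (use supp in auto)
  have "(LINT x|lebesgue. q n x) = 0" for n
  proof -
    have wint': "integrable lebesgue (\<lambda>x. w (x + a))" for a
      using integrable_distr[OF lebesgue_translation_distr(2)[of a]] wint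
      by (simp add: lebesgue_translation_distr(1))
    have "(LINT x|lebesgue. q n x) = ((LINT x|lebesgue. w (x + step n *\<^sub>R e)) - (LINT x|lebesgue. w x)) / step n"
      unfolding q_def using wint wint' by simp
    then show ?thesis by (simp add: lebesgue_integral_translate)
  qed
  moreover have "(\<lambda>n. LINT x|lebesgue. q n x) \<longlonglongrightarrow> (LINT x|lebesgue. grad w x \<bullet> e)"
  proof (rule integral_dominated_convergence[where w = "\<lambda>x. C * norm e * indicator (ball 0 R') x"])
    show "(\<lambda>x. grad w x \<bullet> e) \<in> borel_measurable lebesgue"
      using grad_measurable[OF w] by simp
    show "AE x in lebesgue. (\<lambda>n. q n x) \<longlonglongrightarrow> grad w x \<bullet> e"
      using AE_differentiable[OF w] unfolding q_def
      by eventually_elim (intro tendsto_difference_quotient_grad step)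
    show "AE x in lebesgue. norm (q n x) \<le> C * norm e * indicator (ball 0 R') x" for n
      using bd off by (auto simp: indicator_def)
    show "integrable lebesgue (\<lambda>x::real^2. C * norm e * indicator (ball 0 R') x)"
      by (rule integrable_indicator_ball)
  qed simp
  ultimately show ?thesis
    by (simp add: LIMSEQ_const_iff)
qed

lemma bounded_of_Lip_support:
  assumes w: "w \<in> Lip UNIV" and supp: "\<And>x. R \<le> norm x \<Longrightarrow> w x = 0"
  obtains B where "B \<ge> 0" "\<And>x. \<bar>w x\<bar> \<le> B"
proof -
  have "compact (w ` cball 0 R)"
    by (intro compact_continuous_image continuous_on_subset[OF continuous_Lip[OF w]]) auto
  then obtain B where B: "\<And>x. norm x \<le> R \<Longrightarrow> \<bar>w x\<bar> \<le> B"
    using compact_imp_bounded[THEN bounded_iff[THEN iffD1]] by fastforce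
  show ?thesis
  proof (rule that[of "\<bar>B\<bar>"])
    show "\<bar>w x\<bar> \<le> \<bar>B\<bar>" for x
      using B[of x] supp[of x] by (cases "norm x \<le> R") auto
  qed simp
qed

lemma Lip_mult_support:
  assumes a: "a \<in> Lip UNIV" and w: "w \<in> Lip UNIV" and supp: "\<And>x. R \<le> norm x \<Longrightarrow> w x = 0"
  shows "(\<lambda>x. a x * w x) \<in> Lip UNIV"
proof -
  obtain A where A: "A-lipschitz_on UNIV a" using a by (auto simp: Lip_def)
  obtain C where C: "C-lipschitz_on UNIV w" using w by (auto simp: Lip_def)
  have A0: "A \<ge> 0" and C0: "C \<ge> 0" using A C lipschitz_on_nonneg by auto
  obtain B where B: "B \<ge> 0" "\<And>x. \<bar>w x\<bar> \<le> B" using bounded_of_Lip_support[OF w supp] by metis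
  have "compact (a ` cball 0 R)"
    by (intro compact_continuous_image continuous_on_subset[OF continuous_Lip[OF a]]) auto
  then obtain K0 where K0: "\<And>x. norm x \<le> R \<Longrightarrow> \<bar>a x\<bar> \<le> K0"
    using compact_imp_bounded[THEN bounded_iff[THEN iffD1]] by fastforce
  define K where "K = \<bar>K0\<bar>"
  have K: "K \<ge> 0" "\<And>x. norm x \<le> R \<Longrightarrow> \<bar>a x\<bar> \<le> K" using K0 by (fastforce simp: K_def)+
  have main: "\<bar>a x * w x - a y * w y\<bar> \<le> (K * C + B * A) * dist x y" if "norm x \<le> R" for x y
  proof -
    have "a x * w x - a y * w y = a x * (w x - w y) + w y * (a x - a y)"
      by (simp add: algebra_simps)
    then have "\<bar>a x * w x - a y * w y\<bar> \<le> \<bar>a x\<bar> * \<bar>w x - w y\<bar> + \<bar>w y\<bar> * \<bar>a x - a y\<bar>"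
      by (metis abs_mult abs_triangle_ineq)
    also have "\<dots> \<le> K * (C * dist x y) + B * (A * dist x y)"
      using lipschitz_onD[OF A, of x y] lipschitz_onD[OF C, of x y] K B that
      by (intro add_mono mult_mono) (auto simp: dist_real_def)
    finally show ?thesis by (simp add: algebra_simps)
  qed
  have "(K * C + B * A)-lipschitz_on UNIV (\<lambda>x. a x * w x)"
  proof (rule lipschitz_onI)
    fix x y
    show "dist (a x * w x) (a y * w y) \<le> (K * C + B * A) * dist x y"
    proof (cases "norm x \<le> R \<or> norm y \<le> R")
      case True
      then show ?thesis
        using main[of x y] main[of y x] by (auto simp: dist_real_def dist_commute abs_minus_commute)
    next
      case False
      then show ?thesis
        using supp[of x] supp[of y] A0 C0 K B by simp
    qed
  qed (use A0 C0 K B in simp)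
  then show ?thesis by (auto simp: Lip_def)
qed

lemma integrable_grad_mult:
  assumes a: "a \<in> Lip UNIV" and w: "w \<in> Lip UNIV" and supp: "\<And>x. R \<le> norm x \<Longrightarrow> w x = 0"
  shows "integrable lebesgue (\<lambda>x. a x * (grad w x \<bullet> e))" "integrable lebesgue (\<lambda>x. w x * (grad a x \<bullet> e))"
    "integrable lebesgue (\<lambda>x. (grad a x \<bullet> e) * (grad w x \<bullet> d))"
proof -
  obtain A where A: "A-lipschitz_on UNIV a" using a by (auto simp: Lip_def)
  obtain C where C: "C-lipschitz_on UNIV w" using w by (auto simp: Lip_def)
  have A0: "A \<ge> 0" and C0: "C \<ge> 0" using A C lipschitz_on_nonneg by auto
  note [measurable] = grad_measurable[OF a] grad_measurable[OF w]
    lebesgue_measurable_Lip[OF a] lebesgue_measurable_Lip[OF w]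
  obtain B where B: "B \<ge> 0" "\<And>x. \<bar>w x\<bar> \<le> B" using bounded_of_Lip_support[OF w supp] by metis
  have "compact (a ` cball 0 (\<bar>R\<bar> + 1))"
    by (intro compact_continuous_image continuous_on_subset[OF continuous_Lip[OF a]]) auto
  then obtain K where K: "\<And>x. norm x \<le> \<bar>R\<bar> + 1 \<Longrightarrow> \<bar>a x\<bar> \<le> K"
    using compact_imp_bounded[THEN bounded_iff[THEN iffD1]] by fastforce
  have K0: "K \<ge> 0" using K[of 0] by simp
  have g: "AE x in lebesgue. \<bar>grad W x \<bullet> e\<bar> \<le> L * norm e" if "L-lipschitz_on UNIV W" for W L e
    using Rademacher[OF that]
  proof eventually_elim
    case (elim x)
    have "\<bar>grad W x \<bullet> e\<bar> \<le> norm (grad W x) * norm e" by (rule Cauchy_Schwarz_ineq2)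
    also have "\<dots> \<le> L * norm e"
      using norm_grad_le[OF that _ _ elim] by (intro mult_right_mono) auto
    finally show ?case .
  qed
  have off: "w x = 0" "grad w x = 0" if "x \<notin> ball 0 (\<bar>R\<bar> + 1)" for x
    using that supp grad_eq_0_off_support[of R w x] by auto
  show "integrable lebesgue (\<lambda>x. w x * (grad a x \<bullet> e))"
  proof (rule integrable_bounded_support[of _ "B * (A * norm e)" "\<bar>R\<bar> + 1"])
    show "AE x in lebesgue. \<bar>w x * (grad a x \<bullet> e)\<bar> \<le> B * (A * norm e)"
      using g[OF A] by eventually_elim (use B in \<open>auto simp: abs_mult intro!: mult_mono\<close>)
  qed (use off in auto)
  show "integrable lebesgue (\<lambda>x. a x * (grad w x \<bullet> e))"
  proof (rule integrable_bounded_support[of _ "K * (C * norm e)" "\<bar>R\<bar> + 1"])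
    show "AE x in lebesgue. \<bar>a x * (grad w x \<bullet> e)\<bar> \<le> K * (C * norm e)"
      using g[OF C, where e=e]
    proof eventually_elim
      case (elim x)
      then show ?case
        using off[of x] K[of x] K0 C0
        by (cases "x \<in> ball 0 (\<bar>R\<bar> + 1)") (auto simp: abs_mult intro!: mult_mono)
    qed
  qed (use off in auto)
  show "integrable lebesgue (\<lambda>x. (grad a x \<bullet> e) * (grad w x \<bullet> d))"
  proof (rule integrable_bounded_support[of _ "(A * norm e) * (C * norm d)" "\<bar>R\<bar> + 1"])
    show "AE x in lebesgue. \<bar>(grad a x \<bullet> e) * (grad w x \<bullet> d)\<bar> \<le> (A * norm e) * (C * norm d)"
      using g[OF A, where e=e] g[OF C, where e=d]
      by eventually_elim (use A0 in \<open>auto simp: abs_mult intro!: mult_mono\<close>)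
  qed (use off in auto)
qed

lemma integral_by_parts_Lip:
  assumes a: "a \<in> Lip UNIV" and w: "w \<in> Lip UNIV" and supp: "\<And>x. R \<le> norm x \<Longrightarrow> w x = 0"
  shows "(LINT x|lebesgue. a x * (grad w x \<bullet> e)) = - (LINT x|lebesgue. w x * (grad a x \<bullet> e))"
proof -
  have "0 = (LINT x|lebesgue. grad (\<lambda>x. a x * w x) x \<bullet> e)"
    using integral_grad_eq_0[OF Lip_mult_support[OF a w supp], where e = e and R = R] supp by simp
  also have "\<dots> = (LINT x|lebesgue. a x * (grad w x \<bullet> e) + w x * (grad a x \<bullet> e))"
  proof (rule integral_cong_AE)
    show "(\<lambda>x. grad (\<lambda>x. a x * w x) x \<bullet> e) \<in> borel_measurable lebesgue"
      using grad_measurable[OF Lip_mult_support[OF a w supp]] by simp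
    show "(\<lambda>x. a x * (grad w x \<bullet> e) + w x * (grad a x \<bullet> e)) \<in> borel_measurable lebesgue"
      using integrable_grad_mult[OF a w supp, THEN borel_measurable_integrable] by simp
    show "AE x in lebesgue. grad (\<lambda>x. a x * w x) x \<bullet> e = a x * (grad w x \<bullet> e) + w x * (grad a x \<bullet> e)"
      using AE_differentiable[OF a] AE_differentiable[OF w]
      by eventually_elim (simp add: grad_mult inner_add_left)
  qed
  also have "\<dots> = (LINT x|lebesgue. a x * (grad w x \<bullet> e)) + (LINT x|lebesgue. w x * (grad a x \<bullet> e))"
    using integrable_grad_mult[OF a w supp] by simp
  finally show ?thesis by linarith
qed

lemma lipschitz_translate:
  "C-lipschitz_on UNIV W \<Longrightarrow> C-lipschitz_on UNIV (\<lambda>x. W (x + a))"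
  for W :: "'a::real_normed_vector \<Rightarrow> real"
  unfolding lipschitz_on_def dist_norm by (metis UNIV_I add_diff_cancel_right)

lemma integrable_lebesgue_translate:
  fixes f :: "'a::euclidean_space \<Rightarrow> real"
  assumes "integrable lebesgue f"
  shows "integrable lebesgue (\<lambda>x. f (x + a))"
  using integrable_distr[OF lebesgue_translation_distr(2)[of a]] assms
  by (simp add: lebesgue_translation_distr(1))

text \<open>In the language of distributions, a gradient has no curl. The product of the forward difference quotients along \<open>a\<close> and
\<open>b\<close> has, after translations, the same integral as the product of the backward difference quotients along \<open>b\<close> and \<open>a\<close>; so
no second derivatives enter.\<close>
lemma integral_grad_grad_commute:
  assumes u: "u \<in> Lip UNIV" and w: "w \<in> Lip UNIV" and supp: "\<And>x. R \<le> norm x \<Longrightarrow> w x = 0"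
  shows "(LINT x|lebesgue. (grad u x \<bullet> a) * (grad w x \<bullet> b)) = (LINT x|lebesgue. (grad u x \<bullet> b) * (grad w x \<bullet> a))"
proof -
  obtain A where A: "A-lipschitz_on UNIV u" using u by (auto simp: Lip_def)
  obtain C where C: "C-lipschitz_on UNIV w" using w by (auto simp: Lip_def)
  have A0: "A \<ge> 0" and C0: "C \<ge> 0" using A C lipschitz_on_nonneg by auto
  note [measurable] = lebesgue_measurable_Lip[OF u] lebesgue_measurable_Lip[OF w]
  define D where "D W e t x = (W (x + t *\<^sub>R e) - W x) / t" for W :: "real^2 \<Rightarrow> real" and e t x
  have tl: "(\<lambda>x. W (x + c)) \<in> borel_measurable lebesgue" if "W \<in> Lip UNIV" for W :: "real^2 \<Rightarrow> real" and c
    using that by (intro lebesgue_measurable_Lip) (auto simp: Lip_def intro: lipschitz_translate)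
  have Dm: "D W e t \<in> borel_measurable lebesgue" if "W \<in> Lip UNIV" for W e t
    unfolding D_def using tl[OF that, of "t *\<^sub>R e"] lebesgue_measurable_Lip[OF that] by simp
  define R' where "R' = \<bar>R\<bar> + norm a + norm b + 1"
  have far: "w (x + t *\<^sub>R e) = 0" if "x \<notin> ball 0 R'" "\<bar>t\<bar> \<le> 1" "e = a \<or> e = b" for x t e
  proof -
    have "\<bar>t\<bar> * norm e \<le> 1 * norm e" using that by (intro mult_right_mono) auto
    moreover have "norm e \<le> norm a + norm b"
      using that(3) by auto
    ultimately have "norm (t *\<^sub>R e) \<le> norm a + norm b"
      by simp
    moreover have "norm x \<le> norm (x + t *\<^sub>R e) + norm (t *\<^sub>R e)"
      by (metis add_diff_cancel norm_triangle_ineq4)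
    moreover have "R' \<le> norm x" using that(1) by simp
    ultimately show ?thesis by (intro supp) (simp add: R'_def)
  qed
  have lim: "(\<lambda>n. LINT x|lebesgue. D u a' (t n) x * D w b' (t n) x)
      \<longlonglongrightarrow> (LINT x|lebesgue. (grad u x \<bullet> a') * (grad w x \<bullet> b'))"
    if t: "filterlim t (at 0) sequentially" "\<And>n. \<bar>t n\<bar> \<le> 1" and b': "b' = a \<or> b' = b" for t a' b'
  proof (rule integral_dominated_convergence[where w = "\<lambda>x. (A * norm a') * (C * norm b') * indicator (ball 0 R') x"])
    show "(\<lambda>x. (grad u x \<bullet> a') * (grad w x \<bullet> b')) \<in> borel_measurable lebesgue"
      using integrable_grad_mult(3)[OF u w supp] by (rule borel_measurable_integrable)
    show "(\<lambda>x. D u a' (t n) x * D w b' (t n) x) \<in> borel_measurable lebesgue" for n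
      using Dm[OF u] Dm[OF w] by simp
    show "integrable lebesgue (\<lambda>x::real^2. (A * norm a') * (C * norm b') * indicator (ball 0 R') x)"
      by (rule integrable_indicator_ball)
    show "AE x in lebesgue. (\<lambda>n. D u a' (t n) x * D w b' (t n) x) \<longlonglongrightarrow> (grad u x \<bullet> a') * (grad w x \<bullet> b')"
      using AE_differentiable[OF u] AE_differentiable[OF w] unfolding D_def
      by eventually_elim (intro tendsto_mult tendsto_difference_quotient_grad t)
    show "AE x in lebesgue. norm (D u a' (t n) x * D w b' (t n) x) \<le> (A * norm a') * (C * norm b') * indicator (ball 0 R') x" for n
    proof (rule AE_I2)
      fix x
      show "norm (D u a' (t n) x * D w b' (t n) x) \<le> (A * norm a') * (C * norm b') * indicator (ball 0 R') x"
      proof (cases "x \<in> ball 0 R'")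
        case True
        have "\<bar>D u a' (t n) x\<bar> * \<bar>D w b' (t n) x\<bar> \<le> (A * norm a') * (C * norm b')"
          unfolding D_def using lipschitz_directional_bound[OF A] lipschitz_directional_bound[OF C] A0
          by (intro mult_mono) auto
        then show ?thesis using True by (simp add: abs_mult)
      next
        case False
        then have "D w b' (t n) x = 0"
          using far[OF False t(2) b', of n] far[OF False, of 0 a] by (simp add: D_def)
        then show ?thesis using False by simp
      qed
    qed
  qed
  obtain B where B: "B \<ge> 0" "\<And>x. \<bar>w x\<bar> \<le> B" using bounded_of_Lip_support[OF w supp] by metis
  have prodint: "integrable lebesgue (\<lambda>x. u (x + c) * w x)" for c
  proof -
    have uc: "(\<lambda>x. u (x + c)) \<in> Lip UNIV" using A by (auto simp: Lip_def intro: lipschitz_translate)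
    from Lip_mult_support[OF uc w supp] have L: "(\<lambda>x. u (x + c) * w x) \<in> Lip UNIV" .
    obtain K where "\<And>x. \<bar>u (x + c) * w x\<bar> \<le> K"
      by (rule bounded_of_Lip_support[OF L, of R]) (use supp in auto)
    then show ?thesis
      by (intro integrable_bounded_support[of _ K R] lebesgue_measurable_Lip[OF L]) (use supp in auto)
  qed
  define I where "I c = (LINT x|lebesgue. u (x + c) * w x)" for c
  have Ishift: "(LINT x|lebesgue. u (x + c) * w (x + d)) = I (c - d)"
      and intshift: "integrable lebesgue (\<lambda>x. u (x + c) * w (x + d))" for c d
  proof -
    define h where "h x = u (x + (c - d)) * w x" for x
    have h: "integrable lebesgue h" unfolding h_def by (rule prodint)
    have eq: "(\<lambda>x. u (x + c) * w (x + d)) = (\<lambda>x. h (x + d))"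
      by (simp add: h_def algebra_simps)
    show "integrable lebesgue (\<lambda>x. u (x + c) * w (x + d))"
      unfolding eq using h by (rule integrable_lebesgue_translate)
    show "(LINT x|lebesgue. u (x + c) * w (x + d)) = I (c - d)"
      unfolding eq I_def h_def[symmetric]
      using h by (intro lebesgue_integral_translate borel_measurable_integrable)
  qed
  have expand: "(LINT x|lebesgue. D u p t x * D w q t x)
      = (I (t *\<^sub>R p - t *\<^sub>R q) - I (t *\<^sub>R p) - I (- (t *\<^sub>R q)) + I 0) / (t * t)" for p q t
  proof -
    have "(\<lambda>x. D u p t x * D w q t x) = (\<lambda>x. (u (x + t *\<^sub>R p) * w (x + t *\<^sub>R q) - u (x + t *\<^sub>R p) * w (x + 0)
        - u (x + 0) * w (x + t *\<^sub>R q) + u (x + 0) * w (x + 0)) / (t * t))"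
      by (simp add: D_def field_simps fun_eq_iff)
    then show ?thesis
      by (simp only: integral_divide_zero Bochner_Integration.integral_add Bochner_Integration.integral_diff
          intshift Bochner_Integration.integrable_diff Bochner_Integration.integrable_add Ishift) simp
  qed
  have "(LINT x|lebesgue. D u a (step n) x * D w b (step n) x)
      = (LINT x|lebesgue. D u b (- step n) x * D w a (- step n) x)" for n
    unfolding expand by simp
  moreover have "(\<lambda>n. LINT x|lebesgue. D u a (step n) x * D w b (step n) x)
      \<longlonglongrightarrow> (LINT x|lebesgue. (grad u x \<bullet> a) * (grad w x \<bullet> b))"
    using step(1,3) by (intro lim step) (auto simp: abs_of_pos)
  moreover have "(\<lambda>n. LINT x|lebesgue. D u b (- step n) x * D w a (- step n) x)
      \<longlonglongrightarrow> (LINT x|lebesgue. (grad u x \<bullet> b) * (grad w x \<bullet> a))"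
    using step(1,3) by (intro lim step) (auto simp: abs_of_pos)
  ultimately show ?thesis
    by (simp add: LIMSEQ_unique)
qed

text \<open>The exceptional null set may contain the whole segment from \<open>x\<close> to \<open>y\<close>. But the mean of \<open>W\<close> over a small ball that moves
along the segment is differentiable at all times, and its derivative is the mean of the derivative of \<open>W\<close>.\<close>
lemma lipschitz_of_AE_grad_bound:
  assumes W: "W \<in> Lip UNIV" and S: "open S" "convex S"
    and bd: "AE x in lebesgue. x \<in> S \<longrightarrow> norm (grad W x) \<le> M" and "0 \<le> M"
  shows "M-lipschitz_on S W"
proof (rule lipschitz_onI)
  obtain C where C: "C-lipschitz_on UNIV W" using W by (auto simp: Lip_def)
  have C0: "C \<ge> 0" using C by (rule lipschitz_on_nonneg)
  fix x y assume x: "x \<in> S" and y: "y \<in> S"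
  define \<tau> where "\<tau> = y - x"
  obtain r where r: "r > 0" "ball x r \<subseteq> S" "ball y r \<subseteq> S"
  proof -
    obtain r1 r2 where "r1 > 0" "ball x r1 \<subseteq> S" "r2 > 0" "ball y r2 \<subseteq> S"
      using S(1) x y openE by metis
    then show ?thesis by (intro that[of "min r1 r2"]) auto
  qed
  have tube: "x + t *\<^sub>R \<tau> + z \<in> S" if "t \<in> {0..1}" "z \<in> ball 0 r" for t z
  proof -
    have "x + z \<in> S" "y + z \<in> S"
      using r that(2) by (auto simp: dist_norm subset_iff)
    then have "(1 - t) *\<^sub>R (x + z) + t *\<^sub>R (y + z) \<in> S"
      using S(2) that(1) by (intro convexD_alt) auto
    then show ?thesis by (simp add: \<tau>_def algebra_simps)
  qed
  have est: "\<bar>W y - W x\<bar> \<le> M * norm \<tau> + 2 * C * d" if d: "0 < d" "d < r" for d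
  proof -
    let ?I = "\<lambda>z::real^2. indicator (ball 0 d) z :: real"
    let ?m = "measure lebesgue (ball (0::real^2) d)"
    have m: "?m > 0"
      using content_ball_pos[OF d(1), of "0::real^2"] by simp
    have mint: "(LINT z|lebesgue. ?I z) = ?m" by simp
    have fin: "emeasure lebesgue (ball (0::real^2) d) < \<infinity>"
      by (simp add: emeasure_bounded_finite[unfolded infinity_ennreal_def])
    have bint: "integrable lebesgue (\<lambda>z. ?I z * g z)"
      if "g \<in> borel_measurable lebesgue" "AE z in lebesgue. \<bar>g z\<bar> \<le> K \<or> z \<notin> ball 0 d" for g K
    proof (rule integrable_bounded_support[of _ "\<bar>K\<bar>" d])
      show "(\<lambda>z. ?I z * g z) \<in> borel_measurable lebesgue"
        using that(1) by (intro borel_measurable_times borel_measurable_indicator) auto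
      show "AE z in lebesgue. \<bar>?I z * g z\<bar> \<le> \<bar>K\<bar>"
        using that(2) by eventually_elim (auto simp: indicator_def)
    qed simp
    have Wt: "(\<lambda>z. W (c + z)) \<in> borel_measurable lebesgue" for c
      using lipschitz_translate[OF C, of c] by (intro lebesgue_measurable_Lip) (auto simp: Lip_def add.commute)
    have Wint: "integrable lebesgue (\<lambda>z. ?I z * W (c + z))" for c
    proof (rule bint[OF Wt, where K = "\<bar>W c\<bar> + C * d"])
      show "AE z in lebesgue. \<bar>W (c + z)\<bar> \<le> \<bar>W c\<bar> + C * d \<or> z \<notin> ball 0 d"
      proof (rule AE_I2)
        fix z
        have "\<bar>W (c + z) - W c\<bar> \<le> C * norm z"
          using lipschitz_onD[OF C, of "c + z" c] by (simp add: dist_norm)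
        moreover have "norm z < d \<Longrightarrow> C * norm z \<le> C * d"
          using C0 by (intro mult_left_mono) auto
        ultimately show "\<bar>W (c + z)\<bar> \<le> \<bar>W c\<bar> + C * d \<or> z \<notin> ball 0 d" by auto
      qed
    qed
    define \<psi> where "\<psi> t = (LINT z|lebesgue. ?I z * W (x + t *\<^sub>R \<tau> + z))" for t
    define \<psi>' where "\<psi>' t = (LINT z|lebesgue. ?I z * (grad W (x + t *\<^sub>R \<tau> + z) \<bullet> \<tau>))" for t
    have gm: "(\<lambda>z. grad W (c + z)) \<in> borel_measurable lebesgue" for c
      using measurable_compose[OF lebesgue_translation_distr(2)[of c] grad_measurable[OF W]] by (simp add: add.commute)
    have gI: "(\<lambda>z. ?I z * (grad W (c + z) \<bullet> \<tau>)) \<in> borel_measurable lebesgue" for c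
      using gm[of c] by (intro borel_measurable_times borel_measurable_indicator borel_measurable_inner) auto
    have der: "(\<psi> has_field_derivative \<psi>' t) (at t)" for t
      unfolding DERIV_def tendsto_at_iff_sequentially comp_def
    proof (intro allI impI)
      fix X :: "nat \<Rightarrow> real" assume X: "\<forall>i. X i \<in> UNIV - {0}" "X \<longlonglongrightarrow> 0"
      have X0: "filterlim X (at 0) sequentially"
        using X by (auto simp: filterlim_at)
      have eq: "(\<psi> (t + X n) - \<psi> t) / X n = (LINT z|lebesgue. ?I z * ((W ((x + t *\<^sub>R \<tau> + z) + X n *\<^sub>R \<tau>) - W (x + t *\<^sub>R \<tau> + z)) / X n))" for n
      proof -
        have "(\<psi> (t + X n) - \<psi> t) / X n = (LINT z|lebesgue. (?I z * W (x + (t + X n) *\<^sub>R \<tau> + z) - ?I z * W (x + t *\<^sub>R \<tau> + z)) / X n)"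
          unfolding \<psi>_def using Wint by simp
        then show ?thesis
          by (simp add: right_diff_distrib scaleR_add_left add_ac diff_divide_distrib)
      qed
      show "(\<lambda>n. (\<psi> (t + X n) - \<psi> t) / X n) \<longlonglongrightarrow> \<psi>' t"
        unfolding eq \<psi>'_def
      proof (rule integral_dominated_convergence[where w = "\<lambda>z. C * norm \<tau> * indicator (ball 0 d) z"])
        show "(\<lambda>z. ?I z * (grad W (x + t *\<^sub>R \<tau> + z) \<bullet> \<tau>)) \<in> borel_measurable lebesgue"
          by (rule gI)
        show "integrable lebesgue (\<lambda>z::real^2. C * norm \<tau> * indicator (ball 0 d) z)"
          by (rule integrable_indicator_ball)
        show "(\<lambda>z. ?I z * ((W ((x + t *\<^sub>R \<tau> + z) + X n *\<^sub>R \<tau>) - W (x + t *\<^sub>R \<tau> + z)) / X n)) \<in> borel_measurable lebesgue" for n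
          using Wt[of "x + t *\<^sub>R \<tau> + X n *\<^sub>R \<tau>"] Wt[of "x + t *\<^sub>R \<tau>"]
          by (intro borel_measurable_times borel_measurable_indicator borel_measurable_divide borel_measurable_diff)
            (auto simp: add_ac)
        have "AE z in lebesgue. W differentiable (at (x + t *\<^sub>R \<tau> + z))"
          using AE_lebesgue_translate[OF AE_differentiable[OF W], of "x + t *\<^sub>R \<tau>"] by (simp add: add.commute)
        then show "AE z in lebesgue. (\<lambda>n. ?I z * ((W ((x + t *\<^sub>R \<tau> + z) + X n *\<^sub>R \<tau>) - W (x + t *\<^sub>R \<tau> + z)) / X n))
            \<longlonglongrightarrow> ?I z * (grad W (x + t *\<^sub>R \<tau> + z) \<bullet> \<tau>)"
          by eventually_elim (intro tendsto_mult_left tendsto_difference_quotient_grad X0)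
        show "AE z in lebesgue. norm (?I z * ((W ((x + t *\<^sub>R \<tau> + z) + X n *\<^sub>R \<tau>) - W (x + t *\<^sub>R \<tau> + z)) / X n)) \<le> C * norm \<tau> * indicator (ball 0 d) z" for n
          using lipschitz_directional_bound[OF C] by (auto simp: indicator_def abs_mult)
      qed
    qed
    have bound: "norm (\<psi>' t) \<le> M * norm \<tau> * ?m" if t: "t \<in> {0..1}" for t
    proof -
      have "AE z in lebesgue. x + t *\<^sub>R \<tau> + z \<in> S \<longrightarrow> norm (grad W (x + t *\<^sub>R \<tau> + z)) \<le> M"
        using AE_lebesgue_translate[OF bd, of "x + t *\<^sub>R \<tau>"] by (simp add: add.commute)
      then have ae: "AE z in lebesgue. \<bar>?I z * (grad W (x + t *\<^sub>R \<tau> + z) \<bullet> \<tau>)\<bar> \<le> M * norm \<tau> * ?I z"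
      proof eventually_elim
        case (elim z)
        show ?case
        proof (cases "z \<in> ball 0 d")
          case True
          then have "norm (grad W (x + t *\<^sub>R \<tau> + z)) \<le> M"
            using elim tube[OF t, of z] d by auto
          then have "\<bar>grad W (x + t *\<^sub>R \<tau> + z) \<bullet> \<tau>\<bar> \<le> M * norm \<tau>"
            by (meson Cauchy_Schwarz_ineq2 mult_right_mono norm_ge_zero order_trans)
          then show ?thesis using True by simp
        qed simp
      qed
      have i: "integrable lebesgue (\<lambda>z. ?I z * (grad W (x + t *\<^sub>R \<tau> + z) \<bullet> \<tau>))"
        by (rule Bochner_Integration.integrable_bound[OF integrable_indicator_ball[of "M * norm \<tau>" d]])
          (use gI ae \<open>0 \<le> M\<close> in \<open>auto elim!: eventually_mono\<close>)
      have "norm (\<psi>' t) \<le> (LINT z|lebesgue. \<bar>?I z * (grad W (x + t *\<^sub>R \<tau> + z) \<bullet> \<tau>)\<bar>)"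
        unfolding \<psi>'_def real_norm_def by (rule integral_abs_bound)
      also have "\<dots> \<le> (LINT z|lebesgue. M * norm \<tau> * ?I z)"
        using i ae by (intro integral_mono_AE integrable_indicator_ball) auto
      also have "\<dots> = M * norm \<tau> * ?m" by simp
      finally show ?thesis .
    qed
    have "norm (\<psi> 1 - \<psi> 0) \<le> M * norm \<tau> * ?m * norm (1 - 0 :: real)"
      using der bound by (intro field_differentiable_bound[of "{0..1}" _ \<psi>'])
        (auto intro: has_field_derivative_at_within)
    then have 1: "\<bar>\<psi> 1 - \<psi> 0\<bar> \<le> M * norm \<tau> * ?m" by simp
    have 2: "\<bar>(\<psi> 1 - \<psi> 0) - (W y - W x) * ?m\<bar> \<le> 2 * C * d * ?m"
    proof -
      have gen: "(LINT z|lebesgue. p z - q z - s z) = (LINT z|lebesgue. p z) - (LINT z|lebesgue. q z) - (LINT z|lebesgue. s z)"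
        if "integrable lebesgue p" "integrable lebesgue q" "integrable lebesgue s" for p q s :: "real^2 \<Rightarrow> real"
        using that by simp
      have eq: "(\<psi> 1 - \<psi> 0) - (W y - W x) * ?m
          = (LINT z|lebesgue. ?I z * W (x + 1 *\<^sub>R \<tau> + z) - ?I z * W (x + 0 *\<^sub>R \<tau> + z) - (W y - W x) * ?I z)"
        unfolding \<psi>_def gen[OF Wint Wint integrable_indicator_ball] by simp
      have "\<bar>(\<psi> 1 - \<psi> 0) - (W y - W x) * ?m\<bar> \<le> (LINT z|lebesgue. \<bar>?I z * W (x + 1 *\<^sub>R \<tau> + z) - ?I z * W (x + 0 *\<^sub>R \<tau> + z) - (W y - W x) * ?I z\<bar>)"
        unfolding eq by (rule integral_abs_bound)
      also have "\<dots> \<le> (LINT z|lebesgue. 2 * C * d * ?I z)"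
      proof (rule integral_mono)
        show "integrable lebesgue (\<lambda>z. \<bar>?I z * W (x + 1 *\<^sub>R \<tau> + z) - ?I z * W (x + 0 *\<^sub>R \<tau> + z) - (W y - W x) * ?I z\<bar>)"
          using Wint integrable_indicator_ball[of "W y - W x" d]
          by (intro integrable_abs Bochner_Integration.integrable_diff) auto
        show "integrable lebesgue (\<lambda>z::real^2. 2 * C * d * ?I z)"
          by (rule integrable_indicator_ball)
        fix z :: "real^2"
        show "\<bar>?I z * W (x + 1 *\<^sub>R \<tau> + z) - ?I z * W (x + 0 *\<^sub>R \<tau> + z) - (W y - W x) * ?I z\<bar> \<le> 2 * C * d * ?I z"
        proof (cases "z \<in> ball 0 d")
          case True
          have "\<bar>W (y + z) - W y\<bar> \<le> C * norm z" "\<bar>W (x + z) - W x\<bar> \<le> C * norm z"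
            using lipschitz_onD[OF C, of "y + z" y] lipschitz_onD[OF C, of "x + z" x] by (simp_all add: dist_norm)
          moreover have "C * norm z \<le> C * d" using True C0 by (intro mult_left_mono) auto
          ultimately have "\<bar>W (y + z) - W (x + z) - (W y - W x)\<bar> \<le> 2 * C * d" by linarith
          then show ?thesis using True by (simp add: \<tau>_def)
        qed simp
      qed
      also have "\<dots> = 2 * C * d * ?m" by simp
      finally show ?thesis .
    qed
    have "\<bar>W y - W x\<bar> * ?m \<le> (M * norm \<tau> + 2 * C * d) * ?m"
    proof -
      have "\<bar>W y - W x\<bar> * ?m = \<bar>(W y - W x) * ?m\<bar>"
        using m by (simp add: abs_mult)
      also have "\<dots> \<le> \<bar>\<psi> 1 - \<psi> 0\<bar> + \<bar>(\<psi> 1 - \<psi> 0) - (W y - W x) * ?m\<bar>"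
        by linarith
      finally show ?thesis
        using 1 2 by (simp add: distrib_right)
    qed
    then show ?thesis using m by simp
  qed
  have "\<bar>W y - W x\<bar> \<le> M * norm \<tau> + e" if "e > 0" for e
  proof -
    define d where "d = min (r / 2) (e / (2 * (C + 1)))"
    have d: "0 < d" "d < r" using r that C0 by (auto simp: d_def)
    have "2 * C * d \<le> 2 * (C + 1) * d" using d by simp
    also have "\<dots> \<le> 2 * (C + 1) * (e / (2 * (C + 1)))"
      using C0 by (intro mult_left_mono) (auto simp: d_def)
    also have "\<dots> = e" using C0 by simp
    finally show ?thesis using est[OF d] by linarith
  qed
  then have "\<bar>W y - W x\<bar> \<le> M * norm \<tau>" by (rule field_le_epsilon)
  then show "dist (W x) (W y) \<le> M * dist x y"
    by (simp add: dist_norm \<tau>_def norm_minus_commute abs_minus_commute)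
qed fact

lemma McShane_extension:
  fixes w :: "'a::metric_space \<Rightarrow> real"
  assumes w: "C-lipschitz_on S w"
  obtains W where "C-lipschitz_on UNIV W" "\<And>x. x \<in> S \<Longrightarrow> W x = w x"
proof (cases "S = {}")
  case True
  then show ?thesis
    using that[of "\<lambda>_. 0"] lipschitz_on_nonneg[OF w] by (auto simp: lipschitz_on_def)
next
  case False
  then obtain y0 where y0: "y0 \<in> S" by auto
  have C0: "C \<ge> 0" using w by (rule lipschitz_on_nonneg)
  define W where "W x = (INF y\<in>S. w y + C * dist x y)" for x
  have bdd: "bdd_below ((\<lambda>y. w y + C * dist x y) ` S)" for x
  proof (rule bdd_belowI2)
    fix y assume y: "y \<in> S"
    have "w y0 - w y \<le> C * dist y0 y"
      using lipschitz_onD[OF w y0 y] by (simp add: dist_real_def)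
    also have "\<dots> \<le> C * (dist x y0 + dist x y)"
      using C0 by (intro mult_left_mono) (metis dist_commute dist_triangle)
    finally show "w y0 - C * dist x y0 \<le> w y + C * dist x y" by (simp add: algebra_simps)
  qed
  have le: "W x \<le> W x' + C * dist x x'" for x x'
  proof -
    have "W x - C * dist x x' \<le> W x'"
      unfolding W_def[of x']
    proof (rule cINF_greatest[OF False])
      fix y assume y: "y \<in> S"
      have "W x \<le> w y + C * dist x y"
        unfolding W_def by (rule cINF_lower[OF bdd y])
      also have "\<dots> \<le> w y + C * (dist x' y + dist x x')"
        using C0 by (intro add_left_mono mult_left_mono) (metis add.commute dist_triangle)
      finally show "W x - C * dist x x' \<le> w y + C * dist x' y" by (simp add: algebra_simps)
    qed
    then show ?thesis by simp
  qed
  show ?thesis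
  proof
    show "C-lipschitz_on UNIV W"
    proof (rule lipschitz_onI)
      show "dist (W x) (W y) \<le> C * dist x y" for x y
        using le[of x y] le[of y x] by (auto simp: dist_real_def dist_commute)
    qed fact
    show "W x = w x" if x: "x \<in> S" for x
    proof (rule antisym)
      show "W x \<le> w x"
        using cINF_lower[OF bdd x, of x] by (simp add: W_def)
      show "w x \<le> W x"
        unfolding W_def
      proof (rule cINF_greatest[OF False])
        fix y assume y: "y \<in> S"
        show "w x \<le> w y + C * dist x y"
          using lipschitz_onD[OF w x y] by (simp add: dist_real_def)
      qed
    qed
  qed
qed

text \<open>A segment that leaves \<open>D\<close> meets the frontier, where \<open>z\<close> vanishes.\<close>
lemma lipschitz_zero_extension:
  fixes z :: "'a::euclidean_space \<Rightarrow> real"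
  assumes z: "C-lipschitz_on (closure D) z" and "\<And>x. x \<in> frontier D \<Longrightarrow> z x = 0"
  shows "C-lipschitz_on UNIV (\<lambda>x. if x \<in> D then z x else 0)"
proof (rule lipschitz_onI)
  show C0: "0 \<le> C" using z by (rule lipschitz_on_nonneg)
  have mixed: "\<bar>z x\<bar> \<le> C * dist x y" if "x \<in> D" "y \<notin> D" for x y
  proof -
    have "closed_segment x y \<inter> frontier D \<noteq> {}"
      using that by (intro connected_Int_frontier) auto
    then obtain b where b: "b \<in> closed_segment x y" "b \<in> frontier D" by blast
    have "\<bar>z x - z b\<bar> \<le> C * dist x b"
      using lipschitz_onD[OF z, of x b] that b closure_subset frontier_subset_closed
      by (auto simp: dist_real_def frontier_def)
    also have "\<dots> \<le> C * dist x y"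
      using b(1) C0 dist_in_closed_segment[of b x y] by (intro mult_left_mono) (auto simp: dist_commute)
    finally show ?thesis using assms(2)[OF b(2)] by simp
  qed
  fix x y
  consider "x \<in> D" "y \<in> D" | "x \<in> D" "y \<notin> D" | "x \<notin> D" "y \<in> D" | "x \<notin> D" "y \<notin> D" by blast
  then show "dist (if x \<in> D then z x else 0) (if y \<in> D then z y else 0) \<le> C * dist x y"
  proof cases
    case 1
    then show ?thesis using lipschitz_onD[OF z, of x y] closure_subset by auto
  next
    case 2
    then show ?thesis using mixed[of x y] by (simp add: dist_real_def)
  next
    case 3
    then show ?thesis using mixed[of y x] by (simp add: dist_real_def dist_commute)
  qed (use C0 in simp)
qed

lemma Lip_add: "U \<in> Lip S \<Longrightarrow> W \<in> Lip S \<Longrightarrow> (\<lambda>x. U x + W x) \<in> Lip S"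
  unfolding Lip_def by (auto intro: lipschitz_on_add)

lemma Lip_diff: "U \<in> Lip S \<Longrightarrow> W \<in> Lip S \<Longrightarrow> (\<lambda>x. U x - W x) \<in> Lip S"
  unfolding Lip_def by (auto intro: lipschitz_on_diff)

lemma Lip_cmult: "W \<in> Lip S \<Longrightarrow> (\<lambda>x. c * W x) \<in> Lip S"
  unfolding Lip_def by (auto intro: lipschitz_on_cmult_real)

lemma Lip_minus: "W \<in> Lip S \<Longrightarrow> (\<lambda>x. - W x) \<in> Lip S"
  unfolding Lip_def by auto

lemma Lip_const: "(\<lambda>x. c) \<in> Lip S"
  unfolding Lip_def by (auto intro: lipschitz_on_constant)

lemma Lip_inner: "(\<lambda>x. a \<bullet> x) \<in> Lip S"
proof -
  have "(norm a)-lipschitz_on S (\<lambda>x. a \<bullet> x)"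
    by (rule lipschitz_onI) (auto simp: dist_real_def dist_norm Cauchy_Schwarz_ineq2 simp flip: inner_diff_right)
  then show ?thesis by (auto simp: Lip_def)
qed

lemma Lip_pos_part:
  assumes "W \<in> Lip S"
  shows "(\<lambda>x. max (W x) 0) \<in> Lip S"
proof -
  obtain C where C: "C-lipschitz_on S W" using assms by (auto simp: Lip_def)
  have "C-lipschitz_on S (\<lambda>x. max (W x) 0)"
  proof (rule lipschitz_onI)
    fix x y assume "x \<in> S" "y \<in> S"
    then have "dist (W x) (W y) \<le> C * dist x y" using lipschitz_onD[OF C] by blast
    then show "dist (max (W x) 0) (max (W y) 0) \<le> C * dist x y"
      by (auto simp: dist_real_def max_def split: if_splits)
  qed (rule lipschitz_on_nonneg[OF C])
  then show ?thesis by (auto simp: Lip_def)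
qed

lemma AE_grad_nonneg_zero:
  assumes "W \<in> Lip UNIV" "\<And>x. 0 \<le> W x"
  shows "AE x in lebesgue. W x = 0 \<longrightarrow> grad W x = 0"
  using AE_differentiable[OF assms(1)]
  by eventually_elim (use assms(2) in \<open>auto intro: grad_eq_0_at_local_min[of _ _ UNIV]\<close>)

lemma Lip_eq_0_of_grad_eq_0:
  assumes z: "z \<in> Lip UNIV" and "AE x in lebesgue. grad z x = 0" and "z a = 0"
  shows "z x = 0"
proof -
  have "0-lipschitz_on UNIV z"
    using assms(2) by (intro lipschitz_of_AE_grad_bound[OF z]) (auto elim: eventually_mono)
  then show ?thesis
    using lipschitz_onD[of 0 UNIV z x a] assms(3) by simp
qed

section \<open>Smooth bumps and weak gradients\<close>

text \<open>The functions \<open>p (1 / x) exp (- 1 / x)\<close>, continued by \<open>0\<close>, form a class that is closed under differentiation.\<close>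
definition flat_exp :: "real poly \<Rightarrow> real \<Rightarrow> real" where
  "flat_exp p x = (if 0 < x then poly p (1 / x) * exp (- (1 / x)) else 0)"

lemma poly_times_exp_minus_tendsto_0:
  fixes p :: "real poly"
  shows "((\<lambda>y. poly p y * exp (- y)) \<longlongrightarrow> 0) at_top"
proof -
  have "((\<lambda>y. \<Sum>i\<le>degree p. coeff p i * (y ^ i / exp y)) \<longlongrightarrow> (\<Sum>i\<le>degree p. coeff p i * 0)) at_top"
    by (intro tendsto_sum tendsto_mult_left tendsto_power_div_exp_0)
  then show ?thesis
    by (simp add: poly_altdef sum_distrib_right exp_minus divide_inverse mult.assoc)
qed

lemma flat_exp_has_derivative:
  "(flat_exp p has_real_derivative flat_exp ([:0, 0, 1:] * (p - pderiv p)) x) (at x)"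
proof -
  consider "x > 0" | "x < 0" | "x = 0" by linarith
  then show ?thesis
  proof cases
    case 1
    have "((\<lambda>x. poly p (1 / x) * exp (- (1 / x))) has_real_derivative
        flat_exp ([:0, 0, 1:] * (p - pderiv p)) x) (at x)"
      using 1 by (auto intro!: derivative_eq_intros poly_DERIV[THEN DERIV_chain2] simp: flat_exp_def)
        (simp add: field_simps power2_eq_square)
    then show ?thesis
      by (rule DERIV_cong_ev[THEN iffD1, rotated -1])
        (use 1 in \<open>auto simp: flat_exp_def intro!: eventually_mono[OF eventually_nhds_in_open[of "{0<..}"]]\<close>)
  next
    case 2
    have "((\<lambda>x. 0) has_real_derivative 0) (at x)" by simp
    then have "(flat_exp p has_real_derivative 0) (at x)"
      by (rule DERIV_cong_ev[THEN iffD1, rotated -1])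
        (use 2 in \<open>auto simp: flat_exp_def intro!: eventually_mono[OF eventually_nhds_in_open[of "{..<0}"]]\<close>)
    then show ?thesis using 2 by (simp add: flat_exp_def)
  next
    case 3
    have right: "((\<lambda>h. (flat_exp p (0 + h) - flat_exp p 0) / h) \<longlongrightarrow> 0) (at_right 0)"
    proof (rule Lim_transform_eventually)
      show "((\<lambda>h. poly ([:0, 1:] * p) (inverse h) * exp (- inverse h)) \<longlongrightarrow> 0) (at_right 0)"
        by (rule filterlim_compose[OF poly_times_exp_minus_tendsto_0 filterlim_inverse_at_top_right])
      show "\<forall>\<^sub>F h in at_right 0. poly ([:0, 1:] * p) (inverse h) * exp (- inverse h) = (flat_exp p (0 + h) - flat_exp p 0) / h"
        using eventually_at_right_less[of 0]
        by eventually_elim (simp add: flat_exp_def divide_inverse)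
    qed
    have left: "((\<lambda>h. (flat_exp p (0 + h) - flat_exp p 0) / h) \<longlongrightarrow> 0) (at_left 0)"
    proof (rule Lim_transform_eventually[OF tendsto_const])
      show "\<forall>\<^sub>F h in at_left 0. 0 = (flat_exp p (0 + h) - flat_exp p 0) / h"
        by (auto simp: flat_exp_def eventually_at_left[of "-1"] intro!: exI[of _ "-1"])
    qed
    have "(flat_exp p has_real_derivative 0) (at 0)"
      unfolding DERIV_def using left right by (simp add: filterlim_split_at_real)
    then show ?thesis using 3 by (simp add: flat_exp_def)
  qed
qed

text \<open>A class of functions that is closed under partial derivatives; so the differentiability of its members entails that of
all their iterated partial derivatives.\<close>
inductive_set smooth_family :: "(real^2 \<Rightarrow> real) set" where
  const: "(\<lambda>x. c) \<in> smooth_family"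
| flat: "(\<lambda>x. flat_exp p (c * x $ i + d)) \<in> smooth_family"
| add: "f \<in> smooth_family \<Longrightarrow> g \<in> smooth_family \<Longrightarrow> (\<lambda>x. f x + g x) \<in> smooth_family"
| mult: "f \<in> smooth_family \<Longrightarrow> g \<in> smooth_family \<Longrightarrow> (\<lambda>x. f x * g x) \<in> smooth_family"

lemma partial_eq_grad: "partial j f x = grad f x $ j"
  by (simp add: grad_def)

lemma smooth_family_partial:
  assumes "f \<in> smooth_family"
  shows "(\<forall>x. f differentiable (at x)) \<and> (\<forall>j. partial j f \<in> smooth_family)"
  using assms
proof induction
  case (const c)
  have "partial j (\<lambda>x. c) = (\<lambda>x. 0)" for j
    by (simp add: partial_def fun_eq_iff)
  then show ?case using smooth_family.const[of 0] by auto
next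
  case (flat p c i d)
  let ?q = "[:0, 0, 1:] * (p - pderiv p)"
  have der: "((\<lambda>x. flat_exp p (c * x $ i + d)) has_derivative
      (\<lambda>h. (flat_exp ?q (c * x $ i + d) * c) *\<^sub>R axis i 1 \<bullet> h)) (at x)" for x :: "real^2"
  proof -
    have "((\<lambda>x. c * x $ i + d) has_derivative (\<lambda>h. c * h $ i)) (at x)"
      by (auto intro!: derivative_eq_intros bounded_linear_imp_has_derivative bounded_linear_vec_nth)
    from has_derivative_compose[OF this flat_exp_has_derivative[unfolded has_field_derivative_def]]
    show ?thesis by (simp add: inner_axis' mult.assoc)
  qed
  have "partial j (\<lambda>x. flat_exp p (c * x $ i + d)) = (\<lambda>x. (c * axis i 1 $ j) * flat_exp ?q (c * x $ i + d))" for j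
    by (rule ext) (simp only: partial_eq_grad grad_eqI[OF der] vector_scaleR_component, simp)
  moreover have "(\<lambda>x. (c * axis i 1 $ j) * flat_exp ?q (c * x $ i + d)) \<in> smooth_family" for j :: 2
    by (intro smooth_family.mult smooth_family.const smooth_family.flat)
  ultimately show ?case
    using der by (auto simp: differentiable_def)
next
  case (add f g)
  have "partial j (\<lambda>x. f x + g x) = (\<lambda>x. partial j f x + partial j g x)" for j
    using add.IH by (intro ext) (simp add: partial_eq_grad grad_add)
  then show ?case using add.IH by (auto intro: smooth_family.add)
next
  case (mult f g)
  have "partial j (\<lambda>x. f x * g x) = (\<lambda>x. f x * partial j g x + g x * partial j f x)" for j
    using mult.IH by (intro ext) (simp add: partial_eq_grad grad_mult)
  moreover have "(\<lambda>x. f x * partial j g x + g x * partial j f x) \<in> smooth_family" for j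
    using mult by (intro smooth_family.add smooth_family.mult) auto
  ultimately show ?case using mult.IH by auto
qed

lemma smooth_family_iterated:
  "f \<in> smooth_family \<Longrightarrow> fold partial is f differentiable (at x)"
  by (induction "is" arbitrary: f) (use smooth_family_partial in auto)

text \<open>As \<open>n\<close> grows these functions increase to the indicator of the box.\<close>
definition bump :: "nat \<Rightarrow> real^2 \<Rightarrow> real^2 \<Rightarrow> real^2 \<Rightarrow> real" where
  "bump n a b x = (\<Prod>i\<in>UNIV. flat_exp 1 (real (Suc n) * x $ i + - real (Suc n) * a $ i)
      * flat_exp 1 (- real (Suc n) * x $ i + real (Suc n) * b $ i))"

lemma smooth_family_prod:
  assumes "finite A" "\<And>i. i \<in> A \<Longrightarrow> f i \<in> smooth_family"
  shows "(\<lambda>x. \<Prod>i\<in>A. f i x) \<in> smooth_family"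
  using assms
proof (induction A)
  case empty
  show ?case by (simp add: smooth_family.const)
next
  case (insert i A)
  then show ?case by (simp add: smooth_family.mult)
qed

lemma bump_smooth: "bump n a b \<in> smooth_family"
  unfolding bump_def[abs_def]
  by (intro smooth_family_prod smooth_family.mult smooth_family.flat) simp

lemma flat_exp_1_bounds: "0 \<le> flat_exp 1 x" "flat_exp 1 x \<le> 1"
  by (auto simp: flat_exp_def)

lemma bump_bounds: "0 \<le> bump n a b x" "bump n a b x \<le> 1"
  unfolding bump_def
  by (auto intro!: prod_nonneg prod_le_1 mult_nonneg_nonneg mult_le_one simp: flat_exp_1_bounds)

lemma bump_eq_0: "x \<notin> box a b \<Longrightarrow> bump n a b x = 0"
proof -
  assume "x \<notin> box a b"
  then obtain i where "x $ i \<le> a $ i \<or> b $ i \<le> x $ i"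
    by (auto simp: mem_box_cart not_less)
  then have "flat_exp 1 (real (Suc n) * x $ i + - real (Suc n) * a $ i)
      * flat_exp 1 (- real (Suc n) * x $ i + real (Suc n) * b $ i) = 0"
    by (auto simp: flat_exp_def not_less zero_less_mult_iff algebra_simps simp del: of_nat_Suc
        dest: mult_left_mono[of _ _ "real (Suc n)"])
  then show ?thesis
    unfolding bump_def by (intro prod_zero) auto
qed

lemma flat_exp_1_tendsto:
  assumes "0 < t"
  shows "(\<lambda>n. flat_exp 1 (real (Suc n) * t)) \<longlonglongrightarrow> 1"
proof -
  have "(\<lambda>n. exp (- (1 / t * (1 / real (Suc n))))) \<longlonglongrightarrow> exp (- (1 / t * 0))"
    by (intro tendsto_intros LIMSEQ_Suc[OF lim_1_over_n])
  then show ?thesis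
    using assms by (simp add: flat_exp_def zero_less_mult_iff mult.commute)
qed

lemma bump_tendsto: "(\<lambda>n. bump n a b x) \<longlonglongrightarrow> indicator (box a b) x"
proof (cases "x \<in> box a b")
  case True
  have "(\<lambda>n. bump n a b x) \<longlonglongrightarrow> (\<Prod>i\<in>(UNIV::2 set). 1 * 1)"
    unfolding bump_def
  proof (intro tendsto_prod tendsto_mult)
    fix i :: 2
    have "0 < x $ i - a $ i" "0 < b $ i - x $ i"
      using True by (auto simp: mem_box_cart)
    from this[THEN flat_exp_1_tendsto]
    show "(\<lambda>n. flat_exp 1 (real (Suc n) * x $ i + - real (Suc n) * a $ i)) \<longlonglongrightarrow> 1"
      "(\<lambda>n. flat_exp 1 (- real (Suc n) * x $ i + real (Suc n) * b $ i)) \<longlonglongrightarrow> 1"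
      by (simp_all add: algebra_simps del: of_nat_Suc)
  qed
  then show ?thesis using True by simp
qed (simp add: bump_eq_0)

lemma test_fun_bump:
  assumes "\<phi> \<in> smooth_family" "cbox c d \<subseteq> S"
  shows "test_fun S (\<lambda>x. bump n c d x * \<phi> x)"
proof -
  have "{x. bump n c d x * \<phi> x \<noteq> 0} \<subseteq> cbox c d"
    using bump_eq_0 box_subset_cbox by fastforce
  then have cl: "closure {x. bump n c d x * \<phi> x \<noteq> 0} \<subseteq> cbox c d"
    by (intro closure_minimal) auto
  then have "compact (closure {x. bump n c d x * \<phi> x \<noteq> 0})"
    by (meson bounded_cbox bounded_subset closed_closure compact_eq_bounded_closed)
  then show ?thesis
    unfolding test_fun_def
    using smooth_family_iterated[OF smooth_family.mult[OF bump_smooth assms(1)]] cl assms(2) by auto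
qed

lemma test_fun_Lip:
  assumes "test_fun S \<phi>"
  obtains R where "\<phi> \<in> Lip UNIV" "\<And>x. R \<le> norm x \<Longrightarrow> \<phi> x = 0"
proof -
  have d0: "\<phi> differentiable (at x)" for x
    using assms unfolding test_fun_def by (metis fold_simps(1))
  have d1: "partial i \<phi> differentiable (at x)" for i x
    using assms unfolding test_fun_def by (metis fold_simps)
  have cont: "continuous_on UNIV (\<lambda>x. grad \<phi> x)"
    unfolding grad_def
    by (intro continuous_on_vec_lambda differentiable_imp_continuous_on) (auto simp: differentiable_on_def d1)
  have "bounded (closure {x. \<phi> x \<noteq> 0})"
    using assms by (simp add: test_fun_def compact_imp_bounded)
  then obtain r where r: "\<And>x. \<phi> x \<noteq> 0 \<Longrightarrow> norm x \<le> r"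
    using closure_subset by (metis (mono_tags, lifting) bounded_iff mem_Collect_eq subsetD)
  have z: "\<phi> x = 0" if "r + 1 \<le> norm x" for x
    using r[of x] that by auto
  have "compact ((\<lambda>x. grad \<phi> x) ` cball 0 (r + 1))"
    by (intro compact_continuous_image continuous_on_subset[OF cont]) auto
  then obtain K where K: "\<And>x. norm x \<le> r + 1 \<Longrightarrow> norm (grad \<phi> x) \<le> K"
    using compact_imp_bounded[THEN bounded_iff[THEN iffD1]] by fastforce
  have bd: "norm (grad \<phi> x) \<le> \<bar>K\<bar>" for x
    using K[of x] grad_eq_0_off_support[of "r + 1" \<phi> x] z by (cases "norm x \<le> r + 1") auto
  have "\<bar>K\<bar>-lipschitz_on UNIV \<phi>"
  proof (rule lipschitz_onI)
    fix x y
    have "norm (\<phi> x - \<phi> y) \<le> \<bar>K\<bar> * norm (x - y)"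
    proof (rule differentiable_bound[of UNIV \<phi> "\<lambda>x h. grad \<phi> x \<bullet> h"])
      show "onorm (\<lambda>h. grad \<phi> x \<bullet> h) \<le> \<bar>K\<bar>" for x
        using bd[of x] by (intro onorm_le) (metis Cauchy_Schwarz_ineq2 mult_right_mono norm_ge_zero order_trans real_norm_def)
    qed (use has_derivative_grad[OF d0] in auto)
    then show "dist (\<phi> x) (\<phi> y) \<le> \<bar>K\<bar> * dist x y" by (simp add: dist_norm)
  qed simp
  then show ?thesis
    using that[of "r + 1"] z by (auto simp: Lip_def)
qed

text \<open>A product of two bumps is an admissible test function if one of the boxes has its closure in \<open>S\<close>, and it converges to the
indicator of the intersection of the boxes. So the restriction of \<open>k\<close> to a box in \<open>S\<close> has vanishing integrals over all
boxes.\<close>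
lemma fundamental_lemma:
  fixes k :: "real^2 \<Rightarrow> real"
  assumes k: "k \<in> borel_measurable lebesgue" and bd: "AE x in lebesgue. \<bar>k x\<bar> \<le> K" and S: "open S"
    and test: "\<And>\<phi>. test_fun S \<phi> \<Longrightarrow> (LINT x|lebesgue. k x * \<phi> x) = 0"
  shows "AE x in lebesgue. x \<in> S \<longrightarrow> k x = 0"
proof -
  obtain k' where k'[measurable]: "k' \<in> borel_measurable lborel" and kk': "AE x in lborel. k x = k' x"
    using completion_ex_borel_measurable_real[OF k] by auto
  have kkl: "AE x in lebesgue. k x = k' x" using kk' by (simp add: AE_completion_iff)
  have bd': "AE x in lborel. \<bar>k' x\<bar> \<le> K"
    using kk' bd[unfolded AE_completion_iff] by eventually_elim simp
  have bd'': "AE x in lebesgue. \<bar>k' x\<bar> \<le> K"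
    using bd' by (simp add: AE_completion_iff)
  have k'l: "k' \<in> borel_measurable lebesgue" using k' by (rule measurable_completion)
  have smooth_borel: "\<phi> \<in> borel_measurable borel" if "\<phi> \<in> smooth_family" for \<phi>
    using smooth_family_partial[OF that]
    by (intro borel_measurable_continuous_onI differentiable_imp_continuous_on) (auto simp: differentiable_on_def)
  have bm[measurable]: "bump n a b \<in> borel_measurable borel" for n a b
    by (rule smooth_borel[OF bump_smooth])
  have cbox0: "AE x in lebesgue. x \<in> cbox c d \<longrightarrow> k x = 0" if cd: "cbox c d \<subseteq> S" for c d
  proof -
    have "AE x in lborel. indicator (box c d) x * k' x = 0"
    proof (rule AE_eq_0_of_box_integrals_eq_0)
      show "AE x in lborel. \<bar>indicator (box c d) x * k' x\<bar> \<le> \<bar>K\<bar>"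
        using bd' by eventually_elim (auto simp: indicator_def)
      fix l u :: "real^2"
      have zero: "(LINT x|lborel. k' x * (bump n c d x * bump n l u x)) = 0" for n
      proof -
        have "(LINT x|lborel. k' x * (bump n c d x * bump n l u x)) = (LINT x|lebesgue. k' x * (bump n c d x * bump n l u x))"
          by (rule integral_completion[symmetric]) simp
        also have "\<dots> = (LINT x|lebesgue. k x * (bump n c d x * bump n l u x))"
        proof (rule integral_cong_AE)
          show "(\<lambda>x. k' x * (bump n c d x * bump n l u x)) \<in> borel_measurable lebesgue"
            by (rule measurable_completion) simp
          show "(\<lambda>x. k x * (bump n c d x * bump n l u x)) \<in> borel_measurable lebesgue"
            by (intro borel_measurable_times k) (auto intro!: measurable_completion)
          show "AE x in lebesgue. k' x * (bump n c d x * bump n l u x) = k x * (bump n c d x * bump n l u x)"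
            using kkl by eventually_elim simp
        qed
        also have "\<dots> = 0"
          by (rule test[OF test_fun_bump[OF bump_smooth cd]])
        finally show ?thesis .
      qed
      have "(\<lambda>n. LINT x|lborel. k' x * (bump n c d x * bump n l u x))
          \<longlonglongrightarrow> (LINT x|lborel. k' x * (indicator (box c d) x * indicator (box l u) x))"
      proof (rule integral_dominated_convergence[where w = "\<lambda>x. \<bar>K\<bar> * indicator (box c d) x"])
        show "integrable lborel (\<lambda>x. \<bar>K\<bar> * indicator (box c d) x)"
          by (intro integrable_mult_right integrable_real_indicator)
            (auto intro: emeasure_lborel_box_finite[unfolded infinity_ennreal_def])
        show "AE x in lborel. (\<lambda>n. k' x * (bump n c d x * bump n l u x))
            \<longlonglongrightarrow> k' x * (indicator (box c d) x * indicator (box l u) x)"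
          by (intro AE_I2 tendsto_mult_left tendsto_mult bump_tendsto)
        show "AE x in lborel. norm (k' x * (bump n c d x * bump n l u x)) \<le> \<bar>K\<bar> * indicator (box c d) x" for n
          using bd'
        proof eventually_elim
          case (elim x)
          show ?case
          proof (cases "x \<in> box c d")
            case True
            have "\<bar>k' x\<bar> * (bump n c d x * bump n l u x) \<le> \<bar>K\<bar> * 1"
              using elim bump_bounds by (intro mult_mono mult_le_one) auto
            then show ?thesis using True bump_bounds by (simp add: abs_mult)
          qed (simp add: bump_eq_0)
        qed
      qed simp_all
      then have "(LINT x|lborel. k' x * (indicator (box c d) x * indicator (box l u) x)) = 0"
        unfolding zero by (simp add: LIMSEQ_const_iff)
      then show "(LINT x:box l u|lborel. indicator (box c d) x * k' x) = 0"
        by (simp add: set_lebesgue_integral_def mult_ac)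
    qed simp
    then have "AE x in lebesgue. indicator (box c d) x * k' x = 0"
      by (simp add: AE_completion_iff)
    moreover have "AE x in lebesgue. x \<notin> cbox c d - box c d"
      using negligible_frontier_interval[of c d] unfolding negligible_iff_null_sets by (intro AE_not_in)
    ultimately show ?thesis
      using kkl by eventually_elim (auto simp: indicator_def split: if_splits)
  qed
  obtain \<D> where D: "countable \<D>" "\<D> \<subseteq> Pow S" "\<And>X. X \<in> \<D> \<Longrightarrow> \<exists>a b. X = cbox a b" "\<Union>\<D> = S"
    using open_countable_Union_open_cbox[OF S] by metis
  have "AE x in lebesgue. \<forall>X\<in>\<D>. x \<in> X \<longrightarrow> k x = 0"
    using D(2,3) by (subst AE_ball_countable[OF D(1)]) (fastforce intro: cbox0)
  then show ?thesis
    by eventually_elim (use D(4) in auto)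
qed

text \<open>By partial integration the pointwise gradient is a weak gradient, and weak gradients are unique.\<close>
lemma weak_partial_Lip_eq_grad:
  assumes V: "V \<in> Lip UNIV" and S: "open S" and weak: "has_weak_partial S i V h"
    and h: "h \<in> borel_measurable lebesgue" "AE x in lebesgue. \<bar>h x\<bar> \<le> K"
  shows "AE x in lebesgue. x \<in> S \<longrightarrow> grad V x $ i = h x"
proof -
  obtain C where C: "C-lipschitz_on UNIV V" using V by (auto simp: Lip_def)
  have gm: "(\<lambda>x. grad V x $ i) \<in> borel_measurable lebesgue"
    using grad_measurable[OF V] borel_measurable_inner[OF _ borel_measurable_const, of "grad V" lebesgue "axis i 1"]
    by (simp add: inner_axis)
  have gb: "AE x in lebesgue. \<bar>grad V x $ i\<bar> \<le> C"
    using AE_differentiable[OF V]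
    by eventually_elim (use norm_grad_le[OF C] component_le_norm_cart order_trans in blast)
  have "AE x in lebesgue. x \<in> S \<longrightarrow> grad V x $ i - h x = 0"
  proof (rule fundamental_lemma[OF _ _ S])
    show "(\<lambda>x. grad V x $ i - h x) \<in> borel_measurable lebesgue"
      using gm h(1) by simp
    show "AE x in lebesgue. \<bar>grad V x $ i - h x\<bar> \<le> C + K"
      using gb h(2) by eventually_elim simp
    fix \<phi> assume \<phi>: "test_fun S \<phi>"
    then obtain R where R: "\<phi> \<in> Lip UNIV" "\<And>x. R \<le> norm x \<Longrightarrow> \<phi> x = 0"
      using test_fun_Lip by metis
    have supp: "\<phi> x = 0" "grad \<phi> x = 0" if "x \<notin> S" for x
    proof -
      have x: "x \<in> - closure {x. \<phi> x \<noteq> 0}"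
        using \<phi> that by (auto simp: test_fun_def)
      have z: "\<phi> y = 0" if "y \<in> - closure {x. \<phi> x \<noteq> 0}" for y
        using that closure_subset[of "{x. \<phi> x \<noteq> 0}"] by auto
      show "\<phi> x = 0" using z[OF x] .
      have "grad \<phi> x = grad (\<lambda>_. 0) x"
        by (rule grad_cong[OF _ x z]) auto
      also have "\<dots> = 0" by (rule grad_eqI) simp
      finally show "grad \<phi> x = 0" .
    qed
    obtain B where B: "B \<ge> 0" "\<And>x. \<bar>\<phi> x\<bar> \<le> B" using bounded_of_Lip_support[OF R(1,2)] by metis
    have hint: "integrable lebesgue (\<lambda>x. h x * \<phi> x)"
    proof (rule integrable_bounded_support[of _ "\<bar>K\<bar> * B" "R"])
      show "AE x in lebesgue. \<bar>h x * \<phi> x\<bar> \<le> \<bar>K\<bar> * B"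
        using h(2) by eventually_elim (use B in \<open>auto simp: abs_mult intro!: mult_mono\<close>)
      show "(\<lambda>x. h x * \<phi> x) \<in> borel_measurable lebesgue"
        using h(1) lebesgue_measurable_Lip[OF R(1)] by simp
    qed (use R(2) in auto)
    have gint: "integrable lebesgue (\<lambda>x. \<phi> x * (grad V x \<bullet> axis i 1))"
      using integrable_grad_mult(2)[OF V R(1), of R] R(2) by blast
    have "(LINT x|lebesgue. V x * (grad \<phi> x \<bullet> axis i 1)) = - (LINT x|lebesgue. \<phi> x * (grad V x \<bullet> axis i 1))"
      using integral_by_parts_Lip[OF V R(1), of R] R(2) by blast
    moreover have "(LINT x|lebesgue. V x * (grad \<phi> x \<bullet> axis i 1)) = (LINT x:S|lebesgue. V x * partial i \<phi> x)"
      unfolding set_lebesgue_integral_def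
      by (intro Bochner_Integration.integral_cong) (auto simp: partial_eq_grad inner_axis indicator_def supp)
    moreover have "(LINT x:S|lebesgue. V x * partial i \<phi> x) = - (LINT x:S|lebesgue. h x * \<phi> x)"
      using weak \<phi> by (auto simp: has_weak_partial_def)
    moreover have "(LINT x:S|lebesgue. h x * \<phi> x) = (LINT x|lebesgue. h x * \<phi> x)"
      unfolding set_lebesgue_integral_def
      by (intro Bochner_Integration.integral_cong) (auto simp: indicator_def supp)
    ultimately have "(LINT x|lebesgue. \<phi> x * (grad V x \<bullet> axis i 1)) - (LINT x|lebesgue. h x * \<phi> x) = 0"
      by simp
    then have "(LINT x|lebesgue. \<phi> x * (grad V x \<bullet> axis i 1) - h x * \<phi> x) = 0"
      using gint hint by simp
    then show "(LINT x|lebesgue. (grad V x $ i - h x) * \<phi> x) = 0"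
      by (simp add: inner_axis algebra_simps)
  qed
  then show ?thesis by eventually_elim simp
qed

section \<open>Lagrangeans and their minimizers\<close>

lemma regular_has_derivative:
  assumes "regular_lagrangean f" "0 \<le> x"
  shows "(f has_real_derivative hderiv f x) (at x within {0..})"
  using assms unfolding regular_lagrangean_def C1_halfline_def hderiv_def
  by (simp add: has_real_derivative_iff_has_vector_derivative vector_derivative_works[symmetric])

text \<open>A one-sided limit of difference quotients, so \<open>x = 0\<close> is included; strictness comes from applying the weak inequality
at the midpoint.\<close>
lemma regular_tangent_less:
  assumes f: "regular_lagrangean f" and "0 \<le> x" "0 \<le> y" "x \<noteq> y"
  shows "f x + hderiv f x * (y - x) < f y"
proof -
  have sc: "f ((1 - t) * x + t * y) < (1 - t) * f x + t * f y"
    if "x \<noteq> y" "0 < t" "t < 1" "0 \<le> x" "0 \<le> y" for x y t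
    using f that unfolding regular_lagrangean_def strictly_convex_on_def by auto
  have weak: "f x + hderiv f x * (y - x) \<le> f y" if xy: "0 \<le> x" "0 \<le> y" "x \<noteq> y" for x y
  proof -
    have "filterlim (\<lambda>t. x + t * (y - x)) (at x within {0..}) (at_right 0)"
      unfolding filterlim_at
    proof
      show "((\<lambda>t. x + t * (y - x)) \<longlongrightarrow> x) (at_right 0)"
        by (auto intro!: tendsto_eq_intros)
      show "\<forall>\<^sub>F t in at_right 0. x + t * (y - x) \<in> {0..} \<and> x + t * (y - x) \<noteq> x"
        unfolding eventually_at_right_field
      proof (intro exI[of _ 1] conjI allI impI)
        fix t :: real assume t: "0 < t" "t < 1"
        have "0 \<le> (1 - t) * x + t * y" using t xy by simp
        then show "x + t * (y - x) \<in> {0..}" by (simp add: algebra_simps)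
        show "x + t * (y - x) \<noteq> x" using t xy by simp
      qed simp
    qed
    from filterlim_compose[OF regular_has_derivative[OF f xy(1), unfolded has_field_derivative_iff] this]
    have "((\<lambda>t. (f (x + t * (y - x)) - f x) / (t * (y - x)) * (y - x)) \<longlongrightarrow> hderiv f x * (y - x)) (at_right 0)"
      by (intro tendsto_mult_right) simp
    then have "hderiv f x * (y - x) \<le> f y - f x"
    proof (rule tendsto_upperbound)
      show "\<forall>\<^sub>F t in at_right 0. (f (x + t * (y - x)) - f x) / (t * (y - x)) * (y - x) \<le> f y - f x"
        unfolding eventually_at_right_field
      proof (intro exI[of _ 1] conjI allI impI)
        fix t :: real assume t: "0 < t" "t < 1"
        have "f (x + t * (y - x)) - f x \<le> t * (f y - f x)"
          using sc[OF xy(3) t xy(1,2)] by (simp add: algebra_simps)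
        then have "(f (x + t * (y - x)) - f x) / t \<le> f y - f x"
          using t by (simp add: pos_divide_le_eq mult.commute)
        moreover have "(f (x + t * (y - x)) - f x) / (t * (y - x)) * (y - x) = (f (x + t * (y - x)) - f x) / t"
          using t xy(3) by simp
        ultimately show "(f (x + t * (y - x)) - f x) / (t * (y - x)) * (y - x) \<le> f y - f x"
          by simp
      qed simp
    qed simp
    then show ?thesis by simp
  qed
  show ?thesis
  proof -
    define m where "m = (x + y) / 2"
    define P where "P = hderiv f x * (m - x)"
    have "y - x = 2 * (m - x)" by (simp add: m_def field_simps)
    then have eq: "hderiv f x * (y - x) = 2 * P" by (simp add: P_def)
    have "f x + P \<le> f m"
      using assms unfolding P_def by (intro weak) (auto simp: m_def)
    moreover have "f m < (f x + f y) / 2"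
    proof -
      have "(1 - 1/2) * x + 1/2 * y = m" by (simp add: m_def)
      then show ?thesis using sc[of x y "1/2"] assms by simp
    qed
    ultimately show ?thesis unfolding eq by argo
  qed
qed

lemma regular_hderiv_less:
  assumes f: "regular_lagrangean f" and "0 \<le> x" "x < y"
  shows "hderiv f x < hderiv f y"
proof -
  have "f x + hderiv f x * (y - x) + (f y + hderiv f y * (x - y)) < f y + f x"
    using regular_tangent_less[OF f, of x y] regular_tangent_less[OF f, of y x] assms by auto
  then have "0 < (hderiv f y - hderiv f x) * (y - x)"
    by (simp add: algebra_simps)
  then show ?thesis
    using assms(3) by (simp add: zero_less_mult_iff)
qed

lemma regular_hderiv_le:
  assumes f: "regular_lagrangean f" and "0 \<le> x" "x \<le> y"
  shows "hderiv f x \<le> hderiv f y"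
  using regular_hderiv_less[OF f, of x y] assms by (cases "x = y") auto

lemma regular_hderiv2:
  assumes f: "regular_lagrangean f" and x: "0 < x"
  shows "(hderiv f has_real_derivative hderiv2 f x) (at x)"
proof -
  have "at x within {0..} = at x"
    using x by (intro at_within_interior) (auto simp: interior_real_atLeast)
  moreover have "hderiv f differentiable (at x)"
    using f x unfolding regular_lagrangean_def C2_loc_holder_def by auto
  ultimately show ?thesis
    unfolding hderiv2_def hderiv_def[of "hderiv f"]
    by (simp add: has_real_derivative_iff_has_vector_derivative vector_derivative_works[symmetric])
qed

lemma regular_hderiv2_nonneg:
  assumes f: "regular_lagrangean f" and x: "0 < x"
  shows "0 \<le> hderiv2 f x"
proof (rule ccontr)
  assume "\<not> 0 \<le> hderiv2 f x"
  then obtain d where d: "d > 0" "\<And>h. 0 < h \<Longrightarrow> h < d \<Longrightarrow> hderiv f (x + h) < hderiv f x"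
    using DERIV_neg_dec_right[OF regular_hderiv2[OF f x]] by auto
  show False
    using d(2)[of "d / 2"] d(1) regular_hderiv_less[OF f, of x "x + d / 2"] x by auto
qed

lemma regular_hderiv2_continuous:
  assumes f: "regular_lagrangean f" and a: "0 < a"
  shows "continuous_on {a..b} (hderiv2 f)"
proof -
  obtain \<kappa> where \<kappa>: "0 < \<kappa>" "C2_loc_holder \<kappa> f"
    using f unfolding regular_lagrangean_def by auto
  have "compact {a..b}" "{a..b} \<subseteq> {0<..}" using a by auto
  then have "\<exists>C. \<forall>x\<in>{a..b}. \<forall>y\<in>{a..b}. \<bar>hderiv2 f x - hderiv2 f y\<bar> \<le> C * \<bar>x - y\<bar> powr \<kappa>"
    by (intro \<kappa>(2)[unfolded C2_loc_holder_def, THEN conjunct2, THEN conjunct2, rule_format] conjI)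
  then obtain C where C: "\<forall>x\<in>{a..b}. \<forall>y\<in>{a..b}. \<bar>hderiv2 f x - hderiv2 f y\<bar> \<le> C * \<bar>x - y\<bar> powr \<kappa>" ..
  show ?thesis
    unfolding continuous_on_def
  proof
    fix x assume x: "x \<in> {a..b}"
    have "((\<lambda>y. C * \<bar>y - x\<bar> powr \<kappa>) \<longlongrightarrow> C * 0) (at x within {a..b})"
    proof (rule tendsto_mult_left)
      have "((\<lambda>y. \<bar>y - x\<bar>) \<longlongrightarrow> 0) (at x within {a..b})"
        by (auto intro!: tendsto_eq_intros)
      then show "((\<lambda>y. \<bar>y - x\<bar> powr \<kappa>) \<longlongrightarrow> 0) (at x within {a..b})"
        using tendsto_powr'[of "\<lambda>y. \<bar>y - x\<bar>" 0 _ "\<lambda>_. \<kappa>" \<kappa>] \<kappa>(1) by auto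
    qed
    then have lim: "((\<lambda>y. C * \<bar>y - x\<bar> powr \<kappa>) \<longlongrightarrow> 0) (at x within {a..b})" by simp
    show "(hderiv2 f \<longlongrightarrow> hderiv2 f x) (at x within {a..b})"
    proof (rule Lim_null[THEN iffD2], rule Lim_null_comparison[OF _ lim])
      show "\<forall>\<^sub>F y in at x within {a..b}. norm (hderiv2 f y - hderiv2 f x) \<le> C * \<bar>y - x\<bar> powr \<kappa>"
        using C[rule_format, OF _ x] by (auto simp: eventually_at intro: exI[of _ 1])
    qed
  qed
qed

text \<open>Since \<open>f'(0) = 0\<close>, the function \<open>p \<mapsto> f \<bar>p\<bar>\<close> is convex and differentiable on the whole plane, with the gradient
\<open>stress\<close> below.\<close>
locale degenerate_lagrangean =
  fixes f :: "real \<Rightarrow> real"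
  assumes regular: "regular_lagrangean f" and hderiv_0: "hderiv f 0 = 0"
begin

lemma hderiv_nonneg: "0 \<le> x \<Longrightarrow> 0 \<le> hderiv f x"
  using regular_hderiv_le[OF regular, of 0 x] hderiv_0 by simp

lemma hderiv_pos: "0 < x \<Longrightarrow> 0 < hderiv f x"
  using regular_hderiv_less[OF regular, of 0 x] hderiv_0 by simp

lemma less_lagrangean: "0 \<le> x \<Longrightarrow> x < y \<Longrightarrow> f x < f y"
  using regular_tangent_less[OF regular, of x y] hderiv_nonneg[of x] by (smt (verit) mult_nonneg_nonneg)

lemma le_lagrangean: "0 \<le> x \<Longrightarrow> x \<le> y \<Longrightarrow> f x \<le> f y"
  using less_lagrangean[of x y] by (cases "x = y") auto

lemma continuous_lagrangean: "continuous_on {0..} f"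
  using regular_has_derivative[OF regular]
  by (meson DERIV_continuous atLeast_iff continuous_on_eq_continuous_within)

lemma continuous_hderiv: "continuous_on {0..} (hderiv f)"
  using regular unfolding regular_lagrangean_def C1_halfline_def by blast

lemma continuous_norm_comp:
  assumes "continuous_on {0..} g"
  shows "continuous_on UNIV (\<lambda>p::'a::real_normed_vector. g (norm p))"
  by (rule continuous_on_compose2[OF assms]) (auto intro: continuous_intros)

definition stress :: "real^2 \<Rightarrow> real^2" where
  "stress p = (if p = 0 then 0 else (hderiv f (norm p) / norm p) *\<^sub>R p)"

lemma flux_eq_stress: "flux f u x = stress (grad u x)"
  by (simp add: flux_def stress_def)

lemma norm_stress: "norm (stress p) = hderiv f (norm p)"
  using hderiv_nonneg[of "norm p"] by (auto simp: stress_def hderiv_0)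

lemma stress_inner_self: "stress p \<bullet> p = hderiv f (norm p) * norm p"
  by (auto simp: stress_def hderiv_0 power2_norm_eq_inner[symmetric] power2_eq_square)

lemma stress_inner_le: "stress p \<bullet> q \<le> hderiv f (norm p) * norm q"
  by (metis norm_cauchy_schwarz norm_stress)

text \<open>The two vectors \<open>stress p\<close> and \<open>p\<close> are parallel, so by the Cauchy-Schwarz inequality it suffices that \<open>f'\<close> is increasing.\<close>
lemma stress_monotone: "0 \<le> (stress p - stress q) \<bullet> (p - q)"
proof -
  have "(hderiv f (norm p) - hderiv f (norm q)) * (norm p - norm q) \<ge> 0"
    using regular_hderiv_le[OF regular, of "norm p" "norm q"] regular_hderiv_le[OF regular, of "norm q" "norm p"]
    by (cases "norm p \<le> norm q") (auto simp: mult_nonpos_nonpos)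
  moreover have "(stress p - stress q) \<bullet> (p - q) \<ge> (hderiv f (norm p) - hderiv f (norm q)) * (norm p - norm q)"
    using stress_inner_le[of p q] stress_inner_le[of q p]
    by (simp add: inner_diff_left inner_diff_right stress_inner_self algebra_simps)
  ultimately show ?thesis by linarith
qed

lemma lagrangean_tangent: "f (norm a) + stress a \<bullet> (p - a) \<le> f (norm p)"
proof -
  have "f (norm a) + hderiv f (norm a) * (norm p - norm a) \<le> f (norm p)"
    using regular_tangent_less[OF regular, of "norm a" "norm p"] by (cases "norm a = norm p") auto
  then show ?thesis
    using stress_inner_le[of a p] by (simp add: inner_diff_right stress_inner_self algebra_simps)
qed

lemma lagrangean_midpoint_le: "f (norm ((1/2) *\<^sub>R (p + q))) \<le> (f (norm p) + f (norm q)) / 2"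
  and lagrangean_midpoint_eqD: "f (norm ((1/2) *\<^sub>R (p + q))) = (f (norm p) + f (norm q)) / 2 \<Longrightarrow> p = q"
  for p q :: "real^2"
proof -
  define m where "m = (norm p + norm q) / 2"
  have m0: "0 \<le> norm ((1/2) *\<^sub>R (p + q))" by simp
  have le: "norm ((1/2) *\<^sub>R (p + q)) \<le> m"
    using norm_triangle_ineq[of p q] by (simp add: m_def)
  have less: "f m < (f (norm p) + f (norm q)) / 2" if "norm p \<noteq> norm q"
  proof -
    have "\<forall>x\<in>{0..}. \<forall>y\<in>{0..}. \<forall>t. x \<noteq> y \<and> 0 < t \<and> t < 1 \<longrightarrow> f ((1 - t) * x + t * y) < (1 - t) * f x + t * f y"
      using regular unfolding regular_lagrangean_def strictly_convex_on_def by blast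
    from this[rule_format, of "norm p" "norm q" "1/2"] that
    show ?thesis by (simp add: m_def add_divide_distrib)
  qed
  then have fm: "f m \<le> (f (norm p) + f (norm q)) / 2"
    by (cases "norm p = norm q") (auto simp: m_def)
  then show "f (norm ((1/2) *\<^sub>R (p + q))) \<le> (f (norm p) + f (norm q)) / 2"
    using le_lagrangean[OF m0 le] by linarith
  show "p = q" if eq: "f (norm ((1/2) *\<^sub>R (p + q))) = (f (norm p) + f (norm q)) / 2"
  proof -
    have n: "norm p = norm q"
      using less eq le_lagrangean[OF m0 le] by argo
    have "\<not> norm ((1/2) *\<^sub>R (p + q)) < m"
      using less_lagrangean[OF m0, of m] eq fm by auto
    then have "norm ((1/2) *\<^sub>R (p + q)) = m" using le by linarith
    then have "norm (p + q) = norm p + norm q" by (simp add: m_def)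
    then have "norm p *\<^sub>R q = norm q *\<^sub>R p"
      by (simp add: norm_triangle_eq)
    then show ?thesis using n by (cases "p = 0") auto
  qed
qed

end

lemma continuous_Lip_UNIV: "W \<in> Lip UNIV \<Longrightarrow> continuous_on S W"
  using continuous_Lip continuous_on_subset by blast

lemma Lip_UNIV_imp_Lip: "W \<in> Lip UNIV \<Longrightarrow> W \<in> Lip S"
  unfolding Lip_def using lipschitz_on_subset by fastforce

text \<open>The test functions of all comparison arguments: the positive part of a difference, continued by \<open>0\<close>.\<close>
definition cutoff :: "(real^2) set \<Rightarrow> (real^2 \<Rightarrow> real) \<Rightarrow> real^2 \<Rightarrow> real" where
  "cutoff D g x = (if x \<in> D then max (g x) 0 else 0)"

lemma cutoff_nonneg: "0 \<le> cutoff D g x"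
  by (simp add: cutoff_def)

lemma cutoff_Lip:
  assumes "g \<in> Lip (closure D)" "\<And>x. x \<in> frontier D \<Longrightarrow> g x \<le> 0"
  shows "cutoff D g \<in> Lip UNIV"
proof -
  obtain C where C: "C-lipschitz_on (closure D) (\<lambda>x. max (g x) 0)"
    using Lip_pos_part[OF assms(1)] by (auto simp: Lip_def)
  show ?thesis
    using lipschitz_zero_extension[OF C] assms(2) unfolding cutoff_def[abs_def] Lip_def by fastforce
qed

text \<open>A point where the cutoff vanishes is a minimum, so the gradient is zero there whenever it exists.\<close>
lemma AE_grad_cutoff:
  assumes "cutoff D g \<in> Lip UNIV" "open D" "continuous_on D g"
  shows "AE x in lebesgue. (if 0 < cutoff D g x then x \<in> D \<and> grad (cutoff D g) x = grad g x else grad (cutoff D g) x = 0)"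
  using AE_grad_nonneg_zero[OF assms(1) cutoff_nonneg]
proof eventually_elim
  case (elim x)
  have "open (g -` {0<..} \<inter> D)"
    using assms(2,3) by (simp add: continuous_on_open_vimage)
  moreover have "g -` {0<..} \<inter> D = {x \<in> D. 0 < g x}" by auto
  ultimately have op: "open {x \<in> D. 0 < g x}" by simp
  show ?case
  proof (cases "0 < cutoff D g x")
    case True
    then have x: "x \<in> {x \<in> D. 0 < g x}" by (auto simp: cutoff_def split: if_splits)
    have "grad (cutoff D g) x = grad g x"
      by (rule grad_cong[OF op x]) (auto simp: cutoff_def)
    then show ?thesis using True x by auto
  next
    case False
    then show ?thesis using elim cutoff_nonneg[of D g x] by force
  qed
qed

lemma bounded_outside_ball:
  assumes "bounded D"
  obtains R where "\<And>x. R \<le> norm x \<Longrightarrow> x \<notin> D"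
proof -
  obtain r where "\<And>x. x \<in> D \<Longrightarrow> norm x \<le> r" using assms by (auto simp: bounded_iff)
  then show ?thesis by (intro that[of "r + 1"]) force
qed

text \<open>The minimum problem in terms of competitors on the whole plane: every Lipschitz function on the closure extends, and the
energy depends only on the values in \<open>\<Omega>\<close>.\<close>
definition lip_minimizer :: "(real^2) set \<Rightarrow> (real \<Rightarrow> real) \<Rightarrow> (real^2 \<Rightarrow> real) \<Rightarrow> bool" where
  "lip_minimizer \<Omega> f U \<longleftrightarrow> U \<in> Lip UNIV \<and>
    (\<forall>W\<in>Lip UNIV. (\<forall>x\<in>frontier \<Omega>. W x = U x) \<longrightarrow> energy \<Omega> f U \<le> energy \<Omega> f W)"

locale variational_problem = degenerate_lagrangean +
  fixes \<Omega> :: "(real^2) set"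
  assumes open_\<Omega>: "open \<Omega>" and bounded_\<Omega>: "bounded \<Omega>"
begin

lemma frontier_notin: "x \<in> frontier \<Omega> \<Longrightarrow> x \<notin> \<Omega>"
  using open_\<Omega> by (simp add: frontier_def interior_open)

lemma lagrangean_grad_measurable:
  assumes "W \<in> Lip UNIV"
  shows "(\<lambda>x. f (norm (grad W x))) \<in> borel_measurable lebesgue"
  using measurable_compose[OF grad_measurable[OF assms] borel_measurable_continuous_onI[OF continuous_norm_comp[OF continuous_lagrangean]]] .

lemma energy_integrable:
  assumes W: "W \<in> Lip UNIV"
  shows "integrable lebesgue (\<lambda>x. indicator \<Omega> x * f (norm (grad W x)))"
proof -
  obtain C where C: "C-lipschitz_on UNIV W" using W by (auto simp: Lip_def)
  obtain R where R: "\<And>x. R \<le> norm x \<Longrightarrow> x \<notin> \<Omega>" using bounded_outside_ball[OF bounded_\<Omega>] by blast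
  have C0: "0 \<le> C" using C by (rule lipschitz_on_nonneg)
  show ?thesis
  proof (rule integrable_bounded_support[of _ "\<bar>f 0\<bar> + \<bar>f C\<bar>" R])
    show "(\<lambda>x. indicator \<Omega> x * f (norm (grad W x))) \<in> borel_measurable lebesgue"
      using lagrangean_grad_measurable[OF W] open_\<Omega>
      by (intro borel_measurable_times borel_measurable_indicator) auto
    show "AE x in lebesgue. \<bar>indicator \<Omega> x * f (norm (grad W x))\<bar> \<le> \<bar>f 0\<bar> + \<bar>f C\<bar>"
      using AE_differentiable[OF W]
    proof eventually_elim
      case (elim x)
      have "norm (grad W x) \<le> C" using norm_grad_le[OF C _ _ elim] by auto
      then have "f 0 \<le> f (norm (grad W x))" "f (norm (grad W x)) \<le> f C"
        by (auto intro: le_lagrangean)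
      then show ?case by (auto simp: indicator_def)
    qed
  qed (use R in auto)
qed

lemma energy_eq: "energy \<Omega> f W = (LINT x|lebesgue. indicator \<Omega> x * f (norm (grad W x)))"
  by (simp add: energy_def set_lebesgue_integral_def)

lemma energy_uminus:
  assumes W: "W \<in> Lip UNIV"
  shows "energy \<Omega> f (\<lambda>x. - W x) = energy \<Omega> f W"
  unfolding energy_eq
proof (rule integral_cong_AE)
  show "AE x in lebesgue. indicator \<Omega> x * f (norm (grad (\<lambda>x. - W x) x)) = indicator \<Omega> x * f (norm (grad W x))"
    using AE_differentiable[OF W] by eventually_elim (simp add: grad_minus)
qed (use energy_integrable[OF W] energy_integrable[OF Lip_minus[OF W]] borel_measurable_integrable in blast)+

lemma lip_minimizer_uminus:
  assumes "lip_minimizer \<Omega> f U"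
  shows "lip_minimizer \<Omega> f (\<lambda>x. - U x)"
  unfolding lip_minimizer_def
proof (intro conjI ballI impI)
  have U: "U \<in> Lip UNIV" using assms by (simp add: lip_minimizer_def)
  then show "(\<lambda>x. - U x) \<in> Lip UNIV" by (rule Lip_minus)
  fix W assume W: "W \<in> Lip UNIV" "\<forall>x\<in>frontier \<Omega>. W x = - U x"
  then have "energy \<Omega> f U \<le> energy \<Omega> f (\<lambda>x. - W x)"
    using assms Lip_minus[OF W(1)] by (auto simp: lip_minimizer_def)
  then show "energy \<Omega> f (\<lambda>x. - U x) \<le> energy \<Omega> f W"
    using energy_uminus U W(1) by simp
qed

lemma lip_minimizer_unique_one_sided:
  assumes min: "lip_minimizer \<Omega> f U" and W: "W \<in> Lip UNIV"
    and bd: "\<And>x. x \<in> frontier \<Omega> \<Longrightarrow> W x = U x"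
    and grad: "AE x in lebesgue. x \<in> \<Omega> \<longrightarrow> grad U x = grad W x"
  shows "x \<in> \<Omega> \<Longrightarrow> U x \<le> W x"
proof -
  have U: "U \<in> Lip UNIV" using min by (simp add: lip_minimizer_def)
  let ?g = "\<lambda>x. U x - W x"
  have g: "?g \<in> Lip UNIV" using U W by (rule Lip_diff)
  then have "?g \<in> Lip (closure \<Omega>)"
    by (rule Lip_UNIV_imp_Lip)
  then have z: "cutoff \<Omega> ?g \<in> Lip UNIV"
    using bd by (intro cutoff_Lip) auto
  obtain R where R: "\<And>x. R \<le> norm x \<Longrightarrow> x \<notin> \<Omega>" using bounded_outside_ball[OF bounded_\<Omega>] by blast
  obtain a :: "real^2" where "norm a = \<bar>R\<bar>" using vector_choose_size[of "\<bar>R\<bar>"] by auto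
  then have a: "cutoff \<Omega> ?g a = 0" using R[of a] by (simp add: cutoff_def)
  have "AE x in lebesgue. grad (cutoff \<Omega> ?g) x = 0"
    using AE_grad_cutoff[OF z open_\<Omega> continuous_Lip_UNIV[OF g]] grad AE_differentiable[OF U] AE_differentiable[OF W]
  proof eventually_elim
    case (elim x)
    then show ?case using grad_diff[of U x W] by (auto split: if_splits)
  qed
  then have "cutoff \<Omega> ?g x = 0"
    using Lip_eq_0_of_grad_eq_0[OF z _ a] by blast
  then show "U x \<le> W x" if "x \<in> \<Omega>"
    using that by (simp add: cutoff_def)
qed

text \<open>By strict convexity the mean of two minimizers would have less energy, unless their gradients agree.\<close>
lemma lip_minimizer_unique:
  assumes min: "lip_minimizer \<Omega> f U" and W: "W \<in> Lip UNIV"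
    and bd: "\<And>x. x \<in> frontier \<Omega> \<Longrightarrow> W x = U x" and le: "energy \<Omega> f W \<le> energy \<Omega> f U"
    and x: "x \<in> \<Omega>"
  shows "W x = U x"
proof -
  have U: "U \<in> Lip UNIV" using min by (simp add: lip_minimizer_def)
  define m where "m = (\<lambda>x. (1/2) * (U x + W x))"
  have m: "m \<in> Lip UNIV" unfolding m_def by (intro Lip_cmult Lip_add U W)
  have "energy \<Omega> f U \<le> energy \<Omega> f m"
    using min m bd by (auto simp: lip_minimizer_def m_def)
  let ?e = "\<lambda>W x. indicator \<Omega> x * f (norm (grad W x))"
  define k where "k = (\<lambda>x. (?e U x + ?e W x) / 2 - ?e m x)"
  have kint: "integrable lebesgue k"
    unfolding k_def using energy_integrable[OF U] energy_integrable[OF W] energy_integrable[OF m] by simp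
  have keq: "AE x in lebesgue. k x = indicator \<Omega> x * ((f (norm (grad U x)) + f (norm (grad W x))) / 2 - f (norm ((1/2) *\<^sub>R (grad U x + grad W x))))"
    using AE_differentiable[OF U] AE_differentiable[OF W]
  proof eventually_elim
    case (elim x)
    have "grad m x = (1/2) *\<^sub>R (grad U x + grad W x)"
      unfolding m_def using elim by (subst grad_cmult) (auto simp: grad_add intro: differentiable_add)
    then show ?case by (simp add: k_def indicator_def)
  qed
  have knn: "AE x in lebesgue. 0 \<le> k x"
    using keq by eventually_elim (use lagrangean_midpoint_le in simp)
  have "(LINT x|lebesgue. k x) = (energy \<Omega> f U + energy \<Omega> f W) / 2 - energy \<Omega> f m"
    unfolding k_def energy_eq using energy_integrable[OF U] energy_integrable[OF W] energy_integrable[OF m] by simp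
  then have "(LINT x|lebesgue. k x) \<le> 0"
    using le \<open>energy \<Omega> f U \<le> energy \<Omega> f m\<close> by simp
  then have "(LINT x|lebesgue. k x) = 0"
    using integral_nonneg_AE[OF knn] by linarith
  then have "AE x in lebesgue. k x = 0"
    using integral_nonneg_eq_0_iff_AE[OF kint knn] by simp
  then have grad: "AE x in lebesgue. x \<in> \<Omega> \<longrightarrow> grad U x = grad W x"
    using keq by eventually_elim (use lagrangean_midpoint_eqD in \<open>auto simp: indicator_def\<close>)
  have "U x \<le> W x"
    using lip_minimizer_unique_one_sided[OF min W bd grad x] by simp
  moreover have "- U x \<le> - W x"
  proof (rule lip_minimizer_unique_one_sided[OF lip_minimizer_uminus[OF min] Lip_minus[OF W] _ _ x])
    show "AE x in lebesgue. x \<in> \<Omega> \<longrightarrow> grad (\<lambda>x. - U x) x = grad (\<lambda>x. - W x) x"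
      using grad AE_differentiable[OF U] AE_differentiable[OF W] by eventually_elim (simp add: grad_minus)
  qed (use bd in simp)
  ultimately show ?thesis by simp
qed

text \<open>Replacing \<open>U\<close> by the smaller of \<open>U\<close> and the affine function does not increase the energy: by convexity the change is at least
the integral of \<open>stress a \<bullet> \<nabla>z\<close>, where \<open>z\<close> is the excess of \<open>U\<close> over the affine function, and this integral is \<open>0\<close>.\<close>
lemma lip_minimizer_le_affine:
  assumes min: "lip_minimizer \<Omega> f U" and bd: "\<And>x. x \<in> frontier \<Omega> \<Longrightarrow> U x \<le> a \<bullet> x + b" and x: "x \<in> \<Omega>"
  shows "U x \<le> a \<bullet> x + b"
proof -
  have U: "U \<in> Lip UNIV" using min by (simp add: lip_minimizer_def)
  have L: "(\<lambda>x. a \<bullet> x + b) \<in> Lip UNIV" by (intro Lip_add Lip_inner Lip_const)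
  let ?g = "\<lambda>x. U x - (a \<bullet> x + b)"
  define z where "z = cutoff \<Omega> ?g"
  have g: "?g \<in> Lip UNIV" using U L by (rule Lip_diff)
  then have "?g \<in> Lip (closure \<Omega>)"
    by (rule Lip_UNIV_imp_Lip)
  then have z: "z \<in> Lip UNIV"
    unfolding z_def using bd by (intro cutoff_Lip) auto
  obtain R where R: "\<And>x. R \<le> norm x \<Longrightarrow> x \<notin> \<Omega>" using bounded_outside_ball[OF bounded_\<Omega>] by blast
  have zsupp: "z x = 0" if "R \<le> norm x" for x
    using R[OF that] by (simp add: z_def cutoff_def)
  define W where "W = (\<lambda>x. U x - z x)"
  have W: "W \<in> Lip UNIV" unfolding W_def by (intro Lip_diff U z)
  have Wbd: "W x = U x" if "x \<in> frontier \<Omega>" for x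
    using frontier_notin[OF that] by (simp add: W_def z_def cutoff_def)
  let ?e = "\<lambda>W x. indicator \<Omega> x * f (norm (grad W x))"
  have "(LINT x|lebesgue. grad z x \<bullet> stress a) \<le> (LINT x|lebesgue. ?e U x - ?e W x)"
  proof (rule integral_mono_AE)
    show "integrable lebesgue (\<lambda>x. grad z x \<bullet> stress a)"
      using integrable_grad_mult(1)[OF Lip_const[of 1 UNIV] z zsupp, where e = "stress a"] by simp
    show "integrable lebesgue (\<lambda>x. ?e U x - ?e W x)"
      using energy_integrable[OF U] energy_integrable[OF W] by simp
    show "AE x in lebesgue. grad z x \<bullet> stress a \<le> ?e U x - ?e W x"
      using AE_grad_cutoff[OF z[unfolded z_def] open_\<Omega> continuous_Lip_UNIV[OF g]]
        AE_differentiable[OF U] AE_differentiable[OF L] AE_differentiable[OF z]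
    proof eventually_elim
      case (elim x)
      have gW: "grad W x = grad U x - grad z x"
        unfolding W_def using elim by (intro grad_diff)
      show ?case
      proof (cases "0 < z x")
        case True
        then have x: "x \<in> \<Omega>" and gz: "grad z x = grad U x - a"
          using elim(1) grad_diff[OF elim(2,3)] by (auto simp: z_def grad_affine)
        show ?thesis
          using x lagrangean_tangent[of a "grad U x"] gW gz by (simp add: inner_commute)
      next
        case False
        then have "grad z x = 0" using elim(1) by (simp add: z_def)
        then show ?thesis using gW by simp
      qed
    qed
  qed
  also have "(LINT x|lebesgue. grad z x \<bullet> stress a) = 0"
    by (rule integral_grad_eq_0[OF z zsupp])
  also have "(LINT x|lebesgue. ?e U x - ?e W x) = energy \<Omega> f U - energy \<Omega> f W"
    unfolding energy_eq using energy_integrable[OF U] energy_integrable[OF W] by simp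
  finally have "energy \<Omega> f W \<le> energy \<Omega> f U" by simp
  then have "W x = U x" by (intro lip_minimizer_unique[OF min W Wbd _ x])
  then show ?thesis using x by (simp add: W_def z_def cutoff_def)
qed

lemma lip_minimizer_ge_affine:
  assumes min: "lip_minimizer \<Omega> f U" and bd: "\<And>x. x \<in> frontier \<Omega> \<Longrightarrow> a \<bullet> x + b \<le> U x" and x: "x \<in> \<Omega>"
  shows "a \<bullet> x + b \<le> U x"
  using lip_minimizer_le_affine[OF lip_minimizer_uminus[OF min], of "- a" "- b" x] bd x by (force simp: algebra_simps)

text \<open>Let \<open>z\<close> be the positive part of \<open>U x - U (x + \<tau>) - Q \<bar>\<tau>\<bar>\<close>, which vanishes when \<open>x\<close> or \<open>x + \<tau>\<close> is on the boundary. Then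
\<open>U - z\<close> and \<open>U + z (\<cdot> - \<tau>)\<close> are competitors that exchange the values of \<open>U\<close> and of its translate on the set \<open>z > 0\<close>, so the
sum of their energies is twice the energy of \<open>U\<close>. Hence both are minimizers, and \<open>z = 0\<close> by uniqueness.\<close>
lemma lip_minimizer_lipschitz:
  assumes min: "lip_minimizer \<Omega> f U"
    and Q: "\<And>x y. x \<in> closure \<Omega> \<Longrightarrow> y \<in> frontier \<Omega> \<Longrightarrow> \<bar>U x - U y\<bar> \<le> Q * norm (x - y)" and "0 \<le> Q"
  shows "Q-lipschitz_on \<Omega> U"
proof -
  have U: "U \<in> Lip UNIV" using min by (simp add: lip_minimizer_def)
  obtain C where C: "C-lipschitz_on UNIV U" using U by (auto simp: Lip_def)
  have main: "U x0 - U y0 \<le> Q * norm (y0 - x0)" if x0: "x0 \<in> \<Omega>" and y0: "y0 \<in> \<Omega>" for x0 y0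
  proof -
    define \<tau> where "\<tau> = y0 - x0"
    have U\<tau>: "(\<lambda>x. U (x + \<tau>)) \<in> Lip UNIV" using lipschitz_translate[OF C] by (auto simp: Lip_def)
    define \<Omega>' where "\<Omega>' = \<Omega> \<inter> (\<lambda>x. x + \<tau>) -` \<Omega>"
    have op: "open \<Omega>'"
      unfolding \<Omega>'_def using open_\<Omega> by (intro open_Int open_vimage continuous_intros)
    let ?g = "\<lambda>x. (U x - U (x + \<tau>)) - Q * norm \<tau>"
    have g: "?g \<in> Lip UNIV" by (intro Lip_diff U U\<tau> Lip_const)
    define z where "z = cutoff \<Omega>' ?g"
    have gfr: "?g x \<le> 0" if x: "x \<in> frontier \<Omega>'" for x
    proof -
      have notin: "x \<notin> \<Omega>'" using x op by (simp add: frontier_def interior_open)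
      have "x \<in> closure \<Omega>'" using x by (simp add: frontier_def)
      moreover have "\<Omega>' \<subseteq> closure \<Omega> \<inter> (\<lambda>x. x + \<tau>) -` closure \<Omega>"
        unfolding \<Omega>'_def using closure_subset by blast
      moreover have "closed (closure \<Omega> \<inter> (\<lambda>x. x + \<tau>) -` closure \<Omega>)"
        by (intro closed_Int closed_vimage continuous_intros closed_closure)
      ultimately have cl: "x \<in> closure \<Omega>" "x + \<tau> \<in> closure \<Omega>"
        using closure_minimal by blast+
      have "x \<in> frontier \<Omega> \<or> x + \<tau> \<in> frontier \<Omega>"
        using notin cl open_\<Omega> by (auto simp: \<Omega>'_def frontier_def interior_open)
      then have "\<bar>U x - U (x + \<tau>)\<bar> \<le> Q * norm \<tau>"
        using Q[OF cl(1), of "x + \<tau>"] Q[OF cl(2), of x] by (auto simp: abs_minus_commute)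
      then show ?thesis by simp
    qed
    have "?g \<in> Lip (closure \<Omega>')"
      using g by (rule Lip_UNIV_imp_Lip)
    then have z: "z \<in> Lip UNIV" unfolding z_def using gfr by (rule cutoff_Lip)
    then have z\<tau>: "(\<lambda>x. z (x + - \<tau>)) \<in> Lip UNIV"
      using lipschitz_translate[of _ z "- \<tau>"] unfolding Lip_def by blast
    define W1 where "W1 = (\<lambda>x. U x - z x)"
    define W2 where "W2 = (\<lambda>x. U x + z (x + - \<tau>))"
    have W1: "W1 \<in> Lip UNIV" unfolding W1_def by (intro Lip_diff U z)
    have W2: "W2 \<in> Lip UNIV" unfolding W2_def by (intro Lip_add U z\<tau>)
    have W1bd: "W1 x = U x" if "x \<in> frontier \<Omega>" for x
      using frontier_notin[OF that] by (simp add: W1_def z_def cutoff_def \<Omega>'_def)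
    have W2bd: "W2 x = U x" if "x \<in> frontier \<Omega>" for x
      using frontier_notin[OF that] by (simp add: W2_def z_def cutoff_def \<Omega>'_def)
    let ?e = "\<lambda>W x. indicator \<Omega> x * f (norm (grad W x))"
    define k where "k x = ?e W1 x - ?e U x" for x
    have k: "integrable lebesgue k"
      unfolding k_def using energy_integrable[OF U] energy_integrable[OF W1] by simp
    have gz: "AE x in lebesgue. if 0 < z x then x \<in> \<Omega>' \<and> grad z x = grad U x - grad U (x + \<tau>) else grad z x = 0"
      using AE_grad_cutoff[OF z[unfolded z_def] op continuous_Lip_UNIV[OF g]]
        AE_differentiable[OF U] AE_lebesgue_translate[OF AE_differentiable[OF U], of \<tau>]
    proof eventually_elim
      case (elim x)
      have "grad ?g x = grad (\<lambda>x. U x - U (x + \<tau>)) x - grad (\<lambda>x. Q * norm \<tau>) x"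
        using elim grad_translate(2)[of U x \<tau>] by (intro grad_diff differentiable_diff) auto
      also have "grad (\<lambda>x. Q * norm \<tau>) x = 0"
        by (rule grad_eqI) simp
      also have "grad (\<lambda>x. U x - U (x + \<tau>)) x = grad U x - grad U (x + \<tau>)"
        using elim grad_translate[of U x \<tau>] by (simp add: grad_diff)
      finally show ?case using elim(1) by (auto simp: z_def)
    qed
    have kval: "AE x in lebesgue. k x = (if 0 < z x then f (norm (grad U (x + \<tau>))) - f (norm (grad U x)) else 0)"
      using gz AE_differentiable[OF U] AE_differentiable[OF z]
    proof eventually_elim
      case (elim x)
      have "grad W1 x = grad U x - grad z x" unfolding W1_def using elim by (intro grad_diff)
      then show ?case using elim(1) by (auto simp: k_def \<Omega>'_def split: if_splits)
    qed
    \<comment> \<open>the gain of one competitor is the translated loss of the other\<close>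
    have kval2: "AE x in lebesgue. ?e W2 x - ?e U x = - k (x + - \<tau>)"
      using AE_lebesgue_translate[OF gz, of "- \<tau>"] AE_lebesgue_translate[OF kval, of "- \<tau>"]
        AE_differentiable[OF U] AE_lebesgue_translate[OF AE_differentiable[OF z], of "- \<tau>"]
    proof eventually_elim
      case (elim x)
      have "grad W2 x = grad U x + grad z (x + - \<tau>)"
        unfolding W2_def using elim grad_translate[of z x "- \<tau>"] by (simp add: grad_add)
      then show ?case using elim(1,2) by (auto simp: \<Omega>'_def split: if_splits)
    qed
    have kt: "integrable lebesgue (\<lambda>x. k (x + - \<tau>))" using k by (rule integrable_lebesgue_translate)
    have E1: "energy \<Omega> f W1 - energy \<Omega> f U = (LINT x|lebesgue. k x)"
      unfolding energy_eq k_def using energy_integrable[OF U] energy_integrable[OF W1] by simp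
    have "energy \<Omega> f W2 - energy \<Omega> f U = (LINT x|lebesgue. ?e W2 x - ?e U x)"
      unfolding energy_eq using energy_integrable[OF U] energy_integrable[OF W2] by simp
    also have "\<dots> = (LINT x|lebesgue. - k (x + - \<tau>))"
      using kval2 kt energy_integrable[OF U] energy_integrable[OF W2]
      by (intro integral_cong_AE) (auto dest: borel_measurable_integrable)
    also have "\<dots> = - (LINT x|lebesgue. k x)"
      using lebesgue_integral_translate[OF borel_measurable_integrable[OF k], of "- \<tau>"] by simp
    finally have E2: "energy \<Omega> f W2 - energy \<Omega> f U = - (LINT x|lebesgue. k x)" .
    have "energy \<Omega> f U \<le> energy \<Omega> f W2"
      using min W2 W2bd by (auto simp: lip_minimizer_def)
    then have "energy \<Omega> f W1 \<le> energy \<Omega> f U" using E1 E2 by simp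
    then have "W1 x0 = U x0" by (intro lip_minimizer_unique[OF min W1 W1bd _ x0])
    then have "cutoff \<Omega>' ?g x0 = 0" by (simp add: W1_def z_def)
    moreover have "x0 \<in> \<Omega>'" using x0 y0 by (simp add: \<Omega>'_def \<tau>_def)
    ultimately have "?g x0 \<le> 0" by (simp add: cutoff_def)
    then show ?thesis by (simp add: \<tau>_def)
  qed
  show ?thesis
  proof (rule lipschitz_onI)
    fix x y assume "x \<in> \<Omega>" "y \<in> \<Omega>"
    then show "dist (U x) (U y) \<le> Q * dist x y"
      using main[of x y] main[of y x] by (auto simp: dist_real_def dist_norm norm_minus_commute)
  qed fact
qed

end

lemma is_minimizer_extend:
  assumes "open \<Omega>" and min: "is_minimizer \<Omega> \<psi> f u"
  obtains U where "lip_minimizer \<Omega> f U" "\<And>x. x \<in> closure \<Omega> \<Longrightarrow> U x = u x"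
    "\<And>x. x \<in> frontier \<Omega> \<Longrightarrow> U x = \<psi> x"
proof -
  obtain C where C: "C-lipschitz_on (closure \<Omega>) u"
    using min by (auto simp: is_minimizer_def Lip_def)
  then obtain U where U: "C-lipschitz_on UNIV U" "\<And>x. x \<in> closure \<Omega> \<Longrightarrow> U x = u x"
    using McShane_extension by metis
  have Ubd: "U x = \<psi> x" if "x \<in> frontier \<Omega>" for x
    using that U(2) min by (auto simp: is_minimizer_def frontier_def)
  have "grad U x = grad u x" if "x \<in> \<Omega>" for x
    using grad_cong[OF assms(1) that] U(2) closure_subset by blast
  then have EU: "energy \<Omega> f U = energy \<Omega> f u"
    unfolding energy_def by (intro set_lebesgue_integral_cong) (use assms(1) in auto)
  have "lip_minimizer \<Omega> f U"
    unfolding lip_minimizer_def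
  proof (intro conjI ballI impI)
    show "U \<in> Lip UNIV" using U(1) by (auto simp: Lip_def)
    fix W assume W: "W \<in> Lip UNIV" "\<forall>x\<in>frontier \<Omega>. W x = U x"
    then have "W \<in> Lip (closure \<Omega>)" by (simp add: Lip_UNIV_imp_Lip)
    then show "energy \<Omega> f U \<le> energy \<Omega> f W"
      using min W(2) Ubd unfolding EU is_minimizer_def by auto
  qed
  then show ?thesis using that U(2) Ubd by blast
qed

section \<open>Comparison of the conjugate function with strict supersolutions\<close>

lemma inner_real2: "p \<bullet> q = p $ 1 * q $ 1 + p $ 2 * q $ 2" for p q :: "real^2"
  by (simp add: inner_vec_def sum_2)

definition rot :: "real^2 \<Rightarrow> real^2" where
  "rot p = (\<chi> i. if i = 1 then - (p $ 2) else p $ 1)"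

lemma rot_nth [simp]: "rot p $ 1 = - (p $ 2)" "rot p $ 2 = p $ 1"
  by (simp_all add: rot_def)

lemma rot_inner: "rot p \<bullet> rot q = p \<bullet> q"
  by (simp add: inner_real2)

lemma norm_rot: "norm (rot p) = norm p"
  by (simp add: norm_eq_sqrt_inner rot_inner)

lemma rot_scaleR: "rot (c *\<^sub>R p) = c *\<^sub>R rot p"
  by (simp add: vec_eq_iff forall_2)

lemma rot_eq_0: "rot p = 0 \<longleftrightarrow> p = 0"
  by (metis norm_eq_zero norm_rot)

context degenerate_lagrangean
begin

lemma stress_rot: "stress (rot p) = rot (stress p)"
  by (simp add: stress_def rot_eq_0 norm_rot rot_scaleR)

lemma stress_measurable: "stress \<in> borel_measurable borel"
proof -
  have [measurable]: "(\<lambda>p::real^2. hderiv f (norm p)) \<in> borel_measurable borel"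
    by (intro borel_measurable_continuous_onI continuous_norm_comp continuous_hderiv)
  show ?thesis unfolding stress_def[abs_def] by measurable
qed

text \<open>The second derivative of \<open>f\<close> may have zeros, where the inverse of \<open>f'\<close> is not differentiable. Adding \<open>\<epsilon> * \<rho>\<close> makes the
slope at least \<open>\<epsilon>\<close>.\<close>
definition reg_hderiv :: "real \<Rightarrow> real \<Rightarrow> real" where
  "reg_hderiv \<epsilon> \<rho> = hderiv f \<rho> + \<epsilon> * \<rho>"

lemma reg_hderiv_less: "0 \<le> \<epsilon> \<Longrightarrow> 0 \<le> x \<Longrightarrow> x < y \<Longrightarrow> reg_hderiv \<epsilon> x < reg_hderiv \<epsilon> y"
  using regular_hderiv_less[OF regular, of x y] by (simp add: reg_hderiv_def add_less_le_mono mult_left_mono)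

lemma reg_hderiv_inj: "0 \<le> \<epsilon> \<Longrightarrow> 0 \<le> x \<Longrightarrow> 0 \<le> y \<Longrightarrow> reg_hderiv \<epsilon> x = reg_hderiv \<epsilon> y \<longleftrightarrow> x = y"
  using reg_hderiv_less[of \<epsilon> x y] reg_hderiv_less[of \<epsilon> y x] by (metis less_irrefl linorder_neqE_linordered_idom)

lemma continuous_reg_hderiv: "continuous_on {0..} (reg_hderiv \<epsilon>)"
  unfolding reg_hderiv_def[abs_def] by (intro continuous_intros continuous_hderiv)

lemma reg_hderiv_inverse:
  assumes "0 < \<epsilon>" "0 < \<rho>1" "\<rho>1 < \<rho>2"
  obtains h where "\<And>s. reg_hderiv \<epsilon> \<rho>1 \<le> s \<Longrightarrow> s \<le> reg_hderiv \<epsilon> \<rho>2 \<Longrightarrow> \<rho>1 \<le> h s \<and> h s \<le> \<rho>2 \<and> reg_hderiv \<epsilon> (h s) = s"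
    "\<And>s. reg_hderiv \<epsilon> \<rho>1 < s \<Longrightarrow> s < reg_hderiv \<epsilon> \<rho>2 \<Longrightarrow>
      (h has_real_derivative inverse (hderiv2 f (h s) + \<epsilon>)) (at s)"
proof -
  let ?g = "reg_hderiv \<epsilon>"
  define h where "h = the_inv_into {\<rho>1..\<rho>2} ?g"
  have inj: "inj_on ?g {\<rho>1..\<rho>2}"
    using assms by (intro inj_onI) (auto simp: reg_hderiv_inj)
  have cont: "continuous_on {\<rho>1..\<rho>2} ?g"
    using continuous_on_subset[OF continuous_reg_hderiv] assms by auto
  have img: "{?g \<rho>1..?g \<rho>2} \<subseteq> ?g ` {\<rho>1..\<rho>2}"
    using IVT'[of ?g \<rho>1 _ \<rho>2] cont assms by force
  have hg: "h (?g \<rho>) = \<rho>" if "\<rho> \<in> {\<rho>1..\<rho>2}" for \<rho>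
    unfolding h_def using inj that by (rule the_inv_into_f_f)
  have 1: "\<rho>1 \<le> h s \<and> h s \<le> \<rho>2 \<and> ?g (h s) = s" if "?g \<rho>1 \<le> s" "s \<le> ?g \<rho>2" for s
    using img that hg by force
  have hcont: "continuous_on {?g \<rho>1..?g \<rho>2} h"
    using continuous_on_inv[OF cont compact_Icc] hg img continuous_on_subset by blast
  have 2: "(h has_real_derivative inverse (hderiv2 f (h s) + \<epsilon>)) (at s)"
    if s: "?g \<rho>1 < s" "s < ?g \<rho>2" for s
  proof (rule DERIV_inverse_function[of ?g _ h s "?g \<rho>1" "?g \<rho>2"])
    have hs: "0 < h s" using 1[of s] s assms by auto
    show "(?g has_real_derivative hderiv2 f (h s) + \<epsilon>) (at (h s))"
      unfolding reg_hderiv_def[abs_def]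
      by (auto intro!: derivative_eq_intros regular_hderiv2[OF regular hs])
    show "hderiv2 f (h s) + \<epsilon> \<noteq> 0"
      using regular_hderiv2_nonneg[OF regular hs] assms by simp
    show "isCont h s"
      using hcont s by (intro continuous_on_interior[of "{?g \<rho>1..?g \<rho>2}"]) auto
  qed (use 1 s in auto)
  show ?thesis using that[of h] 1 2 by blast
qed

text \<open>The logarithmic slope \<open>\<rho> g'(\<rho>) / g(\<rho>)\<close> of \<open>g = reg_hderiv \<epsilon>\<close>.\<close>
definition reg_slope :: "real \<Rightarrow> real \<Rightarrow> real" where
  "reg_slope \<epsilon> \<rho> = \<rho> * (hderiv2 f \<rho> + \<epsilon>) / reg_hderiv \<epsilon> \<rho>"

lemma reg_hderiv_pos: "0 < \<epsilon> \<Longrightarrow> 0 < \<rho> \<Longrightarrow> 0 < reg_hderiv \<epsilon> \<rho>"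
  using hderiv_pos[of \<rho>] by (simp add: reg_hderiv_def add_pos_pos)

lemma reg_slope_pos: "0 < \<epsilon> \<Longrightarrow> 0 < \<rho> \<Longrightarrow> 0 < reg_slope \<epsilon> \<rho>"
  using regular_hderiv2_nonneg[OF regular, of \<rho>] reg_hderiv_pos[of \<epsilon> \<rho>]
  by (simp add: reg_slope_def add_nonneg_pos)

lemma reg_slope_diff:
  assumes "0 < \<epsilon>" "0 < \<rho>"
  shows "\<bar>reg_slope \<epsilon> \<rho> - log_slope f \<rho>\<bar> \<le> \<epsilon> * (\<rho> * (1 + \<bar>log_slope f \<rho>\<bar>) / hderiv f \<rho>)"
proof -
  let ?d = "hderiv f \<rho>" and ?b = "log_slope f \<rho>"
  have d: "0 < ?d" using hderiv_pos assms by simp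
  have r: "0 < reg_hderiv \<epsilon> \<rho>" using reg_hderiv_pos assms by simp
  have "hderiv2 f \<rho> = ?b * ?d / \<rho>"
    using d assms by (simp add: log_slope_def)
  then have "reg_slope \<epsilon> \<rho> - ?b = \<epsilon> * \<rho> * (1 - ?b) / reg_hderiv \<epsilon> \<rho>"
    using r assms by (simp add: reg_slope_def field_simps) (simp add: reg_hderiv_def algebra_simps)
  then have "\<bar>reg_slope \<epsilon> \<rho> - ?b\<bar> = \<epsilon> * \<rho> * \<bar>1 - ?b\<bar> / reg_hderiv \<epsilon> \<rho>"
    using r assms by (simp add: abs_mult)
  also have "\<dots> \<le> \<epsilon> * \<rho> * (1 + \<bar>?b\<bar>) / ?d"
    using d r assms by (intro frac_le mult_left_mono) (auto simp: reg_hderiv_def)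
  finally show ?thesis by (simp add: mult.assoc)
qed

text \<open>The field is the inverse of \<open>p \<mapsto> stress p + \<epsilon> *\<^sub>R p\<close>, applied to the gradient \<open>P\<close> of a test function with Hessian \<open>H\<close>. With
\<open>s = \<bar>P x\<bar>\<close>, \<open>\<rho> = \<bar>Z x\<bar>\<close> and \<open>a = reg_slope \<epsilon> \<rho>\<close>, its divergence is \<open>- \<rho> / (s\<^sup>3 a)\<close> times the operator with
coefficient \<open>a\<close>; this bounds it away from \<open>0\<close> by a quantity in which \<open>\<epsilon>\<close> does not occur.\<close>
lemma strict_supersolution_field:
  fixes P :: "real^2 \<Rightarrow> real^2" and H :: "real^2 \<Rightarrow> real^2^2"
  assumes \<epsilon>: "0 < \<epsilon>" and \<rho>: "0 < \<rho>1" "\<rho>1 < \<rho>2" and "0 \<le> K"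
    and P: "\<And>x. x \<in> cball x0 r \<Longrightarrow> (P has_derivative (\<lambda>v. H x *v v)) (at x)"
    and HK: "\<And>x. x \<in> cball x0 r \<Longrightarrow> onorm (\<lambda>v. H x *v v) \<le> K"
    and range: "\<And>x. x \<in> cball x0 r \<Longrightarrow> reg_hderiv \<epsilon> \<rho>1 < norm (P x) \<and> norm (P x) \<le> hderiv f \<rho>2"
    and slope: "\<And>\<rho>. \<rho>1 \<le> \<rho> \<Longrightarrow> \<rho> \<le> \<rho>2 \<Longrightarrow> \<bar>reg_slope \<epsilon> \<rho> - b0\<bar> \<le> \<delta>"
    and strict: "\<And>x b. x \<in> cball x0 r \<Longrightarrow> \<bar>b - b0\<bar> \<le> \<delta> \<Longrightarrow> c \<le> limit_operator (\<lambda>_. b) (P x) (H x)" and "0 < c"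
  shows "\<exists>Z. (\<forall>i. (\<lambda>x. Z x $ i) \<in> Lip UNIV)
    \<and> (\<forall>x\<in>cball x0 r. stress (Z x) + \<epsilon> *\<^sub>R Z x = P x \<and> norm (Z x) \<le> \<rho>2)
    \<and> (\<forall>x\<in>ball x0 r. (\<Sum>i\<in>UNIV. grad (\<lambda>x. Z x $ i) x $ i) \<le> - (\<rho>1 * c / (hderiv f \<rho>2 ^ 3 * (b0 + \<delta>))))"
proof -
  let ?g = "reg_hderiv \<epsilon>"
  obtain h where h: "\<And>s. ?g \<rho>1 \<le> s \<Longrightarrow> s \<le> ?g \<rho>2 \<Longrightarrow> \<rho>1 \<le> h s \<and> h s \<le> \<rho>2 \<and> ?g (h s) = s"
    and dh: "\<And>s. ?g \<rho>1 < s \<Longrightarrow> s < ?g \<rho>2 \<Longrightarrow> (h has_real_derivative inverse (hderiv2 f (h s) + \<epsilon>)) (at s)"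
    using reg_hderiv_inverse[OF \<epsilon> \<rho>] by blast
  have g1: "0 < ?g \<rho>1" using reg_hderiv_pos \<epsilon> \<rho> by simp
  have in_range: "?g \<rho>1 < norm (P x)" "norm (P x) < ?g \<rho>2" "0 < norm (P x)" if "x \<in> cball x0 r" for x
    using range[OF that] g1 \<epsilon> \<rho> by (auto simp: reg_hderiv_def[of _ \<rho>2] intro: less_le_trans le_less_trans)
  define \<zeta> where "\<zeta> x = (h (norm (P x)) / norm (P x)) *\<^sub>R P x" for x
  have hP: "\<rho>1 \<le> h (norm (P x)) \<and> h (norm (P x)) \<le> \<rho>2 \<and> ?g (h (norm (P x))) = norm (P x)"
    if "x \<in> cball x0 r" for x
    using h[of "norm (P x)"] in_range[OF that] by simp
  have n\<zeta>: "norm (\<zeta> x) = h (norm (P x))" if "x \<in> cball x0 r" for x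
    using in_range[OF that] hP[OF that] \<rho> by (simp add: \<zeta>_def)
  have A\<zeta>: "stress (\<zeta> x) + \<epsilon> *\<^sub>R \<zeta> x = P x" if x: "x \<in> cball x0 r" for x
  proof -
    let ?h = "h (norm (P x))"
    have h0: "0 < ?h" using hP[OF x] \<rho> by simp
    then have "\<zeta> x \<noteq> 0" using n\<zeta>[OF x] by auto
    then have "stress (\<zeta> x) + \<epsilon> *\<^sub>R \<zeta> x = (hderiv f ?h / ?h + \<epsilon>) *\<^sub>R \<zeta> x"
      by (simp add: stress_def n\<zeta>[OF x] scaleR_add_left)
    also have "hderiv f ?h / ?h + \<epsilon> = norm (P x) / ?h"
      using hP[OF x] h0 by (simp add: reg_hderiv_def field_simps)
    also have "(norm (P x) / ?h) *\<^sub>R \<zeta> x = P x"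
      using h0 in_range[OF x] by (simp add: \<zeta>_def)
    finally show ?thesis .
  qed
  have PK: "norm (P x - P y) \<le> K * norm (x - y)" if "x \<in> cball x0 r" "y \<in> cball x0 r" for x y
    using P HK that by (intro differentiable_bound[of "cball x0 r" P "\<lambda>x v. H x *v v"])
      (auto intro: has_derivative_at_withinI)
  have \<zeta>lip: "norm (\<zeta> x - \<zeta> y) \<le> K / \<epsilon> * norm (x - y)" if xy: "x \<in> cball x0 r" "y \<in> cball x0 r" for x y
  proof -
    have "P x - P y = (stress (\<zeta> x) - stress (\<zeta> y)) + \<epsilon> *\<^sub>R (\<zeta> x - \<zeta> y)"
      using A\<zeta>[OF xy(1)] A\<zeta>[OF xy(2)] by (simp add: scaleR_diff_right algebra_simps)
    then have "(P x - P y) \<bullet> (\<zeta> x - \<zeta> y) \<ge> \<epsilon> * (norm (\<zeta> x - \<zeta> y))\<^sup>2"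
      using stress_monotone[of "\<zeta> x" "\<zeta> y"] by (simp add: inner_add_left power2_norm_eq_inner)
    moreover have "(P x - P y) \<bullet> (\<zeta> x - \<zeta> y) \<le> norm (P x - P y) * norm (\<zeta> x - \<zeta> y)"
      by (rule norm_cauchy_schwarz)
    ultimately have "\<epsilon> * norm (\<zeta> x - \<zeta> y) * norm (\<zeta> x - \<zeta> y) \<le> norm (P x - P y) * norm (\<zeta> x - \<zeta> y)"
      by (simp add: power2_eq_square mult.assoc)
    then have "\<epsilon> * norm (\<zeta> x - \<zeta> y) \<le> norm (P x - P y)"
      by (cases "\<zeta> x = \<zeta> y") auto
    also have "\<dots> \<le> K * norm (x - y)" using PK xy by blast
    finally show ?thesis using \<epsilon> by (simp add: field_simps)
  qed
  have "\<exists>W. W \<in> Lip UNIV \<and> (\<forall>x\<in>cball x0 r. W x = \<zeta> x $ i)" for i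
  proof -
    have "(K / \<epsilon>)-lipschitz_on (cball x0 r) (\<lambda>x. \<zeta> x $ i)"
    proof (rule lipschitz_onI)
      fix x y assume xy: "x \<in> cball x0 r" "y \<in> cball x0 r"
      have "\<bar>\<zeta> x $ i - \<zeta> y $ i\<bar> \<le> norm (\<zeta> x - \<zeta> y)"
        by (metis component_le_norm_cart vector_minus_component)
      then show "dist (\<zeta> x $ i) (\<zeta> y $ i) \<le> K / \<epsilon> * dist x y"
        using \<zeta>lip[OF xy] by (simp add: dist_norm)
    qed (use \<epsilon> \<open>0 \<le> K\<close> in simp)
    then obtain W where "(K / \<epsilon>)-lipschitz_on UNIV W" "\<And>x. x \<in> cball x0 r \<Longrightarrow> W x = \<zeta> x $ i"
      using McShane_extension by blast
    then show ?thesis by (auto simp: Lip_def)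
  qed
  then obtain W where W: "\<And>i. W i \<in> Lip UNIV" "\<And>i x. x \<in> cball x0 r \<Longrightarrow> W i x = \<zeta> x $ i"
    by metis
  define Z where "Z x = (\<chi> i. W i x)" for x
  have Z\<zeta>: "Z x = \<zeta> x" if "x \<in> cball x0 r" for x
    using W(2)[OF that] by (simp add: Z_def vec_eq_iff)
  have div: "(\<Sum>i\<in>UNIV. grad (\<lambda>x. Z x $ i) x $ i) \<le> - (\<rho>1 * c / (hderiv f \<rho>2 ^ 3 * (b0 + \<delta>)))"
    if x: "x \<in> ball x0 r" for x
  proof -
    have xc: "x \<in> cball x0 r" using x by simp
    define s where "s = norm (P x)"
    define \<rho> where "\<rho> = h s"
    define k where "k = inverse (hderiv2 f \<rho> + \<epsilon>)"
    have s0: "0 < s" and P0: "P x \<noteq> 0" using in_range[OF xc] by (auto simp: s_def)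
    have \<rho>b: "\<rho>1 \<le> \<rho>" "\<rho> \<le> \<rho>2" "?g \<rho> = s" and \<rho>0: "0 < \<rho>"
      using hP[OF xc] \<rho> by (auto simp: \<rho>_def s_def)
    have dnorm: "((\<lambda>x. norm (P x)) has_derivative (\<lambda>v. (P x \<bullet> (H x *v v)) / s)) (at x)"
    proof -
      have "(norm has_derivative (\<lambda>v. P x \<bullet> v / s)) (at (P x))"
        using has_derivative_norm[OF P0] by (simp add: s_def sgn_div_norm inner_commute divide_inverse mult.commute)
      from has_derivative_compose[OF P[OF xc] this] show ?thesis .
    qed
    have dhn: "((\<lambda>x. h (norm (P x))) has_derivative (\<lambda>v. k * ((P x \<bullet> (H x *v v)) / s))) (at x)"
      using has_derivative_compose[OF dnorm dh[unfolded has_field_derivative_def]] in_range[OF xc]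
      by (simp add: s_def \<rho>_def k_def)
    have dq: "((\<lambda>x. h (norm (P x)) / norm (P x)) has_derivative
        (\<lambda>v. (k / s\<^sup>2 - \<rho> / s ^ 3) * (P x \<bullet> (H x *v v)))) (at x)"
      using has_derivative_divide[OF dhn dnorm] s0
      by (simp add: s_def[symmetric] \<rho>_def[symmetric] field_simps power2_eq_square power3_eq_cube)
    have d\<zeta>: "(\<zeta> has_derivative (\<lambda>v. (\<rho> / s) *\<^sub>R (H x *v v) + ((k / s\<^sup>2 - \<rho> / s ^ 3) * (P x \<bullet> (H x *v v))) *\<^sub>R P x)) (at x)"
      unfolding \<zeta>_def[abs_def] using has_derivative_scaleR[OF dq P[OF xc]]
      by (simp add: s_def[symmetric] \<rho>_def[symmetric])
    have gi: "grad (\<lambda>x. Z x $ i) x $ i = (\<rho> / s) * H x $ i $ i + (k / s\<^sup>2 - \<rho> / s ^ 3) * (P x \<bullet> (H x *v axis i 1)) * P x $ i" for i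
    proof -
      let ?D = "\<lambda>v. ((\<rho> / s) *\<^sub>R (H x *v v) + ((k / s\<^sup>2 - \<rho> / s ^ 3) * (P x \<bullet> (H x *v v))) *\<^sub>R P x) $ i"
      have "((\<lambda>x. \<zeta> x $ i) has_derivative ?D) (at x)"
        by (rule bounded_linear.has_derivative[OF bounded_linear_vec_nth d\<zeta>])
      then have D: "((\<lambda>x. Z x $ i) has_derivative ?D) (at x)"
        by (rule has_derivative_transform_within_open[OF _ open_ball x]) (simp add: Z\<zeta>)
      have "grad (\<lambda>x. Z x $ i) x $ i = frechet_derivative (\<lambda>x. Z x $ i) (at x) (axis i 1)"
        by (simp add: grad_def partial_def)
      also have "\<dots> = ?D (axis i 1)"
        by (rule fun_cong[OF frechet_derivative_at[OF D], symmetric])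
      finally show ?thesis
        by (simp add: matrix_vector_mult_basis column_def)
    qed
    let ?Q = "(H x *v P x) \<bullet> P x"
    have Pexp: "P x = (P x $ 1) *\<^sub>R axis 1 1 + (P x $ 2) *\<^sub>R axis 2 1"
      by (simp add: vec_eq_iff forall_2 axis_def)
    have "(\<Sum>i\<in>UNIV. (P x \<bullet> (H x *v axis i 1)) * P x $ i) = ?Q"
    proof -
      have "(\<Sum>i\<in>UNIV. (P x \<bullet> (H x *v axis i 1)) * P x $ i) = P x \<bullet> (H x *v ((P x $ 1) *\<^sub>R axis 1 1 + (P x $ 2) *\<^sub>R axis 2 1))"
        by (simp add: sum_2 matrix_vector_right_distrib matrix_vector_mult_scaleR inner_add_right mult.commute)
      then show ?thesis using Pexp by (simp add: inner_commute)
    qed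
    then have sum: "(\<Sum>i\<in>UNIV. grad (\<lambda>x. Z x $ i) x $ i) = (\<rho> / s) * trace (H x) + (k / s\<^sup>2 - \<rho> / s ^ 3) * ?Q"
      unfolding gi by (simp add: sum.distrib trace_def sum_distrib_left[symmetric] sum_divide_distrib[symmetric] mult.assoc)
    define a where "a = reg_slope \<epsilon> \<rho>"
    have a0: "0 < a" unfolding a_def using reg_slope_pos \<epsilon> \<rho>0 by simp
    have ab: "\<bar>a - b0\<bar> \<le> \<delta>" unfolding a_def using slope \<rho>b by simp
    have k0: "0 < hderiv2 f \<rho> + \<epsilon>" using regular_hderiv2_nonneg[OF regular \<rho>0] \<epsilon> by simp
    have ak: "a = \<rho> / (k * s)"
      unfolding a_def reg_slope_def k_def \<rho>b(3) using k0 s0 by (simp add: field_simps)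
    have k0': "0 < k" unfolding k_def using k0 by simp
    have F: "c \<le> limit_operator (\<lambda>_. a) (P x) (H x)" by (rule strict[OF xc ab])
    have sumF: "(\<Sum>i\<in>UNIV. grad (\<lambda>x. Z x $ i) x $ i) = - (\<rho> / (s ^ 3 * a)) * limit_operator (\<lambda>_. a) (P x) (H x)"
      unfolding sum limit_operator_def s_def[symmetric] ak
      using s0 \<rho>0 k0' by (simp add: field_simps power2_eq_square power3_eq_cube)
    have s2: "s \<le> hderiv f \<rho>2" using range[OF xc] by (simp add: s_def)
    have "\<rho>1 * c / (hderiv f \<rho>2 ^ 3 * (b0 + \<delta>)) \<le> \<rho> * limit_operator (\<lambda>_. a) (P x) (H x) / (s ^ 3 * a)"
    proof (rule frac_le)
      show "\<rho>1 * c \<le> \<rho> * limit_operator (\<lambda>_. a) (P x) (H x)"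
        using \<rho>b F \<open>0 < c\<close> \<rho> by (intro mult_mono) auto
      show "s ^ 3 * a \<le> hderiv f \<rho>2 ^ 3 * (b0 + \<delta>)"
        using s2 s0 ab a0 by (intro mult_mono power_mono) auto
      show "0 < s ^ 3 * a" using s0 a0 by simp
      show "0 \<le> \<rho> * limit_operator (\<lambda>_. a) (P x) (H x)" using \<rho>0 F \<open>0 < c\<close> by simp
    qed
    then show ?thesis unfolding sumF by simp
  qed
  show ?thesis
  proof (intro exI[of _ Z] conjI allI ballI)
    show "(\<lambda>x. Z x $ i) \<in> Lip UNIV" for i
      using W(1)[of i] by (simp add: Z_def)
    show "stress (Z x) + \<epsilon> *\<^sub>R Z x = P x" "norm (Z x) \<le> \<rho>2" if "x \<in> cball x0 r" for x
      using A\<zeta>[OF that] n\<zeta>[OF that] hP[OF that] Z\<zeta>[OF that] by simp_all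
  qed (rule div)
qed

text \<open>Suppose that \<open>V - \<phi>\<close> exceeds \<open>m\<close> at the centre, and test with the positive part \<open>z\<close> of \<open>V - \<phi> - m\<close>. The field
\<open>\<xi> = rot (grad U)\<close> is divergence free, and \<open>stress \<xi> = grad V\<close>; for the field \<open>Z\<close> of the previous lemma the integral of
\<open>Z \<bullet> grad z\<close> is at least a positive multiple of the integral of \<open>z\<close>. By monotonicity of \<open>stress\<close> the integral of
\<open>(\<xi> - Z) \<bullet> grad z\<close> is nonnegative up to an error of order \<open>\<epsilon>\<close>, a contradiction for small \<open>\<epsilon>\<close>.\<close>
lemma comparison_with_strict_supersolution:
  fixes P :: "real^2 \<Rightarrow> real^2" and H :: "real^2 \<Rightarrow> real^2^2"
  assumes U: "U \<in> Lip UNIV" and V: "V \<in> Lip UNIV" and r: "0 < r"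
    and conj: "AE x in lebesgue. x \<in> ball x0 r \<longrightarrow> grad V x = rot (stress (grad U x))"
    and \<rho>: "0 < \<rho>1" "\<rho>1 < \<rho>2" and "0 < \<eta>" "0 \<le> K" "\<delta>' < \<delta>" "0 < c"
    and \<phi>: "\<And>x. x \<in> cball x0 r \<Longrightarrow> (\<phi> has_derivative (\<lambda>v. P x \<bullet> v)) (at x)"
    and P: "\<And>x. x \<in> cball x0 r \<Longrightarrow> (P has_derivative (\<lambda>v. H x *v v)) (at x)"
    and HK: "\<And>x. x \<in> cball x0 r \<Longrightarrow> onorm (\<lambda>v. H x *v v) \<le> K"
    and range: "\<And>x. x \<in> cball x0 r \<Longrightarrow> hderiv f \<rho>1 + \<eta> \<le> norm (P x) \<and> norm (P x) \<le> hderiv f \<rho>2"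
    and slope: "\<And>\<rho>. \<rho>1 \<le> \<rho> \<Longrightarrow> \<rho> \<le> \<rho>2 \<Longrightarrow> \<bar>log_slope f \<rho> - b0\<bar> \<le> \<delta>'"
    and strict: "\<And>x b. x \<in> cball x0 r \<Longrightarrow> \<bar>b - b0\<bar> \<le> \<delta> \<Longrightarrow> c \<le> limit_operator (\<lambda>_. b) (P x) (H x)"
    and bd: "\<And>x. x \<in> sphere x0 r \<Longrightarrow> V x - \<phi> x \<le> m"
  shows "V x0 - \<phi> x0 \<le> m"
proof (rule ccontr)
  assume "\<not> V x0 - \<phi> x0 \<le> m"
  then have m: "m < V x0 - \<phi> x0" by simp
  define D where "D = ball x0 r"
  define g where "g x = V x - (\<phi> x + m)" for x
  define z where "z = cutoff D g"
  have clD: "closure D = cball x0 r" and frD: "frontier D = sphere x0 r"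
    using r by (simp_all add: D_def)
  have \<phi>d: "\<phi> differentiable (at x)" and \<phi>g: "grad \<phi> x = P x" if "x \<in> cball x0 r" for x
    using \<phi>[OF that] by (auto simp: differentiable_def grad_eqI)
  have \<phi>lip: "\<phi> \<in> Lip (cball x0 r)"
  proof -
    have "(hderiv f \<rho>2)-lipschitz_on (cball x0 r) \<phi>"
    proof (rule lipschitz_onI)
      fix x y assume xy: "x \<in> cball x0 r" "y \<in> cball x0 r"
      have "norm (\<phi> x - \<phi> y) \<le> hderiv f \<rho>2 * norm (x - y)"
      proof (rule differentiable_bound[of "cball x0 r" \<phi> "\<lambda>x v. P x \<bullet> v"])
        show "onorm (\<lambda>v. P x \<bullet> v) \<le> hderiv f \<rho>2" if "x \<in> cball x0 r" for x
        proof (rule onorm_le)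
          fix v
          have "\<bar>P x \<bullet> v\<bar> \<le> norm (P x) * norm v" by (rule Cauchy_Schwarz_ineq2)
          also have "\<dots> \<le> hderiv f \<rho>2 * norm v"
            using range[OF that] by (intro mult_right_mono) auto
          finally show "norm (P x \<bullet> v) \<le> hderiv f \<rho>2 * norm v" by simp
        qed
      qed (use \<phi> xy in \<open>auto intro: has_derivative_at_withinI\<close>)
      then show "dist (\<phi> x) (\<phi> y) \<le> hderiv f \<rho>2 * dist x y" by (simp add: dist_norm)
    qed (use hderiv_nonneg \<rho> in simp)
    then show ?thesis by (auto simp: Lip_def)
  qed
  have glip: "g \<in> Lip (closure D)"
    unfolding g_def[abs_def] clD by (intro Lip_diff Lip_add \<phi>lip Lip_const Lip_UNIV_imp_Lip[OF V])
  have z: "z \<in> Lip UNIV"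
    unfolding z_def using glip bd by (intro cutoff_Lip) (auto simp: frD g_def algebra_simps)
  have z0: "0 \<le> z x" for x by (simp add: z_def cutoff_nonneg)
  define R where "R = norm x0 + r"
  have zsupp: "z x = 0" if "R \<le> norm x" for x
  proof -
    have "norm x \<le> norm x0 + dist x0 x" by (metis dist_norm norm_minus_commute norm_triangle_sub)
    then show ?thesis using that by (simp add: z_def cutoff_def D_def R_def)
  qed
  obtain Cu where Cu: "Cu-lipschitz_on UNIV U" using U by (auto simp: Lip_def)
  have Cu0: "0 \<le> Cu" using Cu by (rule lipschitz_on_nonneg)
  have zint: "integrable lebesgue z"
  proof -
    obtain B where "\<And>x. \<bar>z x\<bar> \<le> B" using bounded_of_Lip_support[OF z zsupp] by metis
    then show ?thesis
      by (intro integrable_bounded_support[of _ B R] lebesgue_measurable_Lip[OF z]) (use zsupp in auto)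
  qed
  define I where "I = (LINT x|lebesgue. z x)"
  have I0: "0 < I"
  proof -
    have "0 \<le> I" unfolding I_def using z0 by (intro integral_nonneg_AE) auto
    moreover have "I \<noteq> 0"
    proof
      assume "I = 0"
      then have "AE x in lebesgue. z x = 0"
        using integral_nonneg_eq_0_iff_AE[OF zint] z0 by (auto simp: I_def)
      then have "{x. z x \<noteq> 0} \<in> null_sets lebesgue"
        by (simp add: completion.AE_iff_null_sets)
      moreover have "open {x. z x \<noteq> 0}"
        using continuous_Lip[OF z] by (intro open_Collect_neq continuous_intros)
      moreover have "x0 \<in> {x. z x \<noteq> 0}"
        using m r by (simp add: z_def cutoff_def D_def g_def)
      ultimately show False
        using open_not_negligible negligible_iff_null_sets by blast
    qed
    ultimately show ?thesis by simp
  qed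
  define \<kappa> where "\<kappa> = \<rho>1 * c / (hderiv f \<rho>2 ^ 3 * (b0 + \<delta>))"
  \<comment> \<open>\<open>\<epsilon> * M\<close> bounds the error in the monotonicity estimate\<close>
  define M where "M = (Cu + \<rho>2) * \<rho>2 * measure lebesgue D"
  have key: "\<kappa> * I \<le> \<epsilon> * M"
    if \<epsilon>: "0 < \<epsilon>" "\<epsilon> * \<rho>1 < \<eta>" "\<epsilon> * (\<rho>2 * (1 + \<bar>b0\<bar> + \<delta>) / hderiv f \<rho>1) \<le> \<delta> - \<delta>'" for \<epsilon>
  proof -
    have slope\<epsilon>: "\<bar>reg_slope \<epsilon> \<rho> - b0\<bar> \<le> \<delta>" if "\<rho>1 \<le> \<rho>" "\<rho> \<le> \<rho>2" for \<rho>
    proof -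
      have "0 < \<rho>" using that \<open>0 < \<rho>1\<close> by simp
      have "\<bar>log_slope f \<rho>\<bar> \<le> \<bar>b0\<bar> + \<delta>" using slope[OF that] \<open>\<delta>' < \<delta>\<close> by linarith
      moreover have "hderiv f \<rho>1 \<le> hderiv f \<rho>"
        using regular_hderiv_le[OF regular] that \<open>0 < \<rho>1\<close> by simp
      ultimately have "\<rho> * (1 + \<bar>log_slope f \<rho>\<bar>) / hderiv f \<rho> \<le> \<rho>2 * (1 + \<bar>b0\<bar> + \<delta>) / hderiv f \<rho>1"
        using that \<open>0 < \<rho>\<close> hderiv_pos[OF \<open>0 < \<rho>1\<close>] by (intro frac_le mult_mono) auto
      then have "\<epsilon> * (\<rho> * (1 + \<bar>log_slope f \<rho>\<bar>) / hderiv f \<rho>) \<le> \<delta> - \<delta>'"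
        using \<epsilon> by (meson mult_left_mono order_trans less_imp_le)
      then show ?thesis
        using reg_slope_diff[OF \<epsilon>(1) \<open>0 < \<rho>\<close>] slope[OF that] by linarith
    qed
    have range\<epsilon>: "reg_hderiv \<epsilon> \<rho>1 < norm (P x) \<and> norm (P x) \<le> hderiv f \<rho>2" if "x \<in> cball x0 r" for x
      using range[OF that] \<epsilon>(2) by (simp add: reg_hderiv_def)
    obtain Z where Z: "(\<lambda>x. Z x $ i) \<in> Lip UNIV"
      "x \<in> cball x0 r \<Longrightarrow> stress (Z x) + \<epsilon> *\<^sub>R Z x = P x \<and> norm (Z x) \<le> \<rho>2"
      "x \<in> ball x0 r \<Longrightarrow> (\<Sum>i\<in>UNIV. grad (\<lambda>x. Z x $ i) x $ i) \<le> - \<kappa>" for i x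
      using strict_supersolution_field[OF \<epsilon>(1) \<rho> \<open>0 \<le> K\<close> P HK range\<epsilon> slope\<epsilon> strict \<open>0 < c\<close>, folded \<kappa>_def]
      by blast
    have intZ: "integrable lebesgue (\<lambda>x. Z x $ i * (grad z x \<bullet> e))"
        and intdZ: "integrable lebesgue (\<lambda>x. z x * (grad (\<lambda>x. Z x $ i) x \<bullet> e))" for i e
      using integrable_grad_mult(1,2)[OF Z(1) z zsupp] by blast+
    have ibp: "(LINT x|lebesgue. Z x $ i * (grad z x \<bullet> axis i 1)) = - (LINT x|lebesgue. z x * (grad (\<lambda>x. Z x $ i) x \<bullet> axis i 1))" for i
      by (rule integral_by_parts_Lip[OF Z(1) z zsupp])
    have divint: "integrable lebesgue (\<lambda>x. \<Sum>i\<in>UNIV. z x * (grad (\<lambda>x. Z x $ i) x \<bullet> axis i 1))"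
      using intdZ by (intro Bochner_Integration.integrable_sum)
    have Zint: "integrable lebesgue (\<lambda>x. Z x \<bullet> grad z x)"
    proof -
      have "(\<lambda>x. Z x \<bullet> grad z x) = (\<lambda>x. \<Sum>i\<in>UNIV. Z x $ i * (grad z x \<bullet> axis i 1))"
        by (simp add: inner_axis) (simp add: inner_vec_def)
      then show ?thesis using intZ by (simp add: Bochner_Integration.integrable_sum)
    qed
    have 1: "\<kappa> * I \<le> (LINT x|lebesgue. Z x \<bullet> grad z x)"
    proof -
      have "(LINT x|lebesgue. Z x \<bullet> grad z x) = (\<Sum>i\<in>UNIV. LINT x|lebesgue. Z x $ i * (grad z x \<bullet> axis i 1))"
      proof -
        have "Z x \<bullet> grad z x = (\<Sum>i\<in>UNIV. Z x $ i * (grad z x \<bullet> axis i 1))" for x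
          by (simp add: inner_axis) (simp add: inner_vec_def)
        then show ?thesis
          by (simp only: Bochner_Integration.integral_sum[OF intZ])
      qed
      also have "\<dots> = - (LINT x|lebesgue. (\<Sum>i\<in>UNIV. z x * (grad (\<lambda>x. Z x $ i) x \<bullet> axis i 1)))"
        using intdZ by (subst Bochner_Integration.integral_sum) (auto simp: ibp sum_negf)
      finally have eq: "(LINT x|lebesgue. Z x \<bullet> grad z x) = - (LINT x|lebesgue. (\<Sum>i\<in>UNIV. z x * (grad (\<lambda>x. Z x $ i) x \<bullet> axis i 1)))" .
      have "(LINT x|lebesgue. (\<Sum>i\<in>UNIV. z x * (grad (\<lambda>x. Z x $ i) x \<bullet> axis i 1))) \<le> (LINT x|lebesgue. - \<kappa> * z x)"
      proof (rule integral_mono[OF divint])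
        show "integrable lebesgue (\<lambda>x. - \<kappa> * z x)" using zint by simp
        fix x :: "real^2"
        show "(\<Sum>i\<in>UNIV. z x * (grad (\<lambda>x. Z x $ i) x \<bullet> axis i 1)) \<le> - \<kappa> * z x"
        proof (cases "x \<in> D")
          case True
          then show ?thesis
            using mult_left_mono[OF Z(3)[of x] z0[of x]]
            by (simp add: D_def inner_axis sum_distrib_left mult.commute)
        next
          case False
          then have "z x = 0" by (simp add: z_def cutoff_def)
          then show ?thesis by simp
        qed
      qed
      then show ?thesis unfolding eq I_def using zint by simp
    qed
    define \<xi> where "\<xi> x = rot (grad U x)" for x
    have intU: "integrable lebesgue (\<lambda>x. (grad U x \<bullet> e) * (grad z x \<bullet> d))" for e d
      by (rule integrable_grad_mult(3)[OF U z zsupp])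
    have \<xi>eq: "\<xi> x \<bullet> grad z x = (grad U x \<bullet> axis 1 1) * (grad z x \<bullet> axis 2 1) - (grad U x \<bullet> axis 2 1) * (grad z x \<bullet> axis 1 1)" for x
      by (simp add: \<xi>_def inner_real2[of "rot _"] inner_axis)
    have \<xi>int: "integrable lebesgue (\<lambda>x. \<xi> x \<bullet> grad z x)"
      unfolding \<xi>eq by (intro Bochner_Integration.integrable_diff intU)
    have 2: "(LINT x|lebesgue. \<xi> x \<bullet> grad z x) = 0"
      unfolding \<xi>eq using integral_grad_grad_commute[OF U z zsupp, where a = "axis 1 1" and b = "axis 2 1"]
      by (subst Bochner_Integration.integral_diff) (auto intro: intU)
    have 3: "(LINT x|lebesgue. - (\<epsilon> * (Cu + \<rho>2) * \<rho>2) * indicator D x) \<le> (LINT x|lebesgue. \<xi> x \<bullet> grad z x - Z x \<bullet> grad z x)"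
    proof (rule integral_mono_AE)
      show "integrable lebesgue (\<lambda>x. - (\<epsilon> * (Cu + \<rho>2) * \<rho>2) * indicator D x)"
        unfolding D_def by (intro integrable_mult_right integrable_real_indicator)
          (auto intro: emeasure_bounded_finite[unfolded infinity_ennreal_def])
      show "integrable lebesgue (\<lambda>x. \<xi> x \<bullet> grad z x - Z x \<bullet> grad z x)"
        using \<xi>int Zint by (rule Bochner_Integration.integrable_diff)
      have gcont: "continuous_on D g"
        using continuous_Lip[OF glip] closure_subset continuous_on_subset by blast
      have Dop: "open D" by (simp add: D_def)
      show "AE x in lebesgue. - (\<epsilon> * (Cu + \<rho>2) * \<rho>2) * indicator D x \<le> \<xi> x \<bullet> grad z x - Z x \<bullet> grad z x"
        using AE_grad_cutoff[OF z[unfolded z_def] Dop gcont] conj AE_differentiable[OF U] AE_differentiable[OF V]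
      proof eventually_elim
        case (elim x)
        have nn: "0 \<le> \<epsilon> * (Cu + \<rho>2) * \<rho>2" using \<epsilon> \<rho> Cu0 by simp
        show ?case
        proof (cases "0 < z x")
          case False
          then have "grad z x = 0" using elim(1) by (simp add: z_def)
          then show ?thesis using nn by (simp add: indicator_def)
        next
          case True
          then have x: "x \<in> D" and gz: "grad z x = grad g x"
            using elim(1) by (auto simp: z_def)
          then have xc: "x \<in> cball x0 r" by (simp add: D_def)
          have "((\<lambda>x. \<phi> x + m) has_derivative (\<lambda>v. P x \<bullet> v)) (at x)"
            using \<phi>[OF xc] by (rule has_derivative_add_const)
          from has_derivative_diff[OF has_derivative_grad[OF elim(4)] this]
          have "grad g x = grad V x - P x"
            unfolding g_def[abs_def] by (intro grad_eqI) (simp add: inner_diff_left)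
          also have "grad V x = stress (\<xi> x)"
            using elim(2) x by (simp add: \<xi>_def stress_rot D_def)
          also have "P x = stress (Z x) + \<epsilon> *\<^sub>R Z x" using Z(2)[OF xc] by simp
          finally have gz': "grad z x = (stress (\<xi> x) - stress (Z x)) - \<epsilon> *\<^sub>R Z x" using gz by simp
          have "norm (grad U x) \<le> Cu" using norm_grad_le[OF Cu _ _ elim(3)] by auto
          then have "norm (\<xi> x) \<le> Cu" by (simp add: \<xi>_def norm_rot)
          then have "norm (\<xi> x - Z x) \<le> Cu + \<rho>2"
            using Z(2)[OF xc] norm_triangle_ineq4[of "\<xi> x" "Z x"] by linarith
          then have "norm (\<xi> x - Z x) * norm (Z x) \<le> (Cu + \<rho>2) * \<rho>2"
            using Z(2)[OF xc] Cu0 \<rho> by (intro mult_mono) auto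
          then have "(\<xi> x - Z x) \<bullet> Z x \<le> (Cu + \<rho>2) * \<rho>2"
            using norm_cauchy_schwarz[of "\<xi> x - Z x" "Z x"] by linarith
          then have "\<epsilon> * ((\<xi> x - Z x) \<bullet> Z x) \<le> \<epsilon> * ((Cu + \<rho>2) * \<rho>2)"
            using \<epsilon> by (intro mult_left_mono) auto
          moreover have "\<xi> x \<bullet> grad z x - Z x \<bullet> grad z x = (stress (\<xi> x) - stress (Z x)) \<bullet> (\<xi> x - Z x) - \<epsilon> * ((\<xi> x - Z x) \<bullet> Z x)"
            unfolding gz' by (simp add: inner_diff_left inner_diff_right inner_commute algebra_simps)
          ultimately show ?thesis
            using stress_monotone[of "\<xi> x" "Z x"] x by (simp add: mult.assoc)
        qed
      qed
    qed
    have "(LINT x|lebesgue. - (\<epsilon> * (Cu + \<rho>2) * \<rho>2) * indicator D x) = - (\<epsilon> * M)"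
      by (simp add: M_def mult.assoc)
    moreover have "(LINT x|lebesgue. \<xi> x \<bullet> grad z x - Z x \<bullet> grad z x) = - (LINT x|lebesgue. Z x \<bullet> grad z x)"
      using \<xi>int Zint 2 by simp
    ultimately show ?thesis using 1 3 by linarith
  qed
  have d1: "0 < hderiv f \<rho>1" "0 < hderiv f \<rho>2" using hderiv_pos \<rho> by auto
  have "log_slope f \<rho>1 \<ge> 0"
    using regular_hderiv2_nonneg[OF regular \<rho>(1)] d1 \<rho> by (simp add: log_slope_def)
  then have b0\<delta>: "0 < b0 + \<delta>" using slope[of \<rho>1] \<open>\<delta>' < \<delta>\<close> \<rho> by simp
  then have \<kappa>0: "0 < \<kappa>" unfolding \<kappa>_def using d1 \<rho> \<open>0 < c\<close> by simp
  have \<delta>0: "0 \<le> \<delta>" using slope[of \<rho>1] \<open>\<delta>' < \<delta>\<close> \<rho> by simp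
  define T where "T = \<rho>2 * (1 + \<bar>b0\<bar> + \<delta>) / hderiv f \<rho>1"
  have T0: "0 < T" unfolding T_def using \<rho> d1 \<delta>0 by simp
  have "0 \<le> M" unfolding M_def using Cu0 \<rho> by simp
  define \<epsilon> where "\<epsilon> = min (\<eta> / (2 * \<rho>1)) (min ((\<delta> - \<delta>') / T) (\<kappa> * I / (2 * (M + 1))))"
  have \<epsilon>0: "0 < \<epsilon>"
    unfolding \<epsilon>_def using \<open>0 < \<eta>\<close> \<rho> \<open>\<delta>' < \<delta>\<close> T0 \<kappa>0 I0 \<open>0 \<le> M\<close> by simp
  have "\<epsilon> * \<rho>1 \<le> \<eta> / (2 * \<rho>1) * \<rho>1" using \<rho> by (intro mult_right_mono) (auto simp: \<epsilon>_def)
  also have "\<dots> < \<eta>" using \<rho> \<open>0 < \<eta>\<close> by simp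
  finally have e1: "\<epsilon> * \<rho>1 < \<eta>" .
  have "\<epsilon> * T \<le> (\<delta> - \<delta>') / T * T" using T0 by (intro mult_right_mono) (auto simp: \<epsilon>_def)
  then have e2: "\<epsilon> * T \<le> \<delta> - \<delta>'" using T0 by simp
  have "\<epsilon> * M \<le> \<epsilon> * (M + 1)" using \<epsilon>0 by simp
  also have "\<dots> \<le> \<kappa> * I / (2 * (M + 1)) * (M + 1)"
    using \<open>0 \<le> M\<close> by (intro mult_right_mono) (auto simp: \<epsilon>_def)
  also have "\<dots> = \<kappa> * I / 2" using \<open>0 \<le> M\<close> by (simp add: field_simps)
  also have "\<dots> < \<kappa> * I" using \<kappa>0 I0 by simp
  finally show False using key[OF \<epsilon>0 e1 e2[unfolded T_def]] by simp
qed

end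

section \<open>Stability: the limit is a viscosity solution\<close>

lemma jacobian_has_derivative:
  assumes "grad \<phi> differentiable (at x)"
  shows "(grad \<phi> has_derivative (\<lambda>v. hessian \<phi> x *v v)) (at x)"
  using assms unfolding hessian_def by (simp add: jacobian_works)

lemma C2_onD:
  assumes "C2_on S \<phi>" "x \<in> S"
  shows "(\<phi> has_derivative (\<lambda>v. grad \<phi> x \<bullet> v)) (at x)"
    and "(grad \<phi> has_derivative (\<lambda>v. hessian \<phi> x *v v)) (at x)"
  using assms by (auto simp: C2_on_def intro: has_derivative_grad jacobian_has_derivative)

lemma limit_operator_uminus: "limit_operator \<beta> (- p) (- X) = - limit_operator \<beta> p X"
  by (simp add: limit_operator_def trace_def matrix_vector_mult_def inner_vec_def sum_negf algebra_simps)

lemma limit_operator_zero: "limit_operator \<beta> 0 X = 0"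
  by (simp add: limit_operator_def)

lemma viscosity_supersolution_of_subsolution_uminus:
  assumes "open \<Omega>" "viscosity_subsolution \<Omega> (limit_operator \<beta>) (\<lambda>x. - w x)"
  shows "viscosity_supersolution \<Omega> (limit_operator \<beta>) w"
  unfolding viscosity_supersolution_def
proof (intro conjI allI ballI impI)
  show "continuous_on \<Omega> w"
    using assms(2) continuous_on_minus[of \<Omega> "\<lambda>x. - w x"] by (simp add: viscosity_subsolution_def)
  fix \<phi> x assume x: "x \<in> \<Omega>" and *: "C2_on \<Omega> \<phi> \<and> (\<forall>\<^sub>F y in nhds x. w x - \<phi> x \<le> w y - \<phi> y)"
  then have C2: "C2_on \<Omega> \<phi>" by blast
  have g: "grad (\<lambda>y. - \<phi> y) y = - grad \<phi> y" if "y \<in> \<Omega>" for y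
    using C2 that by (intro grad_minus) (auto simp: C2_on_def)
  have dm: "(grad (\<lambda>y. - \<phi> y) has_derivative (\<lambda>v. (- hessian \<phi> y) *v v)) (at y)" if y: "y \<in> \<Omega>" for y
  proof -
    have "((\<lambda>y. - grad \<phi> y) has_derivative (\<lambda>v. (- hessian \<phi> y) *v v)) (at y)"
      using has_derivative_minus[OF C2_onD(2)[OF C2 y]]
      by (simp add: matrix_vector_mult_def sum_negf vec_eq_iff fun_eq_iff uminus_vec_def)
    then show ?thesis
      by (rule has_derivative_transform_within_open[OF _ assms(1) y]) (simp add: g)
  qed
  have h: "hessian (\<lambda>y. - \<phi> y) y = - hessian \<phi> y" if y: "y \<in> \<Omega>" for y
  proof -
    have "frechet_derivative (grad (\<lambda>y. - \<phi> y)) (at y) = (\<lambda>v. (- hessian \<phi> y) *v v)"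
      using frechet_derivative_at[OF dm[OF y]] by simp
    then show ?thesis by (simp add: hessian_def jacobian_def)
  qed
  have "C2_on \<Omega> (\<lambda>y. - \<phi> y)"
    unfolding C2_on_def
  proof (intro conjI ballI)
    show "(\<lambda>y. - \<phi> y) differentiable at y" if "y \<in> \<Omega>" for y
      using C2 that by (auto simp: C2_on_def)
    show "grad (\<lambda>y. - \<phi> y) differentiable at y" if "y \<in> \<Omega>" for y
      using dm[OF that] by (auto simp: differentiable_def)
    have "continuous_on \<Omega> (\<lambda>y. - hessian \<phi> y)"
      using C2 by (auto simp: C2_on_def intro: continuous_on_minus)
    then show "continuous_on \<Omega> (hessian (\<lambda>y. - \<phi> y))"
      by (rule continuous_on_eq) (simp add: h)
  qed
  moreover have "\<forall>\<^sub>F y in nhds x. - w y - - \<phi> y \<le> - w x - - \<phi> x"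
    using * by (auto elim: eventually_mono)
  ultimately have "limit_operator \<beta> (grad (\<lambda>y. - \<phi> y) x) (hessian (\<lambda>y. - \<phi> y) x) \<le> 0"
    using assms(2) x unfolding viscosity_subsolution_def by blast
  then show "0 \<le> limit_operator \<beta> (grad \<phi> x) (hessian \<phi> x)"
    unfolding g[OF x] h[OF x] limit_operator_uminus by simp
qed

text \<open>In the direction of \<open>- p\<close> the function \<open>\<phi>\<close> falls at the rate \<open>norm p\<close>, and \<open>w\<close>, which stays below, at a rate of at most \<open>M\<close>.\<close>
lemma norm_gradient_at_touching_le:
  fixes w \<phi> :: "real^2 \<Rightarrow> real"
  assumes w: "M-lipschitz_on S w" and S: "open S" "x \<in> S"
    and \<phi>: "(\<phi> has_derivative (\<lambda>v. p \<bullet> v)) (at x)"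
    and touch: "\<forall>\<^sub>F y in nhds x. w y - \<phi> y \<le> w x - \<phi> x"
  shows "norm p \<le> M"
proof -
  have M: "0 \<le> M" using w by (rule lipschitz_on_nonneg)
  have gr: "grad \<phi> x = p" and d: "\<phi> differentiable (at x)"
    using \<phi> by (auto intro: grad_eqI simp: differentiable_def)
  have lim: "((\<lambda>h. (\<phi> (x + h *\<^sub>R (- p)) - \<phi> x) / h) \<longlongrightarrow> p \<bullet> (- p)) (at_right 0)"
    using tendsto_difference_quotient_grad[OF d, of "\<lambda>h. h" "at_right 0" "- p"]
    by (simp add: gr filterlim_at eventually_at_filter)
  have "((\<lambda>h. x + h *\<^sub>R (- p)) \<longlongrightarrow> x) (at_right 0)"
    by (auto intro!: tendsto_eq_intros)
  moreover have "\<forall>\<^sub>F y in nhds x. y \<in> S \<and> w y - \<phi> y \<le> w x - \<phi> x"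
    using touch eventually_nhds_in_open[OF S] by eventually_elim simp
  ultimately have "\<forall>\<^sub>F h in at_right 0. x + h *\<^sub>R (- p) \<in> S \<and> w (x + h *\<^sub>R (- p)) - \<phi> (x + h *\<^sub>R (- p)) \<le> w x - \<phi> x"
    by (rule eventually_compose_filterlim[rotated])
  then have "\<forall>\<^sub>F h in at_right 0. - (M * norm p) \<le> (\<phi> (x + h *\<^sub>R (- p)) - \<phi> x) / h"
    using eventually_at_right_less[of "0::real"]
  proof eventually_elim
    case (elim h)
    have "\<bar>w (x + h *\<^sub>R (- p)) - w x\<bar> \<le> M * (h * norm p)"
      using lipschitz_onD[OF w, of "x + h *\<^sub>R (- p)" x] elim S(2) by (simp add: dist_norm)
    then have "- (M * (h * norm p)) \<le> \<phi> (x + h *\<^sub>R (- p)) - \<phi> x"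
      using elim(1) by linarith
    then have "- (M * norm p) * h \<le> \<phi> (x + h *\<^sub>R (- p)) - \<phi> x"
      by (simp add: mult_ac)
    then show ?case using elim(2) by (simp add: pos_le_divide_eq)
  qed
  then have "- (M * norm p) \<le> p \<bullet> (- p)"
    by (rule tendsto_lowerbound[OF lim]) simp
  then have "norm p * norm p \<le> M * norm p"
    by (simp add: power2_norm_eq_inner[symmetric] power2_eq_square)
  then show ?thesis using M by (cases "p = 0") auto
qed

lemma continuous_limit_operator:
  fixes P :: "'a::topological_space \<Rightarrow> real^2" and X :: "'a \<Rightarrow> real^2^2"
  assumes "continuous_on A b" "continuous_on A P" "continuous_on A X"
  shows "continuous_on A (\<lambda>y. limit_operator (\<lambda>_. b y) (P y) (X y))"
  unfolding limit_operator_def matrix_vector_mult_def inner_vec_def trace_def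
  using assms by (simp, intro continuous_intros)

lemma dist_Pair_le:
  fixes a c :: "'a::metric_space" and b d :: "'b::metric_space"
  shows "dist (a, b) (c, d) \<le> dist a c + dist b d"
  unfolding dist_Pair_Pair by (rule sqrt_sum_squares_le_sum) auto

context degenerate_lagrangean
begin

lemma hderiv_onto:
  assumes "0 \<le> s" "s \<le> hderiv f R" "0 \<le> R"
  obtains \<rho> where "0 \<le> \<rho>" "\<rho> \<le> R" "hderiv f \<rho> = s"
  using IVT'[of "hderiv f" 0 s R] assms continuous_on_subset[OF continuous_hderiv] hderiv_0 by fastforce

lemma dual_deriv_hderiv: "0 \<le> \<rho> \<Longrightarrow> dual_deriv f (hderiv f \<rho>) = \<rho>"
proof -
  assume "0 \<le> \<rho>"
  moreover have "inj_on (hderiv f) {0..}"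
    by (rule inj_onI) (metis atLeast_iff less_irrefl linorder_neqE_linordered_idom regular regular_hderiv_less)
  ultimately show ?thesis unfolding dual_deriv_def by (intro the_inv_into_f_f) auto
qed

text \<open>The limit \<open>\<beta>\<close> inherits this continuity, away from \<open>0\<close>.\<close>
lemma continuous_dual_slope:
  assumes "0 < s1" "s2 \<le> hderiv f R" "0 \<le> R"
  shows "continuous_on {s1..s2} (alpha f \<circ> dual_deriv f)"
proof (cases "s1 \<le> s2")
  case True
  then obtain \<rho>1 where \<rho>1: "0 \<le> \<rho>1" "\<rho>1 \<le> R" "hderiv f \<rho>1 = s1"
    using hderiv_onto[of s1 R] assms by auto
  have \<rho>1': "0 < \<rho>1" using \<rho>1 assms(1) hderiv_0 by (cases "\<rho>1 = 0") auto
  have sub: "{s1..s2} \<subseteq> hderiv f ` {\<rho>1..R}"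
  proof
    fix s assume s: "s \<in> {s1..s2}"
    then obtain \<rho> where "0 \<le> \<rho>" "\<rho> \<le> R" "hderiv f \<rho> = s"
      using hderiv_onto[of s R] assms by auto
    moreover have "\<not> \<rho> < \<rho>1"
      using regular_hderiv_less[OF regular, of \<rho> \<rho>1] calculation s \<rho>1 by auto
    ultimately show "s \<in> hderiv f ` {\<rho>1..R}" by auto
  qed
  have "continuous_on (hderiv f ` {\<rho>1..R}) (dual_deriv f)"
    using \<rho>1(1) by (intro continuous_on_inv continuous_on_subset[OF continuous_hderiv]) (auto simp: dual_deriv_hderiv)
  then have c1: "continuous_on {s1..s2} (dual_deriv f)"
    using sub by (rule continuous_on_subset)
  have img: "dual_deriv f ` {s1..s2} \<subseteq> {\<rho>1..R}"
  proof
    fix \<rho> assume "\<rho> \<in> dual_deriv f ` {s1..s2}"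
    then obtain \<rho>' where "\<rho>' \<in> {\<rho>1..R}" "\<rho> = dual_deriv f (hderiv f \<rho>')"
      using sub by blast
    then show "\<rho> \<in> {\<rho>1..R}" using \<rho>1 by (simp add: dual_deriv_hderiv)
  qed
  have c2: "continuous_on {\<rho>1..R} (alpha f)"
  proof (rule continuous_on_eq)
    have "hderiv f \<rho> \<noteq> 0" if "\<rho> \<in> {\<rho>1..R}" for \<rho>
      using hderiv_pos[of \<rho>] that \<rho>1' by simp
    then show "continuous_on {\<rho>1..R} (\<lambda>\<rho>. \<rho> * hderiv2 f \<rho> / hderiv f \<rho>)"
      using \<rho>1' by (intro continuous_intros regular_hderiv2_continuous[OF regular]
          continuous_on_subset[OF continuous_hderiv]) auto
    show "\<rho> * hderiv2 f \<rho> / hderiv f \<rho> = alpha f \<rho>" if "\<rho> \<in> {\<rho>1..R}" for \<rho>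
      using that \<rho>1' by (simp add: alpha_def log_slope_def)
  qed
  show ?thesis
    by (rule continuous_on_compose[OF c1 continuous_on_subset[OF c2 img]])
qed simp

end

text \<open>The test function \<open>\<phi>\<close>, strengthened by a quadratic term, is compared with \<open>V n\<close> for a single large \<open>n\<close>. The slope of \<open>\<phi>\<close> at the
touching point is at most \<open>M\<close>, hence in the range of \<open>hderiv (F n)\<close> on \<open>[0, R]\<close>; the margin between \<open>M\<close> and \<open>M'\<close> leaves
room for a neighbourhood of slopes.\<close>
lemma viscosity_subsolution_of_uniform_limit:
  fixes \<Omega> :: "(real^2) set" and F :: "nat \<Rightarrow> real \<Rightarrow> real" and \<beta> :: "real \<Rightarrow> real"
  assumes \<Omega>: "open \<Omega>" and F: "\<And>n. degenerate_lagrangean (F n)"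
    and U: "\<And>n. U n \<in> Lip UNIV" and V: "\<And>n. V n \<in> Lip UNIV"
    and conj: "\<And>n. AE x in lebesgue. x \<in> \<Omega> \<longrightarrow> grad (V n) x = rot (degenerate_lagrangean.stress (F n) (grad (U n) x))"
    and lim: "uniform_limit \<Omega> V w sequentially"
    and w: "M-lipschitz_on \<Omega> w" and "M < M'" and "0 \<le> R"
    and range: "\<And>n. M' \<le> hderiv (F n) R"
    and \<beta>: "\<And>K. compact K \<Longrightarrow> K \<subseteq> {0..} \<Longrightarrow> uniform_limit K (\<lambda>n. alpha (F n) \<circ> dual_deriv (F n)) \<beta> sequentially"
  shows "viscosity_subsolution \<Omega> (limit_operator \<beta>) w"
  unfolding viscosity_subsolution_def
proof (intro conjI allI ballI impI)
  show "continuous_on \<Omega> w" using w by (rule lipschitz_on_continuous_on)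
  fix \<phi> x0 assume x0: "x0 \<in> \<Omega>" and *: "C2_on \<Omega> \<phi> \<and> (\<forall>\<^sub>F y in nhds x0. w y - \<phi> y \<le> w x0 - \<phi> x0)"
  then have C2: "C2_on \<Omega> \<phi>" and touch: "\<forall>\<^sub>F y in nhds x0. w y - \<phi> y \<le> w x0 - \<phi> x0" by auto
  show "limit_operator \<beta> (grad \<phi> x0) (hessian \<phi> x0) \<le> 0"
  proof (rule ccontr)
    assume "\<not> ?thesis"
    then have pos: "0 < limit_operator \<beta> (grad \<phi> x0) (hessian \<phi> x0)" by simp
    define s0 where "s0 = norm (grad \<phi> x0)"
    define b0 where "b0 = \<beta> s0"
    have s0: "0 < s0"
      using pos limit_operator_zero by (auto simp: s0_def)
    have "s0 \<le> M"
      unfolding s0_def using norm_gradient_at_touching_le[OF w \<Omega> x0 C2_onD(1)[OF C2 x0] touch] .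
    then have s0M: "s0 < M'" using \<open>M < M'\<close> by simp
    have \<beta>cont: "continuous_on {s0/2..M'} \<beta>"
    proof (rule uniform_limit_theorem)
      show "\<forall>\<^sub>F n in sequentially. continuous_on {s0/2..M'} (alpha (F n) \<circ> dual_deriv (F n))"
        using degenerate_lagrangean.continuous_dual_slope[OF F _ range \<open>0 \<le> R\<close>] s0 by simp
      show "uniform_limit {s0/2..M'} (\<lambda>n. alpha (F n) \<circ> dual_deriv (F n)) \<beta> sequentially"
        using s0 by (intro \<beta>) auto
    qed simp
    \<comment> \<open>the operator stays above \<open>c\<close> under small changes of the coefficient, the point and the size \<open>k\<close> of the quadratic perturbation\<close>
    define P where "P k x = grad \<phi> x + (2 * k) *\<^sub>R (x - x0)" for k x
    define H where "H k x = hessian \<phi> x + mat (2 * k)" for k :: real and x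
    define A where "A = (UNIV :: real set) \<times> \<Omega> \<times> (UNIV :: real set)"
    define \<Theta> where "\<Theta> y = limit_operator (\<lambda>_. fst y) (P (snd (snd y)) (fst (snd y))) (H (snd (snd y)) (fst (snd y)))"
      for y :: "real \<times> (real^2) \<times> real"
    define c where "c = limit_operator \<beta> (grad \<phi> x0) (hessian \<phi> x0) / 2"
    have c: "0 < c" using pos by (simp add: c_def)
    have gcont: "continuous_on \<Omega> (grad \<phi>)"
      using C2_onD(2)[OF C2] by (meson \<Omega> continuous_on_eq_continuous_at has_derivative_continuous)
    have hcont: "continuous_on \<Omega> (hessian \<phi>)"
      using C2 by (simp add: C2_on_def)
    have \<Theta>cont: "continuous_on A \<Theta>"
    proof -
      have m: "continuous_on A (\<lambda>y. mat (2 * snd (snd y)) :: real^2^2)"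
        unfolding mat_def
      proof (intro continuous_on_vec_lambda)
        show "continuous_on A (\<lambda>y. if i = j then 2 * snd (snd y) else 0)" for i j :: 2
          by (cases "i = j") (auto intro!: continuous_intros)
      qed
      show ?thesis
        unfolding \<Theta>_def[abs_def] P_def H_def
        by (intro continuous_limit_operator continuous_intros m
            continuous_on_compose2[OF gcont] continuous_on_compose2[OF hcont]) (auto simp: A_def)
    qed
    have Aop: "open A" unfolding A_def using \<Omega> by (intro open_Times) auto
    have Aop': "open (A \<inter> \<Theta> -` {c<..})"
      using \<Theta>cont Aop by (intro continuous_open_preimage) auto
    have "\<Theta> (b0, x0, 0) = limit_operator \<beta> (grad \<phi> x0) (hessian \<phi> x0)"
      by (simp add: \<Theta>_def P_def H_def mat_0 limit_operator_def b0_def s0_def)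
    then have "(b0, x0, 0) \<in> A \<inter> \<Theta> -` {c<..}"
      using x0 pos by (simp add: A_def c_def)
    then obtain e where e: "0 < e" "ball (b0, x0, 0) e \<subseteq> A \<inter> \<Theta> -` {c<..}"
      using Aop' openE by blast
    define d where "d = e / 3"
    have d: "0 < d" using e by (simp add: d_def)
    have near: "x \<in> \<Omega>" "c < limit_operator (\<lambda>_. b) (P k x) (H k x)"
      if "\<bar>b - b0\<bar> < d" "dist x0 x < d" "\<bar>k\<bar> < d" for b x k
    proof -
      have "dist (b0, x0, 0) (b, x, k) \<le> dist b0 b + dist (x0, 0) (x, k)"
        by (rule dist_Pair_le)
      also have "dist (x0, 0) (x, k) \<le> dist x0 x + dist 0 k"
        by (rule dist_Pair_le)
      finally have "dist (b0, x0, 0) (b, x, k) < e"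
        using that by (simp add: d_def dist_real_def abs_minus_commute)
      then have "(b, x, k) \<in> A \<inter> \<Theta> -` {c<..}" using e by auto
      then show "x \<in> \<Omega>" "c < limit_operator (\<lambda>_. b) (P k x) (H k x)"
        by (auto simp: A_def \<Theta>_def)
    qed
    define \<kappa> where "\<kappa> = d / 2"
    have \<kappa>: "0 < \<kappa>" "\<bar>\<kappa>\<bar> < d" using d by (auto simp: \<kappa>_def)
    \<comment> \<open>a window of slopes around \<open>s0\<close> on which \<open>\<beta>\<close> is nearly constant\<close>
    obtain \<sigma>0 where \<sigma>0: "0 < \<sigma>0" "\<And>s. s \<in> {s0/2..M'} \<Longrightarrow> dist s s0 < \<sigma>0 \<Longrightarrow> dist (\<beta> s) b0 < d / 4"
      using \<beta>cont[unfolded continuous_on_iff, rule_format, of s0 "d / 4"] s0 s0M d unfolding b0_def by force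
    define \<sigma> where "\<sigma> = min (\<sigma>0 / 4) (min (s0 / 4) ((M' - s0) / 2))"
    have \<sigma>: "0 < \<sigma>" "2 * \<sigma> < \<sigma>0" "2 * \<sigma> \<le> s0 / 2" "s0 + 2 * \<sigma> \<le> M'"
    proof -
      have "\<sigma> \<le> \<sigma>0 / 4" "\<sigma> \<le> s0 / 4" "\<sigma> \<le> (M' - s0) / 2"
        unfolding \<sigma>_def by (rule min.cobounded1 min.coboundedI2 order_refl)+
      moreover show "0 < \<sigma>" using \<sigma>0 s0 s0M by (simp add: \<sigma>_def)
      ultimately show "2 * \<sigma> < \<sigma>0" "2 * \<sigma> \<le> s0 / 2" "s0 + 2 * \<sigma> \<le> M'"
        using \<sigma>0(1) by argo+
    qed
    have \<beta>near: "\<bar>\<beta> s - b0\<bar> < d / 4" if "\<bar>s - s0\<bar> \<le> 2 * \<sigma>" for s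
    proof -
      have "s - s0 \<le> 2 * \<sigma>" "s0 - s \<le> 2 * \<sigma>" using that by auto
      then have "s0 / 2 \<le> s" "s \<le> M'" using \<sigma>(3,4) by argo+
      then show ?thesis
        using \<sigma>0(2)[of s] that \<sigma>(2) by (simp add: dist_real_def)
    qed
    \<comment> \<open>the ball of comparison: the touching inequality holds on it, and the slopes of the perturbed test function stay in the window\<close>
    have "continuous_on \<Omega> (\<lambda>x. norm (P \<kappa> x))"
      unfolding P_def by (intro continuous_intros gcont)
    then obtain r1 where r1: "0 < r1" "\<And>x. x \<in> \<Omega> \<Longrightarrow> dist x x0 < r1 \<Longrightarrow> \<bar>norm (P \<kappa> x) - s0\<bar> < \<sigma>"
      using x0 \<sigma>(1) unfolding continuous_on_iff by (force simp: P_def s0_def dist_real_def)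
    obtain r2 where r2: "0 < r2" "\<And>y. dist y x0 < r2 \<Longrightarrow> w y - \<phi> y \<le> w x0 - \<phi> x0"
      using touch unfolding eventually_nhds_metric by blast
    define r where "r = min (d / 2) (min (r1 / 2) (r2 / 2))"
    have r: "0 < r" "r < d" "r < r1" "r < r2" using d r1 r2 by (auto simp: r_def)
    have inball: "dist x0 x < d" "dist x x0 < r1" "dist x x0 < r2" "x \<in> \<Omega>" if "x \<in> cball x0 r" for x
      using that r near(1)[of b0 x 0] d by (auto simp: dist_commute)
    have Pnorm: "\<bar>norm (P \<kappa> x) - s0\<bar> < \<sigma>" if "x \<in> cball x0 r" for x
      using r1(2)[of x] inball[OF that] by simp
    define \<phi>' where "\<phi>' x = \<phi> x + \<kappa> * ((x - x0) \<bullet> (x - x0))" for x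
    have \<phi>'der: "(\<phi>' has_derivative (\<lambda>v. P \<kappa> x \<bullet> v)) (at x)" if x: "x \<in> cball x0 r" for x
    proof -
      have "((\<lambda>x. \<kappa> * ((x - x0) \<bullet> (x - x0))) has_derivative (\<lambda>v. ((2 * \<kappa>) *\<^sub>R (x - x0)) \<bullet> v)) (at x)"
        by (auto intro!: derivative_eq_intros simp: inner_commute algebra_simps)
      from has_derivative_add[OF C2_onD(1)[OF C2 inball(4)[OF x]] this]
      show ?thesis unfolding \<phi>'_def[abs_def] P_def by (simp add: inner_add_left)
    qed
    have Pder: "(P \<kappa> has_derivative (\<lambda>v. H \<kappa> x *v v)) (at x)" if x: "x \<in> cball x0 r" for x
    proof -
      have "((\<lambda>x. (2 * \<kappa>) *\<^sub>R (x - x0)) has_derivative (\<lambda>v. (2 * \<kappa>) *\<^sub>R v)) (at x)"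
        by (auto intro!: derivative_eq_intros)
      moreover have "(mat (2 * \<kappa>) :: real^2^2) *v v = (2 * \<kappa>) *\<^sub>R v" for v
        by (simp add: vec_eq_iff forall_2 matrix_vector_mult_def mat_def sum_2)
      ultimately show ?thesis
        using has_derivative_add[OF C2_onD(2)[OF C2 inball(4)[OF x]]]
        unfolding P_def[abs_def] H_def by (simp add: matrix_vector_mult_add_rdistrib)
    qed
    obtain K where K: "0 \<le> K" "\<And>x. x \<in> cball x0 r \<Longrightarrow> onorm (\<lambda>v. H \<kappa> x *v v) \<le> K"
    proof -
      have sub: "cball x0 r \<subseteq> \<Omega>" using inball(4) by blast
      have "continuous_on (cball x0 r) (H \<kappa>)"
        unfolding H_def[abs_def] by (intro continuous_intros continuous_on_subset[OF hcont sub])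
      then have "bounded (H \<kappa> ` cball x0 r)"
        by (intro compact_imp_bounded compact_continuous_image) auto
      then obtain B where B: "\<forall>x\<in>cball x0 r. norm (H \<kappa> x) \<le> B"
        by (auto simp: bounded_iff)
      show ?thesis
      proof (rule that[of "real CARD(2) * real CARD(2) * \<bar>B\<bar>"])
        fix x assume x: "x \<in> cball x0 r"
        have "\<bar>H \<kappa> x $ i $ j\<bar> \<le> \<bar>B\<bar>" for i j
          using component_le_norm_cart[of "H \<kappa> x $ i" j] Finite_Cartesian_Product.norm_nth_le[of "H \<kappa> x" i] B[rule_format, OF x] by linarith
        then show "onorm (\<lambda>v. H \<kappa> x *v v) \<le> real CARD(2) * real CARD(2) * \<bar>B\<bar>"
          by (rule onorm_le_matrix_component)
      qed simp
    qed
    \<comment> \<open>the margin \<open>\<kappa> * r\<^sup>2\<close>, gained on the sphere by the quadratic perturbation, is shared between the errors of \<open>V n\<close> on the sphere and at the centre\<close>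
    have "0 < \<kappa> * r\<^sup>2 / 3" using \<kappa> r by simp
    then have "\<forall>\<^sub>F n in sequentially. \<forall>x\<in>\<Omega>. dist (V n x) (w x) < \<kappa> * r\<^sup>2 / 3"
      by (rule uniform_limitD[OF lim])
    moreover have "\<forall>\<^sub>F n in sequentially. \<forall>s\<in>{s0 - 2 * \<sigma>..s0 + 2 * \<sigma>}.
        dist ((alpha (F n) \<circ> dual_deriv (F n)) s) (\<beta> s) < d / 4"
    proof -
      have "{s0 - 2 * \<sigma>..s0 + 2 * \<sigma>} \<subseteq> {0..}" using \<sigma> s0 by auto
      then show ?thesis
        using d by (intro uniform_limitD[OF \<beta>[OF compact_Icc]]) auto
    qed
    ultimately have "\<forall>\<^sub>F n in sequentially. (\<forall>x\<in>\<Omega>. dist (V n x) (w x) < \<kappa> * r\<^sup>2 / 3) \<and>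
        (\<forall>s\<in>{s0 - 2 * \<sigma>..s0 + 2 * \<sigma>}. dist ((alpha (F n) \<circ> dual_deriv (F n)) s) (\<beta> s) < d / 4)"
      by (rule eventually_conj)
    then obtain n where Vn: "\<And>x. x \<in> \<Omega> \<Longrightarrow> \<bar>V n x - w x\<bar> < \<kappa> * r\<^sup>2 / 3"
      and an: "\<And>s. \<bar>s - s0\<bar> \<le> 2 * \<sigma> \<Longrightarrow> \<bar>alpha (F n) (dual_deriv (F n) s) - \<beta> s\<bar> < d / 4"
      unfolding eventually_sequentially by (force simp: dist_real_def abs_le_iff)
    interpret L: degenerate_lagrangean "F n" by (rule F)
    obtain \<rho>1 where \<rho>1: "0 \<le> \<rho>1" "\<rho>1 \<le> R" "hderiv (F n) \<rho>1 = s0 - 2 * \<sigma>"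
      using L.hderiv_onto[of "s0 - 2 * \<sigma>" R] \<sigma> s0 range[of n] \<open>0 \<le> R\<close> by auto
    obtain \<rho>2 where \<rho>2: "0 \<le> \<rho>2" "\<rho>2 \<le> R" "hderiv (F n) \<rho>2 = s0 + 2 * \<sigma>"
      using L.hderiv_onto[of "s0 + 2 * \<sigma>" R] \<sigma> s0 range[of n] \<open>0 \<le> R\<close> by auto
    have \<rho>1': "0 < \<rho>1" using \<rho>1 \<sigma> s0 L.hderiv_0 by (cases "\<rho>1 = 0") auto
    have \<rho>12: "\<rho>1 < \<rho>2"
      using regular_hderiv_le[OF L.regular, of \<rho>2 \<rho>1] \<rho>1 \<rho>2 \<sigma>(1) by force
    define m where "m = w x0 - \<phi> x0 - 2 / 3 * (\<kappa> * r\<^sup>2)"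
    have "V n x0 - \<phi>' x0 \<le> m"
    proof (rule L.comparison_with_strict_supersolution[OF U V r(1) _ \<rho>1' \<rho>12 \<sigma>(1) K(1) _ c, where \<delta>' = "d / 2" and \<delta> = "3 / 4 * d" and P = "P \<kappa>" and H = "H \<kappa>" and ?b0.0 = b0])
      show "AE x in lebesgue. x \<in> ball x0 r \<longrightarrow> grad (V n) x = rot (L.stress (grad (U n) x))"
        using conj[of n] by eventually_elim (use inball(4) in auto)
      show "d / 2 < 3 / 4 * d" using d by simp
      show "hderiv (F n) \<rho>1 + \<sigma> \<le> norm (P \<kappa> x) \<and> norm (P \<kappa> x) \<le> hderiv (F n) \<rho>2" if "x \<in> cball x0 r" for x
        using Pnorm[OF that] \<sigma>(1) \<rho>1 \<rho>2 by auto
      show "\<bar>log_slope (F n) \<rho> - b0\<bar> \<le> d / 2" if "\<rho>1 \<le> \<rho>" "\<rho> \<le> \<rho>2" for \<rho>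
      proof -
        have "0 < \<rho>" using that \<rho>1' by simp
        have "hderiv (F n) \<rho>1 \<le> hderiv (F n) \<rho>" "hderiv (F n) \<rho> \<le> hderiv (F n) \<rho>2"
          using that \<rho>1' \<open>0 < \<rho>\<close> by (auto intro!: regular_hderiv_le[OF L.regular])
        then have s: "\<bar>hderiv (F n) \<rho> - s0\<bar> \<le> 2 * \<sigma>" using \<rho>1 \<rho>2 by simp
        have "alpha (F n) (dual_deriv (F n) (hderiv (F n) \<rho>)) = log_slope (F n) \<rho>"
          using \<open>0 < \<rho>\<close> by (simp add: L.dual_deriv_hderiv alpha_def)
        then show ?thesis using an[OF s] \<beta>near[OF s] by argo
      qed
      show "c \<le> limit_operator (\<lambda>_. b) (P \<kappa> x) (H \<kappa> x)" if "x \<in> cball x0 r" "\<bar>b - b0\<bar> \<le> 3 / 4 * d" for x b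
        using near(2)[of b x \<kappa>] inball(1)[OF that(1)] that(2) \<kappa> d by simp
      show "V n x - \<phi>' x \<le> m" if x: "x \<in> sphere x0 r" for x
      proof -
        have xc: "x \<in> cball x0 r" using x by auto
        have "(x - x0) \<bullet> (x - x0) = r\<^sup>2"
          using x by (simp add: dist_norm norm_minus_commute flip: power2_norm_eq_inner)
        then have "\<phi>' x = \<phi> x + \<kappa> * r\<^sup>2" by (simp add: \<phi>'_def)
        moreover have "w x - \<phi> x \<le> w x0 - \<phi> x0" using r2(2) inball(3)[OF xc] by blast
        ultimately show ?thesis
          using Vn[OF inball(4)[OF xc]] unfolding m_def by argo
      qed
    qed (use \<phi>'der Pder K(2) in auto)
    moreover have "\<phi>' x0 = \<phi> x0" by (simp add: \<phi>'_def)
    ultimately show False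
      using Vn[OF x0] unfolding m_def by argo
  qed
qed

section \<open>Bounded slope condition and compactness\<close>

text \<open>From a point of \<open>S\<close> the affine function decreases in the direction \<open>- a\<close>, and the ray leaves the bounded set \<open>S\<close> through its
frontier.\<close>
lemma affine_pos_inside:
  fixes a :: "'a::euclidean_space"
  assumes "open S" "bounded S" "a \<noteq> 0" and fr: "\<And>x. x \<in> frontier S \<Longrightarrow> 0 \<le> a \<bullet> x + b" and x: "x \<in> S"
  shows "0 < a \<bullet> x + b"
proof -
  have nonneg: "0 \<le> a \<bullet> x + b" if x: "x \<in> S" for x
  proof (rule ccontr)
    assume neg: "\<not> ?thesis"
    obtain R where R: "\<And>y. y \<in> S \<Longrightarrow> norm y \<le> R" using assms(2) by (auto simp: bounded_iff)
    define t where "t = (R + norm x + 1) / norm a"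
    have Rx: "0 < R + norm x + 1" using R[OF x] norm_ge_zero[of x] by linarith
    then have t: "0 < t" unfolding t_def using \<open>a \<noteq> 0\<close> by simp
    have "norm (t *\<^sub>R a) = R + norm x + 1"
      using Rx \<open>a \<noteq> 0\<close> by (simp add: t_def)
    moreover have "norm (t *\<^sub>R a) \<le> norm (x - t *\<^sub>R a) + norm x"
      by (metis add.commute norm_minus_commute norm_triangle_sub)
    ultimately have "x - t *\<^sub>R a \<notin> S" using R[of "x - t *\<^sub>R a"] by auto
    then have "closed_segment x (x - t *\<^sub>R a) \<inter> frontier S \<noteq> {}"
      using x by (intro connected_Int_frontier) auto
    then obtain y where y: "y \<in> closed_segment x (x - t *\<^sub>R a)" "y \<in> frontier S" by blast
    then obtain u where u: "0 \<le> u" "y = (1 - u) *\<^sub>R x + u *\<^sub>R (x - t *\<^sub>R a)"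
      by (auto simp: closed_segment_def)
    have "y = x - (u * t) *\<^sub>R a" using u(2) by (simp add: algebra_simps)
    then have "a \<bullet> y + b = a \<bullet> x + b - u * t * (a \<bullet> a)" by (simp add: inner_diff_right)
    moreover have "0 \<le> u * t * (a \<bullet> a)" using u t by simp
    ultimately show False using fr[OF y(2)] neg by linarith
  qed
  show ?thesis
  proof (rule ccontr)
    assume neg: "\<not> ?thesis"
    obtain e where e: "e > 0" "ball x e \<subseteq> S" using assms(1) x openE by blast
    define y where "y = x - (e / (2 * norm a)) *\<^sub>R a"
    have "y \<in> ball x e" using e \<open>a \<noteq> 0\<close> by (simp add: y_def dist_norm)
    then have "0 \<le> a \<bullet> y + b" using nonneg e by blast
    moreover have "a \<bullet> y + b = a \<bullet> x + b - (e / (2 * norm a)) * (a \<bullet> a)" by (simp add: y_def inner_diff_right)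
    moreover have "0 < (e / (2 * norm a)) * (a \<bullet> a)" using e \<open>a \<noteq> 0\<close> by (intro mult_pos_pos) auto
    ultimately show False using neg by linarith
  qed
qed

text \<open>A segment between points of \<open>S\<close> that leaves \<open>S\<close> does so at a point of the frontier, where the supporting function is zero; but
it is positive at both ends.\<close>
lemma convex_of_supporting_halfspaces:
  fixes S :: "'a::euclidean_space set"
  assumes "open S" "bounded S"
    and supp: "\<And>x0. x0 \<in> frontier S \<Longrightarrow> \<exists>a b. a \<noteq> 0 \<and> a \<bullet> x0 + b = 0 \<and> (\<forall>x\<in>frontier S. 0 \<le> a \<bullet> x + b)"
  shows "convex S"
  unfolding convex_contains_segment
proof (intro ballI subsetI)
  fix x y z assume x: "x \<in> S" and y: "y \<in> S" and z: "z \<in> closed_segment x y"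
  show "z \<in> S"
  proof (rule ccontr)
    assume "z \<notin> S"
    then have "closed_segment x y \<inter> frontier S \<noteq> {}"
      using x z by (intro connected_Int_frontier) auto
    then obtain x0 where x0: "x0 \<in> closed_segment x y" "x0 \<in> frontier S" by blast
    then obtain a b where ab: "a \<noteq> 0" "a \<bullet> x0 + b = 0" "\<forall>x\<in>frontier S. 0 \<le> a \<bullet> x + b"
      using supp by blast
    have "0 < a \<bullet> x + b" "0 < a \<bullet> y + b"
      using affine_pos_inside[OF assms(1,2) ab(1), of b] ab(3) x y by auto
    obtain u where u: "0 \<le> u" "u \<le> 1" "x0 = (1 - u) *\<^sub>R x + u *\<^sub>R y"
      using x0(1) by (auto simp: closed_segment_def)
    have "a \<bullet> x0 + b = (1 - u) * (a \<bullet> x + b) + u * (a \<bullet> y + b)"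
      unfolding u(3) by (simp add: inner_add_right algebra_simps)
    moreover have "0 < (1 - u) * (a \<bullet> x + b) + u * (a \<bullet> y + b)"
      using \<open>0 < a \<bullet> x + b\<close> \<open>0 < a \<bullet> y + b\<close> u
      by (cases "u = 0") (auto intro!: add_nonneg_pos)
    ultimately show False using ab(2) by simp
  qed
qed

lemma norm_slope_le:
  fixes a :: "real^2"
  assumes "open S" "x0 \<in> S" "0 \<le> Q"
    and Q: "\<And>x y. x \<in> S \<Longrightarrow> y \<in> S \<Longrightarrow> x \<noteq> y \<Longrightarrow> \<bar>a \<bullet> x + b - (a \<bullet> y + b)\<bar> / norm (x - y) \<le> Q"
  shows "norm a \<le> Q"
proof -
  have "Q-lipschitz_on S (\<lambda>x. a \<bullet> x + b)"
  proof (rule lipschitz_onI)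
    fix x y assume xy: "x \<in> S" "y \<in> S"
    show "dist (a \<bullet> x + b) (a \<bullet> y + b) \<le> Q * dist x y"
    proof (cases "x = y")
      case False
      then show ?thesis using Q[OF xy False] by (simp add: dist_norm field_simps)
    qed simp
  qed fact
  moreover have "(\<lambda>x. a \<bullet> x + b) differentiable (at x0)"
    by (auto intro!: differentiableI derivative_eq_intros)
  ultimately show ?thesis
    using norm_grad_le[OF _ assms(1,2)] grad_affine[of a b x0] by metis
qed

lemma bounded_slope_condition_affine:
  assumes "open \<Omega>" "z \<in> \<Omega>" "0 \<le> Q" "bounded_slope_condition \<Omega> \<psi> Q" "x0 \<in> frontier \<Omega>"
  obtains a b a' b' where "norm a \<le> Q" "norm a' \<le> Q"
    "\<And>x. x \<in> frontier \<Omega> \<Longrightarrow> a' \<bullet> x + b' \<le> \<psi> x \<and> \<psi> x \<le> a \<bullet> x + b"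
    "a' \<bullet> x0 + b' = \<psi> x0" "a \<bullet> x0 + b = \<psi> x0"
proof -
  obtain Lp Lm where L: "affine_fun Lp" "affine_fun Lm"
     "\<forall>x\<in>frontier \<Omega>. Lm x \<le> \<psi> x \<and> \<psi> x \<le> Lp x" "Lm x0 = \<psi> x0" "\<psi> x0 = Lp x0"
     "\<forall>x\<in>\<Omega>. \<forall>y\<in>\<Omega>. x \<noteq> y \<longrightarrow> \<bar>Lp x - Lp y\<bar> / norm (x - y) \<le> Q \<and> \<bar>Lm x - Lm y\<bar> / norm (x - y) \<le> Q"
    using bspec[OF assms(4)[unfolded bounded_slope_condition_def] assms(5)]
    by (elim exE conjE) (rule that; assumption)
  obtain a b where ab: "\<And>x. Lp x = a \<bullet> x + b" using L(1) by (auto simp: affine_fun_def)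
  obtain a' b' where ab': "\<And>x. Lm x = a' \<bullet> x + b'" using L(2) by (auto simp: affine_fun_def)
  have "norm a \<le> Q" by (rule norm_slope_le[OF assms(1,2,3), of a b]) (use L(6) ab in auto)
  moreover have "norm a' \<le> Q" by (rule norm_slope_le[OF assms(1,2,3), of a' b']) (use L(6) ab' in auto)
  moreover have "a' \<bullet> x + b' \<le> \<psi> x \<and> \<psi> x \<le> a \<bullet> x + b" if "x \<in> frontier \<Omega>" for x
    using bspec[OF L(3) that] unfolding ab ab' .
  moreover have "a' \<bullet> x0 + b' = \<psi> x0" "a \<bullet> x0 + b = \<psi> x0"
    using L(4) L(5)[symmetric] unfolding ab ab' .
  ultimately show ?thesis by (rule that)
qed

lemma has_weak_partial_cong:
  assumes "\<And>x. x \<in> S \<Longrightarrow> v x = v' x" "\<And>x. x \<in> S \<Longrightarrow> h x = h' x" and weak: "has_weak_partial S i v h"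
  shows "has_weak_partial S i v' h'"
proof -
  have K: "(\<lambda>x. indicator K x *\<^sub>R v' x) = (\<lambda>x. indicator K x *\<^sub>R v x)"
     "(\<lambda>x. indicator K x *\<^sub>R h' x) = (\<lambda>x. indicator K x *\<^sub>R h x)" if "K \<subseteq> S" for K
    using assms(1,2) that by (fastforce simp: indicator_def fun_eq_iff)+
  have I: "(\<lambda>x. indicator S x *\<^sub>R (v' x * partial i \<phi> x)) = (\<lambda>x. indicator S x *\<^sub>R (v x * partial i \<phi> x))"
      "(\<lambda>x. indicator S x *\<^sub>R (h' x * \<phi> x)) = (\<lambda>x. indicator S x *\<^sub>R (h x * \<phi> x))" for \<phi>
    using assms(1,2) by (auto simp: indicator_def fun_eq_iff)
  show ?thesis
    using weak unfolding has_weak_partial_def set_integrable_def set_lebesgue_integral_def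
    by (auto simp: K I simp del: real_scaleR_def)
qed

lemma (in degenerate_lagrangean) conjugate_extend:
  assumes \<Omega>: "open \<Omega>" and U: "U \<in> Lip UNIV" "\<And>x. x \<in> \<Omega> \<Longrightarrow> U x = u x" and conj: "is_conjugate \<Omega> f u v"
  obtains V where "V \<in> Lip UNIV" "\<And>x. x \<in> \<Omega> \<Longrightarrow> V x = v x"
    "AE x in lebesgue. x \<in> \<Omega> \<longrightarrow> grad V x = rot (stress (grad U x))"
proof -
  obtain C where "C-lipschitz_on \<Omega> v" using conj by (auto simp: is_conjugate_def Lip_def)
  then obtain V where V: "C-lipschitz_on UNIV V" "\<And>x. x \<in> \<Omega> \<Longrightarrow> V x = v x"
    using McShane_extension by metis
  have VL: "V \<in> Lip UNIV" using V(1) by (auto simp: Lip_def)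
  obtain Cu where Cu: "Cu-lipschitz_on UNIV U" using U(1) by (auto simp: Lip_def)
  have fl: "flux f u x = stress (grad U x)" if "x \<in> \<Omega>" for x
    using grad_cong[OF \<Omega> that, of U u] U(2) by (simp add: flux_eq_stress)
  have m: "(\<lambda>x. stress (grad U x)) \<in> borel_measurable lebesgue"
    using measurable_compose[OF grad_measurable[OF U(1)] stress_measurable] .
  have mi: "(\<lambda>x. stress (grad U x) $ i) \<in> borel_measurable lebesgue" for i
    using borel_measurable_inner[OF m borel_measurable_const, of "axis i 1"] by (simp add: inner_axis)
  have bd: "AE x in lebesgue. \<bar>stress (grad U x) $ i\<bar> \<le> hderiv f Cu" for i
    using AE_differentiable[OF U(1)]
  proof eventually_elim
    case (elim x)
    have "norm (grad U x) \<le> Cu" using norm_grad_le[OF Cu _ _ elim] by auto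
    then have "norm (stress (grad U x)) \<le> hderiv f Cu"
      using regular_hderiv_le[OF regular, of "norm (grad U x)" Cu] by (simp add: norm_stress)
    then show ?case using component_le_norm_cart order_trans by blast
  qed
  have "AE x in lebesgue. x \<in> \<Omega> \<longrightarrow> grad V x $ 1 = - (stress (grad U x) $ 2)"
  proof (rule weak_partial_Lip_eq_grad[OF VL \<Omega>])
    show "has_weak_partial \<Omega> 1 V (\<lambda>x. - (stress (grad U x) $ 2))"
      by (rule has_weak_partial_cong[of \<Omega> v V "\<lambda>x. - (flux f u x $ 2)"])
        (use V(2) fl conj in \<open>auto simp: is_conjugate_def\<close>)
    show "AE x in lebesgue. \<bar>- (stress (grad U x) $ 2)\<bar> \<le> hderiv f Cu" using bd[of 2] by simp
  qed (use mi in simp)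
  moreover have "AE x in lebesgue. x \<in> \<Omega> \<longrightarrow> grad V x $ 2 = stress (grad U x) $ 1"
  proof (rule weak_partial_Lip_eq_grad[OF VL \<Omega> _ mi bd])
    show "has_weak_partial \<Omega> 2 V (\<lambda>x. stress (grad U x) $ 1)"
      by (rule has_weak_partial_cong[of \<Omega> v V "\<lambda>x. flux f u x $ 1"])
        (use V(2) fl conj in \<open>auto simp: is_conjugate_def\<close>)
  qed
  ultimately have "AE x in lebesgue. x \<in> \<Omega> \<longrightarrow> grad V x = rot (stress (grad U x))"
    by eventually_elim (simp add: vec_eq_iff forall_2)
  then show ?thesis using that VL V(2) by blast
qed

lemma lipschitz_of_AE_grad_const:
  assumes V: "V \<in> Lip UNIV" and \<Omega>: "open \<Omega>" "connected \<Omega>"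
    and grad: "AE x in lebesgue. x \<in> \<Omega> \<longrightarrow> grad V x = p"
  shows "(norm p)-lipschitz_on \<Omega> V"
proof -
  have L: "(\<lambda>x. p \<bullet> x + 0) \<in> Lip UNIV" by (intro Lip_add Lip_inner Lip_const)
  define W where "W = (\<lambda>x. V x - (p \<bullet> x + 0))"
  have W: "W \<in> Lip UNIV" unfolding W_def using V L by (rule Lip_diff)
  have gW: "AE x in lebesgue. x \<in> \<Omega> \<longrightarrow> grad W x = 0"
    using grad AE_differentiable[OF V] AE_differentiable[OF L]
    by eventually_elim (simp add: W_def grad_diff grad_affine[of p 0, simplified])
  have loc: "\<forall>x\<in>\<Omega>. \<forall>\<^sub>F y in at x within \<Omega>. W x = W y"
  proof
    fix x assume "x \<in> \<Omega>"
    then obtain e where e: "e > 0" "ball x e \<subseteq> \<Omega>" using \<Omega>(1) openE by blast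
    have "0-lipschitz_on (ball x e) W"
      using gW e(2) by (intro lipschitz_of_AE_grad_bound[OF W]) (auto elim!: eventually_mono)
    then have "W x = W y" if "y \<in> ball x e" for y
      using lipschitz_onD[of 0 "ball x e" W x y] that e by simp
    then show "\<forall>\<^sub>F y in at x within \<Omega>. W x = W y"
      unfolding eventually_at using e(1) by (intro exI[of _ e]) (auto simp: dist_commute)
  qed
  show ?thesis
  proof (rule lipschitz_onI)
    fix x y assume "x \<in> \<Omega>" "y \<in> \<Omega>"
    then have "W x = W y" using connected_local_const[OF \<Omega>(2) _ _ loc] by blast
    then have "V x - V y = p \<bullet> (x - y)" by (simp add: W_def inner_diff_right)
    then show "dist (V x) (V y) \<le> norm p * dist x y"
      using Cauchy_Schwarz_ineq2[of p "x - y"] by (simp add: dist_norm)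
  qed simp
qed

text \<open>If the upper and the lower barrier have different slopes at every boundary point, then their differences are supporting functions and
\<open>\<Omega>\<close> is convex. Otherwise both barriers coincide at some point, so \<open>\<psi>\<close> is affine, \<open>U\<close> is affine and \<open>V\<close> has a constant
gradient; then convexity of \<open>\<Omega>\<close> may fail.\<close>
lemma (in degenerate_lagrangean) conjugate_lipschitz:
  assumes \<Omega>: "open \<Omega>" "connected \<Omega>" "\<Omega> \<noteq> {}" "bounded \<Omega>"
    and Q: "0 \<le> Q" "bounded_slope_condition \<Omega> \<psi> Q"
    and min: "lip_minimizer \<Omega> f U" and Ubd: "\<And>x. x \<in> frontier \<Omega> \<Longrightarrow> U x = \<psi> x"
    and V: "V \<in> Lip UNIV" and conj: "AE x in lebesgue. x \<in> \<Omega> \<longrightarrow> grad V x = rot (stress (grad U x))"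
  shows "(hderiv f Q)-lipschitz_on \<Omega> V"
proof -
  interpret variational_problem f \<Omega> by unfold_locales (use \<Omega> in auto)
  obtain z where z: "z \<in> \<Omega>" using \<Omega>(3) by auto
  have U: "U \<in> Lip UNIV" using min by (simp add: lip_minimizer_def)
  note bsc = bounded_slope_condition_affine[OF \<Omega>(1) z Q]
  have "\<bar>U x - U y\<bar> \<le> Q * norm (x - y)" if x: "x \<in> closure \<Omega>" and y: "y \<in> frontier \<Omega>" for x y
  proof -
    obtain a b a' b' where ab: "norm a \<le> Q" "norm a' \<le> Q"
      "\<And>x. x \<in> frontier \<Omega> \<Longrightarrow> a' \<bullet> x + b' \<le> \<psi> x \<and> \<psi> x \<le> a \<bullet> x + b"
      "a' \<bullet> y + b' = \<psi> y" "a \<bullet> y + b = \<psi> y"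
      using bsc[OF y] by metis
    have "a' \<bullet> x + b' \<le> U x \<and> U x \<le> a \<bullet> x + b"
    proof (cases "x \<in> \<Omega>")
      case True
      then show ?thesis
        using lip_minimizer_le_affine[OF min, of a b x] lip_minimizer_ge_affine[OF min, of a' b' x] ab(3) Ubd by auto
    next
      case False
      then have "x \<in> frontier \<Omega>" using x \<Omega>(1) by (simp add: frontier_def interior_open)
      then show ?thesis using ab(3) Ubd by auto
    qed
    moreover have "\<bar>p \<bullet> (x - y)\<bar> \<le> Q * norm (x - y)" if "norm p \<le> Q" for p
      using Cauchy_Schwarz_ineq2[of p "x - y"] mult_right_mono[OF that, of "norm (x - y)"] by simp
    from this[OF ab(1)] this[OF ab(2)] have "\<bar>a \<bullet> x - a \<bullet> y\<bar> \<le> Q * norm (x - y)" "\<bar>a' \<bullet> x - a' \<bullet> y\<bar> \<le> Q * norm (x - y)"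
      by (simp_all add: inner_diff_right)
    ultimately show ?thesis using ab(4,5) Ubd[OF y] by linarith
  qed
  then have UQ: "Q-lipschitz_on \<Omega> U" by (intro lip_minimizer_lipschitz[OF min _ Q(1)])
  show ?thesis
  proof (cases "convex \<Omega>")
    case True
    show ?thesis
    proof (rule lipschitz_of_AE_grad_bound[OF V \<Omega>(1) True])
      show "AE x in lebesgue. x \<in> \<Omega> \<longrightarrow> norm (grad V x) \<le> hderiv f Q"
        using conj AE_differentiable[OF U]
      proof eventually_elim
        case (elim x)
        show ?case
        proof
          assume x: "x \<in> \<Omega>"
          have "norm (grad U x) \<le> Q" using norm_grad_le[OF UQ \<Omega>(1) x elim(2)] .
          then show "norm (grad V x) \<le> hderiv f Q"
            using elim(1) x regular_hderiv_le[OF regular, of "norm (grad U x)" Q]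
            by (simp add: norm_rot norm_stress)
        qed
      qed
    qed (use hderiv_nonneg Q in simp)
  next
    case False
    have "\<exists>x0\<in>frontier \<Omega>. \<not> (\<exists>a b. a \<noteq> 0 \<and> a \<bullet> x0 + b = 0 \<and> (\<forall>x\<in>frontier \<Omega>. 0 \<le> a \<bullet> x + b))"
    proof (rule ccontr)
      assume "\<not> ?thesis"
      then have "convex \<Omega>" by (intro convex_of_supporting_halfspaces[OF \<Omega>(1,4)]) blast
      with False show False by simp
    qed
    then obtain x0 where x0: "x0 \<in> frontier \<Omega>"
      "\<And>a b. a \<noteq> 0 \<Longrightarrow> a \<bullet> x0 + b = 0 \<Longrightarrow> (\<forall>x\<in>frontier \<Omega>. 0 \<le> a \<bullet> x + b) \<Longrightarrow> False" by blast
    obtain a b a' b' where ab: "norm a \<le> Q" "norm a' \<le> Q"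
      "\<And>x. x \<in> frontier \<Omega> \<Longrightarrow> a' \<bullet> x + b' \<le> \<psi> x \<and> \<psi> x \<le> a \<bullet> x + b"
      "a' \<bullet> x0 + b' = \<psi> x0" "a \<bullet> x0 + b = \<psi> x0"
      using bsc[OF x0(1)] by metis
    have "a - a' = 0"
    proof (rule ccontr)
      assume "a - a' \<noteq> 0"
      then show False
      proof (rule x0(2)[of "a - a'" "b - b'"])
        show "(a - a') \<bullet> x0 + (b - b') = 0" using ab(4,5) by (simp add: inner_diff_left)
        show "\<forall>x\<in>frontier \<Omega>. 0 \<le> (a - a') \<bullet> x + (b - b')"
          using ab(3) by (fastforce simp: inner_diff_left)
      qed
    qed
    then have eq: "a' = a" "b' = b" using ab(4,5) by auto
    have Uaff: "U x = a \<bullet> x + b" if "x \<in> \<Omega>" for x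
      using lip_minimizer_le_affine[OF min, of a b x] lip_minimizer_ge_affine[OF min, of a b x] ab(3) Ubd that
      unfolding eq by (force intro: antisym)
    have "grad U x = a" if "x \<in> \<Omega>" for x
      using grad_cong[OF \<Omega>(1) that, of U "\<lambda>x. a \<bullet> x + b"] Uaff grad_affine[of a b x] by simp
    then have "AE x in lebesgue. x \<in> \<Omega> \<longrightarrow> grad V x = rot (stress a)"
      using conj by (auto elim: eventually_mono)
    then have "(norm (rot (stress a)))-lipschitz_on \<Omega> V"
      by (rule lipschitz_of_AE_grad_const[OF V \<Omega>(1,2)])
    moreover have "norm (rot (stress a)) \<le> hderiv f Q"
      using regular_hderiv_le[OF regular _ ab(1)] by (simp add: norm_rot norm_stress)
    ultimately show ?thesis by (rule lipschitz_on_mono[OF _ order_refl])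
  qed
qed

text \<open>A Lipschitz function oscillates by at most \<open>M * D\<close>; if it exceeded this value somewhere, it would be positive throughout.\<close>
lemma abs_le_of_mean_zero:
  assumes \<Omega>: "open \<Omega>" "bounded \<Omega>" and V: "V \<in> Lip UNIV" and M: "M-lipschitz_on \<Omega> V"
    and mean: "(LINT x:\<Omega>|lebesgue. V x) = 0" and D: "\<And>x y. x \<in> \<Omega> \<Longrightarrow> y \<in> \<Omega> \<Longrightarrow> dist x y \<le> D" and x: "x \<in> \<Omega>"
  shows "\<bar>V x\<bar> \<le> M * D"
proof -
  have M0: "0 \<le> M" using M by (rule lipschitz_on_nonneg)
  have upper: "W x \<le> M * D"
    if W: "W \<in> Lip UNIV" and WM: "M-lipschitz_on \<Omega> W" and Wmean: "(LINT x:\<Omega>|lebesgue. W x) = 0" for W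
  proof -
    define c where "c = W x - M * D"
    have cW: "c \<le> W y" if "y \<in> \<Omega>" for y
    proof -
      have "\<bar>W x - W y\<bar> \<le> M * dist x y" using lipschitz_onD[OF WM x that] by (simp add: dist_real_def)
      also have "\<dots> \<le> M * D" using D[OF x that] M0 by (rule mult_left_mono)
      finally show ?thesis by (simp add: c_def)
    qed
    have fin: "\<Omega> \<in> lmeasurable" using \<Omega> by (rule lmeasurable_open[rotated])
    have "0 < measure lebesgue \<Omega>"
      using open_not_negligible[OF \<Omega>(1)] x fin negligible_iff_measure zero_less_measure_iff by blast
    moreover have "c * measure lebesgue \<Omega> \<le> 0"
    proof -
      obtain R where R: "\<And>x. R \<le> norm x \<Longrightarrow> x \<notin> \<Omega>" using bounded_outside_ball[OF \<Omega>(2)] by blast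
      have "compact (W ` closure \<Omega>)"
        using \<Omega>(2) by (intro compact_continuous_image continuous_Lip_UNIV[OF W]) (simp add: compact_closure)
      then obtain B where B: "\<And>y. y \<in> closure \<Omega> \<Longrightarrow> \<bar>W y\<bar> \<le> B"
        using compact_imp_bounded[THEN bounded_iff[THEN iffD1]] by fastforce
      have int: "integrable lebesgue (\<lambda>y. indicator \<Omega> y * W y)"
      proof (rule integrable_bounded_support[of _ "\<bar>B\<bar>" R])
        show "(\<lambda>y. indicator \<Omega> y * W y) \<in> borel_measurable lebesgue"
          using lebesgue_measurable_Lip[OF W] \<Omega>(1) by (intro borel_measurable_times borel_measurable_indicator) auto
        have "\<bar>indicator \<Omega> y * W y\<bar> \<le> \<bar>B\<bar>" for y
          using B[of y] closure_subset[of \<Omega>] by (cases "y \<in> \<Omega>") auto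
        then show "AE y in lebesgue. \<bar>indicator \<Omega> y * W y\<bar> \<le> \<bar>B\<bar>" by simp
      qed (use R in auto)
      have "(LINT y|lebesgue. c * indicator \<Omega> y) \<le> (LINT y|lebesgue. indicator \<Omega> y * W y)"
      proof (rule integral_mono[OF _ int])
        show "integrable lebesgue (\<lambda>y. c * indicator \<Omega> y)"
          using fin by (intro integrable_mult_right integrable_real_indicator) (auto simp: fmeasurable_def)
        show "c * indicator \<Omega> y \<le> indicator \<Omega> y * W y" for y
          using cW by (auto simp: indicator_def)
      qed
      then show ?thesis using Wmean by (simp add: set_lebesgue_integral_def)
    qed
    ultimately have "c \<le> 0" by (simp add: mult_le_0_iff)
    then show ?thesis by (simp add: c_def)
  qed
  have "(LINT x:\<Omega>|lebesgue. - V x) = 0"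
    using mean by (simp add: set_lebesgue_integral_def)
  then show ?thesis
    using upper[OF V M mean] upper[OF Lip_minus[OF V]] M by auto
qed

theorem theorem3p8:
  fixes \<Omega> :: "(real^2) set" and \<psi> :: "real^2 \<Rightarrow> real" and Q :: real
    and f :: "real \<Rightarrow> real" and F :: "nat \<Rightarrow> real \<Rightarrow> real"
    and u v :: "nat \<Rightarrow> real^2 \<Rightarrow> real" and \<beta> :: "real \<Rightarrow> real"
  assumes "open \<Omega>" and "connected \<Omega>" and "\<Omega> \<noteq> {}" and "bounded \<Omega>" and "simply_connected \<Omega>"
    and "continuous_on (frontier \<Omega>) \<psi>"
    and "Q > 0" and "bounded_slope_condition \<Omega> \<psi> Q"
    and "admissible_lagrangean f"
    and "uniform_limit {0..} F f sequentially"
    and "\<And>n. regular_lagrangean (F n)"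
    and "\<And>n. hderiv (F n) 0 = 0"
    and "\<And>n. is_minimizer \<Omega> \<psi> (F n) (u n)"
    and "\<And>n. is_conjugate \<Omega> (F n) (u n) (v n)"
    and "\<And>n. \<exists>c>0. (log_slope (F n) \<longlongrightarrow> c) (at_right 0)"
    and "\<And>K. compact K \<Longrightarrow> K \<subseteq> {0..} \<Longrightarrow>
           uniform_limit K (\<lambda>n. alpha (F n) \<circ> dual_deriv (F n)) \<beta> sequentially"
  shows "\<exists>r w. strict_mono (r :: nat \<Rightarrow> nat) \<and> uniform_limit \<Omega> (v \<circ> r) w sequentially
           \<and> viscosity_solution \<Omega> (limit_operator \<beta>) w"
proof -
  note \<Omega> = assms(1-4) and F_lim = assms(10) and \<beta>_lim = assms(16)
  have Q: "0 \<le> Q" using assms(7) by simp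
  have F: "degenerate_lagrangean (F n)" for n
    using assms(11,12) by unfold_locales
  define good where "good n U V \<longleftrightarrow> lip_minimizer \<Omega> (F n) U \<and> (\<forall>x\<in>frontier \<Omega>. U x = \<psi> x) \<and>
      V \<in> Lip UNIV \<and> (\<forall>x\<in>\<Omega>. V x = v n x) \<and>
      (AE x in lebesgue. x \<in> \<Omega> \<longrightarrow> grad V x = rot (degenerate_lagrangean.stress (F n) (grad U x)))" for n U V
  have "\<exists>U V. good n U V" for n
  proof -
    obtain U where U: "lip_minimizer \<Omega> (F n) U" "\<And>x. x \<in> closure \<Omega> \<Longrightarrow> U x = u n x"
      "\<And>x. x \<in> frontier \<Omega> \<Longrightarrow> U x = \<psi> x"
      using is_minimizer_extend[OF \<Omega>(1) assms(13)] by metis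
    have UL: "U \<in> Lip UNIV" using U(1) by (simp add: lip_minimizer_def)
    have Uu: "U x = u n x" if "x \<in> \<Omega>" for x using U(2) that closure_subset by blast
    obtain V where V: "V \<in> Lip UNIV" "\<And>x. x \<in> \<Omega> \<Longrightarrow> V x = v n x"
      "AE x in lebesgue. x \<in> \<Omega> \<longrightarrow> grad V x = rot (degenerate_lagrangean.stress (F n) (grad U x))"
      using degenerate_lagrangean.conjugate_extend[OF F \<Omega>(1) UL Uu assms(14)] by blast
    show ?thesis
      unfolding good_def by (intro exI[of _ U] exI[of _ V]) (use U V in auto)
  qed
  then obtain U V where good: "\<And>n. good n (U n) (V n)"
    by metis
  have U: "\<And>n. lip_minimizer \<Omega> (F n) (U n)" "\<And>n x. x \<in> frontier \<Omega> \<Longrightarrow> U n x = \<psi> x"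
    and V: "\<And>n. V n \<in> Lip UNIV" "\<And>n x. x \<in> \<Omega> \<Longrightarrow> V n x = v n x"
    and conj: "\<And>n. AE x in lebesgue. x \<in> \<Omega> \<longrightarrow> grad (V n) x = rot (degenerate_lagrangean.stress (F n) (grad (U n) x))"
    using good unfolding good_def by blast+
  have UL: "U n \<in> Lip UNIV" for n using U(1) by (simp add: lip_minimizer_def)
  have VQ: "(hderiv (F n) Q)-lipschitz_on \<Omega> (V n)" for n
    by (rule degenerate_lagrangean.conjugate_lipschitz[OF F \<Omega> Q assms(8) U V(1) conj])
  \<comment> \<open>strict convexity of \<open>f\<close> separates its difference quotients to the right of \<open>Q\<close> and \<open>Q + 1\<close>\<close>
  define A where "A = f (Q + 1) - f Q"
  define B where "B = f (Q + 2) - f (Q + 1)"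
  define M where "M = (2 * A + B) / 3"
  define M' where "M' = (A + 2 * B) / 3"
  have "A < B"
  proof -
    have "\<forall>x\<in>{0..}. \<forall>y\<in>{0..}. \<forall>t. x \<noteq> y \<and> 0 < t \<and> t < 1 \<longrightarrow> f ((1 - t) * x + t * y) < (1 - t) * f x + t * f y"
      using assms(9) unfolding admissible_lagrangean_def regular_lagrangean_def strictly_convex_on_def by blast
    from this[rule_format, of Q "Q + 2" "1/2"] Q
    have "f ((1 - 1/2) * Q + 1/2 * (Q + 2)) < (1 - 1/2) * f Q + 1/2 * f (Q + 2)" by simp
    moreover have "(1 - 1/2) * Q + 1/2 * (Q + 2) = Q + 1" by argo
    ultimately show ?thesis unfolding A_def B_def by argo
  qed
  then have MM': "A < M" "M < M'" "M' < B" unfolding M_def M'_def by argo+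
  have Flim: "(\<lambda>n. F n x) \<longlonglongrightarrow> f x" if "0 \<le> x" for x
    using tendsto_uniform_limitI[OF F_lim, of x] that by simp
  have "\<forall>\<^sub>F n in sequentially. F n (Q + 1) - F n Q < M"
    using Q MM' by (intro order_tendstoD(2)[OF tendsto_diff[OF Flim Flim]]) (auto simp: A_def)
  moreover have "\<forall>\<^sub>F n in sequentially. M' < F n (Q + 2) - F n (Q + 1)"
    using Q MM' by (intro order_tendstoD(1)[OF tendsto_diff[OF Flim Flim]]) (auto simp: B_def)
  ultimately obtain N where N: "\<And>n. N \<le> n \<Longrightarrow> F n (Q + 1) - F n Q < M \<and> M' < F n (Q + 2) - F n (Q + 1)"
    using eventually_conj unfolding eventually_sequentially by (metis (mono_tags, lifting) linorder_le_cases order_trans)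
  have low: "hderiv (F n) Q \<le> M" if "N \<le> n" for n
    using regular_tangent_less[OF assms(11), of Q "Q + 1" n] N[OF that] Q by simp
  have high: "M' \<le> hderiv (F n) (Q + 2)" if "N \<le> n" for n
    using regular_tangent_less[OF assms(11), of "Q + 2" "Q + 1" n] N[OF that] Q by simp
  have VM: "M-lipschitz_on \<Omega> (V (n + N))" for n
    by (rule lipschitz_on_mono[OF VQ order_refl low]) simp
  have M0: "0 \<le> M" using VM[of 0] by (rule lipschitz_on_nonneg)
  have "\<exists>W. M-lipschitz_on UNIV W \<and> (\<forall>x\<in>\<Omega>. W x = V (n + N) x)" for n
    by (rule McShane_extension[OF VM[of n]]) (intro exI conjI ballI, assumption+)
  then have "\<exists>W. \<forall>n. M-lipschitz_on UNIV (W n) \<and> (\<forall>x\<in>\<Omega>. W n x = V (n + N) x)"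
    by (intro choice allI)
  then obtain W where "\<forall>n. M-lipschitz_on UNIV (W n) \<and> (\<forall>x\<in>\<Omega>. W n x = V (n + N) x)" ..
  then have W: "\<And>n. M-lipschitz_on UNIV (W n)" "\<And>n x. x \<in> \<Omega> \<Longrightarrow> W n x = V (n + N) x"
    by blast+
  obtain z where z: "z \<in> \<Omega>" using \<Omega>(3) by auto
  have bcl: "bounded (closure \<Omega>)" using \<Omega>(4) by (rule bounded_closure)
  obtain D where D: "\<And>x y. x \<in> closure \<Omega> \<Longrightarrow> y \<in> closure \<Omega> \<Longrightarrow> dist x y \<le> D"
    using bounded_two_points[THEN iffD1, OF bcl] by blast
  have D': "dist x y \<le> D" if "x \<in> \<Omega>" "y \<in> \<Omega>" for x y
    using D that closure_subset by blast
  have mean: "(LINT x:\<Omega>|lebesgue. V n x) = 0" for n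
  proof -
    have "(\<lambda>x. indicator \<Omega> x *\<^sub>R V n x) = (\<lambda>x. indicator \<Omega> x *\<^sub>R v n x)"
      using V(2) by (auto simp: indicator_def fun_eq_iff)
    then show ?thesis
      using assms(14)[of n] by (simp add: is_conjugate_def set_lebesgue_integral_def)
  qed
  have Wbd: "norm (W n x) \<le> M * D + M * D" if x: "x \<in> closure \<Omega>" for n x
  proof -
    have "\<bar>W n z\<bar> \<le> M * D"
      using abs_le_of_mean_zero[OF \<Omega>(1,4) V(1) VM mean D' z] W(2)[OF z] by simp
    moreover have "\<bar>W n x - W n z\<bar> \<le> M * dist x z"
      using lipschitz_onD[OF W(1), of x z n] by (simp add: dist_real_def)
    moreover have "M * dist x z \<le> M * D"
      using D[OF x, of z] z closure_subset M0 by (intro mult_left_mono) auto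
    ultimately show ?thesis unfolding real_norm_def by linarith
  qed
  have equi: "\<exists>d. 0 < d \<and> (\<forall>n y. y \<in> closure \<Omega> \<and> norm (x - y) < d \<longrightarrow> norm (W n x - W n y) < e)"
    if "0 < e" for x e
  proof (intro exI[of _ "e / (M + 1)"] conjI allI impI)
    show "0 < e / (M + 1)" using that M0 by simp
    fix n y assume "y \<in> closure \<Omega> \<and> norm (x - y) < e / (M + 1)"
    then have "(M + 1) * norm (x - y) < e" using M0 by (simp add: field_simps)
    moreover have "norm (W n x - W n y) \<le> M * norm (x - y)"
      using lipschitz_onD[OF W(1), of x y n] by (simp add: dist_norm)
    moreover have "M * norm (x - y) \<le> (M + 1) * norm (x - y)" by (intro mult_right_mono) auto
    ultimately show "norm (W n x - W n y) < e" by linarith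
  qed
  have cpt: "compact (closure \<Omega>)" using \<Omega>(4) by (simp add: compact_closure)
  obtain w k where k: "strict_mono (k :: nat \<Rightarrow> nat)"
    and wlim: "\<And>e. 0 < e \<Longrightarrow> \<exists>n0. \<forall>n x. n0 \<le> n \<and> x \<in> closure \<Omega> \<longrightarrow> norm (W (k n) x - w x) < e"
    by (rule Arzela_Ascoli[of "closure \<Omega>" W, OF cpt Wbd equi]) blast+
  define r where "r n = k n + N" for n
  have r: "strict_mono r" using k by (simp add: r_def strict_mono_def)
  have rN: "N \<le> r n" for n by (simp add: r_def)
  have Vlim: "uniform_limit \<Omega> (\<lambda>n. V (r n)) w sequentially"
    unfolding uniform_limit_iff
  proof (intro allI impI)
    fix e :: real assume "0 < e"
    then obtain n0 where "\<And>n x. n0 \<le> n \<Longrightarrow> x \<in> closure \<Omega> \<Longrightarrow> norm (W (k n) x - w x) < e"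
      using wlim by blast
    then show "\<forall>\<^sub>F n in sequentially. \<forall>x\<in>\<Omega>. dist (V (r n) x) (w x) < e"
      unfolding eventually_sequentially r_def using W(2) closure_subset
      by (intro exI[of _ n0]) (fastforce simp: dist_norm)
  qed
  have vlim: "uniform_limit \<Omega> (v \<circ> r) w sequentially"
    by (rule uniform_limit_cong'[THEN iffD1, OF _ _ Vlim]) (auto simp: V(2))
  have wM: "M-lipschitz_on \<Omega> w"
  proof (rule lipschitz_onI)
    fix x y assume xy: "x \<in> \<Omega>" "y \<in> \<Omega>"
    have "(\<lambda>n. dist (V (r n) x) (V (r n) y)) \<longlonglongrightarrow> dist (w x) (w y)"
      by (intro tendsto_dist tendsto_uniform_limitI[OF Vlim] xy)
    then show "dist (w x) (w y) \<le> M * dist x y"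
    proof (rule LIMSEQ_le_const2)
      show "\<exists>n0. \<forall>n\<ge>n0. dist (V (r n) x) (V (r n) y) \<le> M * dist x y"
        using lipschitz_onD[OF VM xy] by (simp add: r_def)
    qed
  qed fact
  have \<beta>r: "uniform_limit K (\<lambda>n. alpha (F (r n)) \<circ> dual_deriv (F (r n))) \<beta> sequentially"
    if "compact K" "K \<subseteq> {0..}" for K
    using filterlim_compose[OF \<beta>_lim[OF that] filterlim_subseq[OF r]] by simp
  have sub: "viscosity_subsolution \<Omega> (limit_operator \<beta>) w"
    by (rule viscosity_subsolution_of_uniform_limit[of \<Omega> "\<lambda>n. F (r n)" "\<lambda>n. U (r n)" "\<lambda>n. V (r n)" w M M' "Q + 2" \<beta>,
          OF \<Omega>(1) F UL V(1) conj Vlim wM MM'(2) _ high[OF rN] \<beta>r]) (use Q in auto)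
  have "viscosity_subsolution \<Omega> (limit_operator \<beta>) (\<lambda>x. - w x)"
  proof (rule viscosity_subsolution_of_uniform_limit[of \<Omega> "\<lambda>n. F (r n)" "\<lambda>n x. - U (r n) x" "\<lambda>n x. - V (r n) x" "\<lambda>x. - w x" M M' "Q + 2" \<beta>,
          OF \<Omega>(1) F Lip_minus[OF UL] Lip_minus[OF V(1)] _ _ _ MM'(2) _ high[OF rN] \<beta>r])
    show "AE x in lebesgue. x \<in> \<Omega> \<longrightarrow> grad (\<lambda>x. - V (r n) x) x
        = rot (degenerate_lagrangean.stress (F (r n)) (grad (\<lambda>x. - U (r n) x) x))" for n
    proof -
      interpret degenerate_lagrangean "F (r n)" by (rule F)
      have odd: "rot (stress (- p)) = - rot (stress p)" for p
        by (simp add: stress_def rot_def vec_eq_iff forall_2)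
      show ?thesis
        using conj[of "r n"] AE_differentiable[OF UL[of "r n"]] AE_differentiable[OF V(1)[of "r n"]]
        by eventually_elim (simp add: grad_minus odd)
    qed
    show "uniform_limit \<Omega> (\<lambda>n x. - V (r n) x) (\<lambda>x. - w x) sequentially"
      using Vlim by (rule uniform_limit_uminus)
    show "M-lipschitz_on \<Omega> (\<lambda>x. - w x)" using wM by simp
  qed (use Q in auto)
  then have "viscosity_supersolution \<Omega> (limit_operator \<beta>) w"
    by (rule viscosity_supersolution_of_subsolution_uminus[OF \<Omega>(1)])
  then show ?thesis
    using r vlim sub by (auto simp: viscosity_solution_def)
qed

end
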